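(* Let $\mu\in\mathbb{R}$, $\Omega=\{0,1\}^{\mathbb{Z}}$ with the uniform Bernoulli measure $\nu=\{1/2,1/2\}^{\mathbb{Z}}$, let $T:\Omega\to\Omega$ be the shift $(T\omega)_n=\omega_{n+1}$, and put \[ f(\omega)=1+(-1)^{\omega_{-1}},\qquad g(\omega)=\mu(-1)^{\omega_0+1}. \] Let $\{H_{\mu,\omega}\}_{\omega\in\Omega}$ be the random family of operators on $\ell^2(\mathbb{Z})$ given by \[ (H_{\mu,\omega}u)(n)=f(T^n\omega)u(n-1)+g(T^n\omega)u(n)+f(T^{n+1}\omega)u(n+1). \] Let $M_\mu$ be the operator of convolution on $\ell^2(\mathcal{L})$ by $a+a^{-1}+b+b^{-1}-\mu c$, with $\mathcal{L}$ the lamplighter group as in the context. Then: (a) For $\nu$-almost every $\omega$, the operator $H_{\mu,\omega}$ has pure point spectrum, and as a set its spectrum equals the spectrum of $M_\mu$, i.e. the closure of the set of eigenvalues of $M_\mu$: this is the interval $[-4-\mu,4-\mu]$ if $|\mu|\le1$, and, if $|\mu|>1$, it is the closure of a countable set of eigenvalues that is dense in the interval $[-4-\mu,4-\mu]$ and that also has the accumulation point $\mu+2/\mu\notin[-4-\mu,4-\mu]$. (b) The density of states of $H_{\mu,\omega}$ is discrete and equals \[ \frac{1}{4}\delta_{\mu}+\sum_{k=2}^{\infty}\left[\frac{1}{2^{k+1}}\sum_{\{s:\,G_{k}(s,\mu)=0\}}\delta_s\right],\qquad G_{k}(z,\mu)=2^k\left[U_k\left(\tfrac{-z-\mu}{4}\right)+\mu\,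 U_{k-1}\left(\tfrac{-z-\mu}{4}\right)\right], \] where $U_k$ is the degree $k$ Chebyshev polynomial of the second kind and zeros of $G_k(\cdot,\mu)$ are counted with multiplicities; this measure is the spectral measure of $M_\mu$ at the delta function $\delta_1\in\ell^2(\mathcal{L})$.
   Context: The lamplighter group is $\mathcal{L}=\mathbb{Z}/2\mathbb{Z}\wr\mathbb{Z}=\left(\bigoplus_{\mathbb{Z}}\mathbb{Z}/2\mathbb{Z}\right)\rtimes\mathbb{Z}$, where a generator $a$ of $\mathbb{Z}$ acts on $\bigoplus_{\mathbb{Z}}\mathbb{Z}/2\mathbb{Z}$ by the automorphism induced by the shift of the index set $\mathbb{Z}$. The element $c$ (of order $2$) is $(\ldots,0,0,1,0,0,\ldots)\in\bigoplus_{\mathbb{Z}}\mathbb{Z}/2\mathbb{Z}$ with the entry $1$ at position $0$, and $b\in\mathcal{L}$ is determined by $c=b^{-1}a$ (so $b=ac$). The operator of convolution by an element of the group algebra is its image under the (left) regular representation on $\ell^2(\mathcal{L})$. The spectral measure of a self-adjoint operator with spectral projections $E$ at a vector $v$ is $B\mapsto\langle E(B)v,v\rangle$. The density of states of the family $\{H_{\mu,\omega}\}_{\omega\in\Omega}$ is the average over $(\Omega,\nu)$ of the spectral measures of $H_{\mu,\omega}$ at the delta function at the origin $\delta_0\in\ell^2(\mathbb{Z})$. "Pure point spectrum" means that the Hilbert space has an orthonormal basis of eigenvectors. The Chebyshev polynomials of the second kind are $U_0(x)=1$, $U_1(x)=2x$, $U_{n+1}(x)=2xU_n(x)-U_{n-1}(x)$.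 $\delta_s$ (for $s\in\mathbb{R}$) is the unit point mass at $s$. *)

theory Defs
  imports
    "HOL-Probability.Probability"
    "HOL-Algebra.Group"
    "HOL-Library.Poly_Mapping"
    "HOL-Library.Z2"
    "HOL-Computational_Algebra.Polynomial"
begin

section \<open>The complex Hilbert space of square-summable functions\<close>

typedef 'a ell2 = "{u :: 'a \<Rightarrow> complex. (\<lambda>x. (cmod (u x))\<^sup>2) summable_on UNIV}"
  by (rule exI[of _ "\<lambda>_. 0"]) simp

setup_lifting type_definition_ell2

lemma cmod_add_sq_le: "(cmod (a + b))\<^sup>2 \<le> 2 * ((cmod a)\<^sup>2 + (cmod b)\<^sup>2)"
proof -
  have "(cmod (a + b))\<^sup>2 \<le> (cmod a + cmod b)\<^sup>2"
    by (simp add: norm_triangle_ineq power_mono)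
  also have "\<dots> \<le> 2 * ((cmod a)\<^sup>2 + (cmod b)\<^sup>2)"
    using sum_squares_bound[of "cmod a" "cmod b"] by (simp add: power2_sum)
  finally show ?thesis .
qed

lemma square_summable_add:
  assumes "(\<lambda>x. (cmod (u x))\<^sup>2) summable_on UNIV" "(\<lambda>x. (cmod (v x))\<^sup>2) summable_on UNIV"
  shows "(\<lambda>x. (cmod (u x + v x))\<^sup>2) summable_on UNIV"
  by (rule summable_on_comparison_test
      [OF summable_on_cmult_right[OF summable_on_add[OF assms], of 2]])
    (use cmod_add_sq_le in simp_all)

lemma square_summable_bounded_mult:
  assumes "(\<lambda>x. (cmod (u x))\<^sup>2) summable_on UNIV" "\<And>x. cmod (w x) \<le> C"
  shows "(\<lambda>x. (cmod (w x * u x))\<^sup>2) summable_on UNIV"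
  by (rule summable_on_comparison_test[OF summable_on_cmult_right[OF assms(1), of "C\<^sup>2"]])
    (auto simp: norm_mult power_mult_distrib intro!: mult_right_mono power_mono assms(2))

lemma square_summable_bij:
  assumes "(\<lambda>x. (cmod (u x))\<^sup>2) summable_on UNIV" "bij h"
  shows "(\<lambda>x. (cmod (u (h x)))\<^sup>2) summable_on UNIV"
  using summable_on_reindex_bij_betw[OF assms(2), of "\<lambda>x. (cmod (u x))\<^sup>2"] assms(1) by simp

lemma square_summable_mult:
  assumes "(\<lambda>x. (cmod (u x))\<^sup>2) summable_on UNIV" "(\<lambda>x. (cmod (v x))\<^sup>2) summable_on UNIV"
  shows "(\<lambda>x. u x * cnj (v x)) summable_on UNIV"
proof (rule abs_summable_summable, rule Infinite_Sum.abs_summable_on_comparison_test')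
  show "(\<lambda>x. (cmod (u x))\<^sup>2 + (cmod (v x))\<^sup>2) summable_on UNIV"
    by (rule summable_on_add[OF assms])
  show "cmod (u x * cnj (v x)) \<le> (cmod (u x))\<^sup>2 + (cmod (v x))\<^sup>2" for x
    using sum_squares_bound[of "cmod (u x)" "cmod (v x)"]
      mult_nonneg_nonneg[OF norm_ge_zero norm_ge_zero, of "u x" "v x"]
    unfolding norm_mult complex_mod_cnj by linarith
qed

lift_definition scaleC :: "complex \<Rightarrow> 'a ell2 \<Rightarrow> 'a ell2"  (infixr "*\<^sub>C" 75)
  is "\<lambda>c u x. c * u x"
  by (rule square_summable_bounded_mult[where C = "cmod c" for c]) auto

lift_definition cinner :: "'a ell2 \<Rightarrow> 'a ell2 \<Rightarrow> complex"
  is "\<lambda>u v. \<Sum>\<^sub>\<infinity>x. u x * cnj (v x)" .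

lift_definition delta :: "'a \<Rightarrow> 'a ell2"
  is "\<lambda>a x. if x = a then 1 else 0"
proof -
  fix a :: 'a
  have "finite {x. (cmod (if x = a then 1 else 0))\<^sup>2 \<noteq> 0}"
    by (rule finite_subset[of _ "{a}"]) auto
  then show "(\<lambda>x. (cmod (if x = a then 1 else 0))\<^sup>2) summable_on UNIV"
    by (intro summable_on_cong_neutral[THEN iffD1, OF _ _ _ summable_on_finite[of "{a}"]]) auto
qed

instantiation ell2 :: (type) real_vector
begin

lift_definition zero_ell2 :: "'a ell2" is "\<lambda>_. 0" by simp

lift_definition plus_ell2 :: "'a ell2 \<Rightarrow> 'a ell2 \<Rightarrow> 'a ell2" is "\<lambda>u v x. u x + v x"
  by (rule square_summable_add)

lift_definition uminus_ell2 :: "'a ell2 \<Rightarrow> 'a ell2" is "\<lambda>u x. - u x" by simp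

definition minus_ell2 :: "'a ell2 \<Rightarrow> 'a ell2 \<Rightarrow> 'a ell2" where
  "minus_ell2 u v = u + - v"

definition scaleR_ell2 :: "real \<Rightarrow> 'a ell2 \<Rightarrow> 'a ell2" where
  "scaleR_ell2 r u = complex_of_real r *\<^sub>C u"

instance
proof
  fix u v w :: "'a ell2" and r s :: real
  show "u + v + w = u + (v + w)" by transfer (simp add: fun_eq_iff)
  show "u + v = v + u" by transfer (simp add: fun_eq_iff)
  show "0 + u = u" by transfer simp
  show "- u + u = 0" by transfer simp
  show "u - v = u + - v" by (fact minus_ell2_def)
  show "r *\<^sub>R (u + v) = r *\<^sub>R u + r *\<^sub>R v"
    unfolding scaleR_ell2_def by transfer (simp add: fun_eq_iff algebra_simps)
  show "(r + s) *\<^sub>R u = r *\<^sub>R u + s *\<^sub>R u"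
    unfolding scaleR_ell2_def by transfer (simp add: fun_eq_iff algebra_simps)
  show "r *\<^sub>R s *\<^sub>R u = (r * s) *\<^sub>R u"
    unfolding scaleR_ell2_def by transfer (simp add: fun_eq_iff algebra_simps)
  show "1 *\<^sub>R u = u"
    unfolding scaleR_ell2_def by transfer simp
qed

end

instantiation ell2 :: (type) real_inner
begin

definition inner_ell2 :: "'a ell2 \<Rightarrow> 'a ell2 \<Rightarrow> real" where
  "inner_ell2 u v = Re (cinner u v)"

definition norm_ell2 :: "'a ell2 \<Rightarrow> real" where
  "norm_ell2 u = sqrt (inner u u)"

definition sgn_ell2 :: "'a ell2 \<Rightarrow> 'a ell2" where
  "sgn_ell2 u = u /\<^sub>R norm u"

definition dist_ell2 :: "'a ell2 \<Rightarrow> 'a ell2 \<Rightarrow> real" where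
  "dist_ell2 u v = norm (u - v)"

definition uniformity_ell2 :: "('a ell2 \<times> 'a ell2) filter" where
  "uniformity_ell2 = (INF e\<in>{0<..}. principal {(x, y). dist x y < e})"

definition open_ell2 :: "'a ell2 set \<Rightarrow> bool" where
  "open_ell2 U \<longleftrightarrow> (\<forall>x\<in>U. eventually (\<lambda>(x', y). x' = x \<longrightarrow> y \<in> U) uniformity)"

instance
proof
  fix u v w :: "'a ell2" and r :: real
  show "sgn u = u /\<^sub>R norm u" by (fact sgn_ell2_def)
  show "dist u v = norm (u - v)" by (fact dist_ell2_def)
  show "uniformity = (INF e\<in>{0<..}. principal {(x, y::'a ell2). dist x y < e})"
    by (fact uniformity_ell2_def)
  show "open U \<longleftrightarrow> (\<forall>x\<in>U. \<forall>\<^sub>F (x', y) in uniformity. x' = x \<longrightarrow> y \<in> U)" for U :: "'a ell2 set"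
    by (fact open_ell2_def)
  have "cinner v u = cnj (cinner u v)"
    by transfer (simp add: infsum_cnj[symmetric] mult.commute del: infsum_cnj)
  then show "inner u v = inner v u" by (simp add: inner_ell2_def)
  have "cinner (u + v) w = cinner u w + cinner v w"
    by transfer (simp add: distrib_right infsum_add square_summable_mult)
  then show "inner (u + v) w = inner u w + inner v w" by (simp add: inner_ell2_def)
  have "cinner (c *\<^sub>C u) v = c * cinner u v" for c
    by transfer (simp add: mult.assoc infsum_cmult_right')
  then show "inner (r *\<^sub>R u) v = r * inner u v"
    by (simp add: inner_ell2_def scaleR_ell2_def)
  have "inner u u = Re (\<Sum>\<^sub>\<infinity>x. Rep_ell2 u x * cnj (Rep_ell2 u x))"
    by (simp add: inner_ell2_def cinner.rep_eq)
  also have "\<dots> = (\<Sum>\<^sub>\<infinity>x. Re (Rep_ell2 u x * cnj (Rep_ell2 u x)))"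
    using Rep_ell2[of u] by (subst infsum_Re) (auto intro: square_summable_mult)
  finally have *: "inner u u = (\<Sum>\<^sub>\<infinity>x. (cmod (Rep_ell2 u x))\<^sup>2)"
    by (simp add: complex_norm_square[symmetric] del: of_real_power)
  show "inner u u \<ge> 0" unfolding * by (rule infsum_nonneg) simp
  show "inner u u = 0 \<longleftrightarrow> u = 0"
  proof
    assume "inner u u = 0"
    then have "(cmod (Rep_ell2 u x))\<^sup>2 = 0" for x
      unfolding * using Rep_ell2[of u] by (intro nonneg_infsum_le_0D[of _ UNIV]) auto
    then show "u = 0" by (transfer) (simp add: fun_eq_iff)
  next
    show "u = 0 \<Longrightarrow> inner u u = 0" unfolding * by (simp add: zero_ell2.rep_eq)
  qed
  show "norm u = sqrt (inner u u)" by (fact norm_ell2_def)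
qed

end

global_interpretation ell2: vector_space "scaleC :: complex \<Rightarrow> 'a ell2 \<Rightarrow> 'a ell2"
  defines cspan = ell2.span
  by unfold_locales (transfer; simp add: fun_eq_iff algebra_simps)+


section \<open>Operators and spectral theory\<close>

definition bounded_clinear :: "('a ell2 \<Rightarrow> 'b ell2) \<Rightarrow> bool" where
  "bounded_clinear A \<longleftrightarrow> bounded_linear A \<and> (\<forall>c u. A (c *\<^sub>C u) = c *\<^sub>C A u)"

definition spectrum :: "('a ell2 \<Rightarrow> 'a ell2) \<Rightarrow> complex set" where
  "spectrum A = {z. \<not> (\<exists>R. bounded_clinear R \<and>
     (\<forall>u. R (A u - z *\<^sub>C u) = u) \<and> (\<forall>u. A (R u) - z *\<^sub>C R u = u))}"

definition eigenvalues :: "('a ell2 \<Rightarrow> 'a ell2) \<Rightarrow> complex set" where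
  "eigenvalues A = {z. \<exists>u. u \<noteq> 0 \<and> A u = z *\<^sub>C u}"

definition orthonormal_basis :: "'a ell2 set \<Rightarrow> bool" where
  "orthonormal_basis S \<longleftrightarrow>
     (\<forall>u\<in>S. norm u = 1) \<and> (\<forall>u\<in>S. \<forall>v\<in>S. u \<noteq> v \<longrightarrow> cinner u v = 0) \<and> closure (cspan S) = UNIV"

definition pure_point :: "('a ell2 \<Rightarrow> 'a ell2) \<Rightarrow> bool" where
  "pure_point A \<longleftrightarrow> (\<exists>S. orthonormal_basis S \<and> (\<forall>u\<in>S. \<exists>z. A u = z *\<^sub>C u))"

definition orthogonal_projection :: "('a ell2 \<Rightarrow> 'a ell2) \<Rightarrow> bool" where
  "orthogonal_projection P \<longleftrightarrow>
     bounded_clinear P \<and> (\<forall>u. P (P u) = P u) \<and> (\<forall>u v. cinner (P u) v = cinner u (P v))"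

definition projection_valued_measure :: "(real set \<Rightarrow> 'a ell2 \<Rightarrow> 'a ell2) \<Rightarrow> bool" where
  "projection_valued_measure E \<longleftrightarrow>
     (\<forall>B\<in>sets borel. orthogonal_projection (E B)) \<and>
     (\<forall>u. E UNIV u = u) \<and>
     (\<forall>A\<in>sets borel. \<forall>B\<in>sets borel. \<forall>u. E (A \<inter> B) u = E A (E B u)) \<and>
     (\<forall>A :: nat \<Rightarrow> real set. range A \<subseteq> sets borel \<longrightarrow> disjoint_family A \<longrightarrow>
        (\<forall>u. (\<lambda>n. E (A n) u) sums E (\<Union>n. A n) u))"

definition scalar_measure :: "(real set \<Rightarrow> 'a ell2 \<Rightarrow> 'a ell2) \<Rightarrow> 'a ell2 \<Rightarrow> real measure" where
  "scalar_measure E u = measure_of UNIV (sets borel) (\<lambda>B. ennreal (Re (cinner (E B u) u)))"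

text \<open>
  The second conjunct is \<open>A = \<integral> t dE(t)\<close> in the weak sense; it suffices to require it on the
  diagonal, since over the complex numbers the quadratic form of an operator determines the
  operator.
\<close>

definition spectral_resolution ::
  "('a ell2 \<Rightarrow> 'a ell2) \<Rightarrow> (real set \<Rightarrow> 'a ell2 \<Rightarrow> 'a ell2) \<Rightarrow> bool" where
  "spectral_resolution A E \<longleftrightarrow> projection_valued_measure E \<and>
     (\<forall>u. integrable (scalar_measure E u) (\<lambda>t. t) \<and>
          cinner (A u) u = complex_of_real (\<integral>t. t \<partial>scalar_measure E u))"

text \<open>
  For a bounded self-adjoint operator the resolution exists and is unique on Borel sets by the
  spectral theorem; its values off the Borel sets are arbitrary and play no role below.
\<close>

definition spectral_projections ::
  "('a ell2 \<Rightarrow> 'a ell2) \<Rightarrow> real set \<Rightarrow> 'a ell2 \<Rightarrow> 'a ell2" where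
  "spectral_projections A = (SOME E. spectral_resolution A E)"

definition spectral_measure :: "('a ell2 \<Rightarrow> 'a ell2) \<Rightarrow> 'a ell2 \<Rightarrow> real measure" where
  "spectral_measure A u = scalar_measure (spectral_projections A) u"


section \<open>The lamplighter group and its regular representation\<close>

text \<open>
  The generator of \<open>\<int>\<close> moves the entry at position \<open>n\<close> to position \<open>n + 1\<close>. Shifting in the
  other direction gives an isomorphic group, by reflecting the index set; that isomorphism fixes
  \<open>gen_a\<close> and \<open>gen_c\<close>.
\<close>

type_synonym lamp = "(int \<Rightarrow>\<^sub>0 bit) \<times> int"

lift_definition translate :: "int \<Rightarrow> (int \<Rightarrow>\<^sub>0 bit) \<Rightarrow> (int \<Rightarrow>\<^sub>0 bit)"
  is "\<lambda>m x n. x (n - m)"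
proof -
  fix m :: int and x :: "int \<Rightarrow> bit"
  assume "finite {n. x n \<noteq> 0}"
  then have "finite ((\<lambda>n. n + m) ` {n. x n \<noteq> 0})" by simp
  then show "finite {n. x (n - m) \<noteq> 0}"
    by (rule rev_finite_subset) (auto intro: image_eqI[where x = "n - m" for n])
qed

definition lamplighter :: "lamp monoid" where
  "lamplighter = \<lparr>carrier = UNIV,
     mult = (\<lambda>(x, m) (y, n). (x + translate m y, m + n)), one = (0, 0)\<rparr>"

lemma translate_simps:
  "translate 0 x = x"
  "translate m (translate n x) = translate (m + n) x"
  "translate m (x + y) = translate m x + translate m y"
  "translate m 0 = 0"
  by (transfer; simp add: algebra_simps fun_eq_iff)+

lemma group_lamplighter: "group lamplighter"
proof (rule groupI)
  fix g assume "g \<in> carrier lamplighter"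
  obtain x m where g: "g = (x, m)" by (cases g)
  have "(translate (- m) (- x), - m) \<otimes>\<^bsub>lamplighter\<^esub> g = \<one>\<^bsub>lamplighter\<^esub>"
    by (simp add: g lamplighter_def translate_simps(3)[symmetric] translate_simps(4))
  then show "\<exists>h\<in>carrier lamplighter. h \<otimes>\<^bsub>lamplighter\<^esub> g = \<one>\<^bsub>lamplighter\<^esub>"
    by (rule bexI) (simp add: lamplighter_def)
qed (auto simp: lamplighter_def translate_simps ac_simps)

definition gen_a :: lamp where
  "gen_a = (0, 1)"

definition gen_c :: lamp where
  "gen_c = (Poly_Mapping.single 0 1, 0)"

definition gen_b :: lamp where
  "gen_b = gen_a \<otimes>\<^bsub>lamplighter\<^esub> gen_c"

lemma gen_c_conv: "gen_c = inv\<^bsub>lamplighter\<^esub> gen_b \<otimes>\<^bsub>lamplighter\<^esub> gen_a"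
proof -
  interpret group lamplighter by (rule group_lamplighter)
  have car: "g \<in> carrier lamplighter" for g by (simp add: lamplighter_def)
  have "Poly_Mapping.single (0 :: int) (1 :: bit) + Poly_Mapping.single 0 1 = 0"
    unfolding Poly_Mapping.single_add[symmetric] by simp
  then have "gen_c \<otimes>\<^bsub>lamplighter\<^esub> gen_c = \<one>\<^bsub>lamplighter\<^esub>"
    by (simp add: gen_c_def lamplighter_def translate_simps del: single_one)
  then have "inv\<^bsub>lamplighter\<^esub> gen_c = gen_c"
    using inv_equality car by blast
  then show ?thesis
    unfolding gen_b_def by (simp add: car inv_mult_group m_assoc)
qed

lemma bij_lamplighter_mult: "bij (\<lambda>h. g \<otimes>\<^bsub>lamplighter\<^esub> h)"
proof -
  interpret group lamplighter by (rule group_lamplighter)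
  have car: "h \<in> carrier lamplighter" for h by (simp add: lamplighter_def)
  show ?thesis
    by (rule bij_betw_byWitness[where f' = "\<lambda>h. inv\<^bsub>lamplighter\<^esub> g \<otimes>\<^bsub>lamplighter\<^esub> h"])
      (auto simp: car m_assoc[symmetric])
qed

lift_definition left_regular :: "lamp \<Rightarrow> lamp ell2 \<Rightarrow> lamp ell2"
  is "\<lambda>g u h. u (inv\<^bsub>lamplighter\<^esub> g \<otimes>\<^bsub>lamplighter\<^esub> h)"
  by (rule square_summable_bij[OF _ bij_lamplighter_mult])

text \<open>Elements of the group algebra are finitely supported functions on the group.\<close>

definition convolution :: "(lamp \<Rightarrow>\<^sub>0 complex) \<Rightarrow> lamp ell2 \<Rightarrow> lamp ell2" where
  "convolution p u = (\<Sum>g\<in>Poly_Mapping.keys p. Poly_Mapping.lookup p g *\<^sub>C left_regular g u)"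

definition M_op :: "real \<Rightarrow> lamp ell2 \<Rightarrow> lamp ell2" where
  "M_op \<mu> = convolution
     (Poly_Mapping.single gen_a 1 + Poly_Mapping.single (inv\<^bsub>lamplighter\<^esub> gen_a) 1
      + Poly_Mapping.single gen_b 1 + Poly_Mapping.single (inv\<^bsub>lamplighter\<^esub> gen_b) 1
      - Poly_Mapping.single gen_c (complex_of_real \<mu>))"


section \<open>The random operators\<close>

definition bernoulli_measure :: "(int \<Rightarrow> nat) measure" where
  "bernoulli_measure = (\<Pi>\<^sub>M n\<in>UNIV. uniform_count_measure {0, 1})"

lemma space_bernoulli_measure: "space bernoulli_measure = (UNIV \<rightarrow> {0, 1})"
  by (simp add: bernoulli_measure_def space_PiM PiE_UNIV_domain space_uniform_count_measure Pi_def)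

definition shift :: "(int \<Rightarrow> nat) \<Rightarrow> int \<Rightarrow> nat" where
  "shift \<omega> = (\<lambda>n. \<omega> (n + 1))"

definition shift_power :: "int \<Rightarrow> (int \<Rightarrow> nat) \<Rightarrow> int \<Rightarrow> nat" where
  "shift_power n =
     (if 0 \<le> n then shift ^^ nat n else (inv_into UNIV shift) ^^ nat (- n))"

lemma shift_power_apply: "shift_power n \<omega> k = \<omega> (k + n)"
proof -
  have pos: "(shift ^^ m) \<omega> k = \<omega> (k + int m)" for m \<omega> k
    by (induction m arbitrary: k) (simp_all add: shift_def add_ac)
  have inv: "inv_into UNIV shift = (\<lambda>\<omega> n. \<omega> (n - 1))"
    by (rule inv_equality[THEN trans]) (auto simp: shift_def)
  have neg: "((\<lambda>\<omega> n. \<omega> (n - 1)) ^^ m) \<omega> k = \<omega> (k - int m)" for m and \<omega> :: "int \<Rightarrow> nat" and k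
    by (induction m arbitrary: k) (simp_all add: algebra_simps)
  show ?thesis
    by (simp add: shift_power_def pos inv neg)
qed

definition f_coeff :: "(int \<Rightarrow> nat) \<Rightarrow> real" where
  "f_coeff \<omega> = 1 + (- 1) ^ \<omega> (- 1)"

definition g_coeff :: "real \<Rightarrow> (int \<Rightarrow> nat) \<Rightarrow> real" where
  "g_coeff \<mu> \<omega> = \<mu> * (- 1) ^ (\<omega> 0 + 1)"

lift_definition H_op :: "real \<Rightarrow> (int \<Rightarrow> nat) \<Rightarrow> int ell2 \<Rightarrow> int ell2"
  is "\<lambda>\<mu> \<omega> u n. complex_of_real (f_coeff (shift_power n \<omega>)) * u (n - 1)
        + complex_of_real (g_coeff \<mu> (shift_power n \<omega>)) * u n
        + complex_of_real (f_coeff (shift_power (n + 1) \<omega>)) * u (n + 1)"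
proof -
  fix \<mu> :: real and \<omega> :: "int \<Rightarrow> nat" and u :: "int \<Rightarrow> complex"
  assume u: "(\<lambda>n. (cmod (u n))\<^sup>2) summable_on UNIV"
  have f: "cmod (complex_of_real (f_coeff \<eta>)) \<le> 2" for \<eta>
    by (cases "even (\<eta> (- 1))") (simp_all add: f_coeff_def)
  have g: "cmod (complex_of_real (g_coeff \<mu> \<eta>)) \<le> \<bar>\<mu>\<bar>" for \<eta>
    by (simp add: g_coeff_def norm_mult norm_power)
  have b: "bij (\<lambda>n::int. n - 1)" "bij (\<lambda>n::int. n + 1)"
    by (auto intro: bij_betw_byWitness[where f' = "\<lambda>n. n + 1"]
        bij_betw_byWitness[where f' = "\<lambda>n. n - 1"])
  show "(\<lambda>n. (cmod (complex_of_real (f_coeff (shift_power n \<omega>)) * u (n - 1)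
        + complex_of_real (g_coeff \<mu> (shift_power n \<omega>)) * u n
        + complex_of_real (f_coeff (shift_power (n + 1) \<omega>)) * u (n + 1)))\<^sup>2) summable_on UNIV"
    by (intro square_summable_add square_summable_bounded_mult[OF square_summable_bij[OF u b(1)]]
        square_summable_bounded_mult[OF square_summable_bij[OF u b(2)]]
        square_summable_bounded_mult[OF u]) (rule f g)+
qed

text \<open>
  \<open>nn_integral\<close> depends on the integrand only up to null sets, so only the spectral measures
  for almost every \<open>\<omega>\<close> matter here.
\<close>

definition density_of_states :: "real \<Rightarrow> real measure" where
  "density_of_states \<mu> = measure_of UNIV (sets borel)
     (\<lambda>B. \<integral>\<^sup>+ \<omega>. emeasure (spectral_measure (H_op \<mu> \<omega>) (delta 0)) B \<partial>bernoulli_measure)"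

definition discrete_measure :: "real measure \<Rightarrow> bool" where
  "discrete_measure m \<longleftrightarrow> (\<exists>S\<in>sets m. countable S \<and> emeasure m (space m - S) = 0)"


section \<open>Chebyshev polynomials of the second kind\<close>

fun cheb_U :: "nat \<Rightarrow> real poly" where
  "cheb_U 0 = 1"
| "cheb_U (Suc 0) = [:0, 2:]"
| "cheb_U (Suc (Suc n)) = [:0, 2:] * cheb_U (Suc n) - cheb_U n"

text \<open>\<open>G_poly k \<mu>\<close> is \<open>G\<^sub>k(z, \<mu>)\<close> as a polynomial in \<open>z\<close>; it is used for \<open>k \<ge> 2\<close> only.\<close>

definition G_poly :: "nat \<Rightarrow> real \<Rightarrow> real poly" where
  "G_poly k \<mu> = smult (2 ^ k)
     (pcompose (cheb_U k) [:- \<mu> / 4, - 1 / 4:]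
      + smult \<mu> (pcompose (cheb_U (k - 1)) [:- \<mu> / 4, - 1 / 4:]))"

end

theory Submission
  imports Defs "HOL-Computational_Algebra.Fundamental_Theorem_Algebra" "HOL-Real_Asymp.Real_Asymp"
begin

text \<open>
  The weight \<open>1 + (- 1) ^ \<omega> n\<close> of the bond between \<open>n\<close> and \<open>n + 1\<close> is \<open>0\<close> if \<open>\<omega> n = 1\<close> and \<open>2\<close> otherwise, so for
  almost every \<open>\<omega>\<close> the operator \<open>H_op \<mu> \<omega>\<close> is an orthogonal sum of finite Jacobi blocks, and all sizes
  \<open>k \<ge> 1\<close> occur. The block of size \<open>k\<close> has the entries \<open>- \<mu>, \<dots>, - \<mu>, \<mu>\<close> on the diagonal and \<open>2\<close> next to it;
  its characteristic polynomial is \<open>G_poly k \<mu>\<close>, and the Christoffel-Darboux identity shows that the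
  roots are real and simple with orthogonal Chebyshev eigenvectors, and that they come close to
  every point of the band and, for \<open>\<bar>\<mu>\<bar> > 1\<close>, to \<open>\<mu> + 2 / \<mu>\<close>.
  With \<open>P = (1 + c) / 2\<close> one has \<open>a + b = 2 a P\<close>, and \<open>P\<close> acts diagonally on the characters of the base
  group; hence \<open>M_op \<mu>\<close> is an orthogonal sum of the same blocks, spanned by partial Fourier transforms
  over finite windows. The origin, like the unit of the group, gives weight \<open>1 / 2 ^ (k + 1)\<close> to each of
  the \<open>k\<close> sites of a block of size \<open>k\<close>, so both spectral averages are the sum over \<open>k\<close> of
  \<open>1 / 2 ^ (k + 1)\<close> times the trace of the spectral projections of the block.
\<close>

subsection \<open>Square-summable functions\<close>

text \<open>\<open>spectral_projections\<close> is a choice among all resolutions, so it can be used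
  only after uniqueness is proved; this is done directly for operators diagonal in an orthonormal
  basis, and both operators reach that form through the one locale \<open>block_operator\<close>.
  The Chebyshev condition comes from a vector with entries U_0(c), ..., U_(k-1)(c), where r + \<mu>
  = 4c: the three-term recurrence settles every row but the last, where the diagonal entry \<mu> in
  place of -\<mu> leaves U_k(c) = \<mu> U_(k-1)(c). The weight 1/2^(k+1) has the same origin on both
  sides: a block of k sites is fixed by k + 1 bonds, two cut and k - 1 intact, hence by k + 1 coins
  for the chain and by a character of k + 1 lamps in the group. In the group infinitely many blocks
  pass through each site; they are complete only in the limit, because the numbers k / 2^(k+1) add
  up to 1. Measurability in \<open>\<omega>\<close> of the spectral measures is not treated in
  general: almost surely their values are countable sums of constants times indicators of cylinder
  events.\<close>

lemma ell2_eqI: "(\<And>x. Rep_ell2 u x = Rep_ell2 v x) \<Longrightarrow> u = v"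
  by (metis Rep_ell2_inject ext)

lemma cinner_commute: "cinner v u = cnj (cinner u v)"
  by transfer (simp add: infsum_cnj[symmetric] mult.commute del: infsum_cnj)

lemma cinner_add_left: "cinner (u + v) w = cinner u w + cinner v w"
  by transfer (simp add: distrib_right infsum_add square_summable_mult)

lemma cinner_scaleC_left: "cinner (c *\<^sub>C u) v = c * cinner u v"
  by transfer (simp add: mult.assoc infsum_cmult_right')

lemma cinner_scaleC_right: "cinner u (c *\<^sub>C v) = cnj c * cinner u v"
  by (metis cinner_scaleC_left cinner_commute complex_cnj_mult)

lemma scaleR_scaleC: "r *\<^sub>R (u :: 'a ell2) = complex_of_real r *\<^sub>C u"
  by (fact scaleR_ell2_def)

lemma cinner_scaleR_left: "cinner (r *\<^sub>R u) v = r *\<^sub>R cinner u v"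
  by (simp add: scaleR_scaleC cinner_scaleC_left scaleR_conv_of_real)

lemma cinner_self: "cinner u u = complex_of_real ((norm u)\<^sup>2)"
proof -
  have "Im (cinner u u) = 0"
    using cinner_commute[of u u] by (simp add: complex_eq_iff)
  moreover have "Re (cinner u u) = (norm u)\<^sup>2"
    by (simp add: power2_norm_eq_inner inner_ell2_def)
  ultimately show ?thesis
    by (simp add: complex_eq_iff del: of_real_power)
qed

lemma norm_scaleC: "norm (c *\<^sub>C u) = cmod c * norm (u :: 'a ell2)"
proof -
  have "complex_of_real ((norm (c *\<^sub>C u))\<^sup>2) = complex_of_real ((cmod c * norm u)\<^sup>2)"
    unfolding cinner_self[symmetric] cinner_scaleC_left cinner_scaleC_right
    by (simp only: cinner_self complex_norm_square[of c] power_mult_distrib of_real_mult mult.assoc mult.left_commute)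
  then have "(norm (c *\<^sub>C u))\<^sup>2 = (cmod c * norm u)\<^sup>2"
    unfolding of_real_eq_iff .
  then show ?thesis by (subst (asm) power2_eq_iff_nonneg) auto
qed

lemma cmod_cinner_le: "cmod (cinner u v) \<le> norm u * norm v"
proof (cases "cinner u v = 0")
  case False
  define c where "c = cnj (sgn (cinner u v))"
  have c: "cmod c = 1" using False by (simp add: c_def norm_sgn)
  have "cinner (c *\<^sub>C u) v = complex_of_real (cmod (cinner u v))"
    unfolding cinner_scaleC_left c_def using False
    by (simp add: sgn_eq mult.commute complex_norm_square[symmetric] power2_eq_square)
  then have "cmod (cinner u v) = inner (c *\<^sub>C u) v" by (simp add: inner_ell2_def)
  also have "\<dots> \<le> norm (c *\<^sub>C u) * norm v" by (rule norm_cauchy_schwarz)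
  finally show ?thesis by (simp add: norm_scaleC c)
qed simp

lemma bounded_linear_cinner_left: "bounded_linear (\<lambda>u. cinner u v)"
  by (rule bounded_linear_intro[where K = "norm v"])
    (auto simp: cinner_add_left cinner_scaleR_left cmod_cinner_le)

lemma linear_cinner_left: "linear (\<lambda>u. cinner u v)"
  by (rule bounded_linear.linear[OF bounded_linear_cinner_left])

lemma cinner_zero_left [simp]: "cinner 0 v = 0"
  using linear_0[OF linear_cinner_left[of v]] .

lemma cinner_diff_left: "cinner (u - w) v = cinner u v - cinner w v"
  using linear_diff[OF linear_cinner_left[of v]] .

lemma cinner_sum_left: "cinner (\<Sum>i\<in>F. f i) v = (\<Sum>i\<in>F. cinner (f i) v)"
  using linear_sum[OF linear_cinner_left[of v]] .

lemma cinner_zero_right [simp]: "cinner v 0 = 0"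
  using cinner_commute[of v 0] by simp

lemma cinner_diff_right: "cinner v (u - w) = cinner v u - cinner v w"
  using cinner_commute[of v "u - w"] cinner_commute[of v u] cinner_commute[of v w]
  by (simp add: cinner_diff_left)

lemma cinner_sum_right: "cinner v (\<Sum>i\<in>F. f i) = (\<Sum>i\<in>F. cinner v (f i))"
proof -
  have "cinner v (\<Sum>i\<in>F. f i) = cnj (\<Sum>i\<in>F. cinner (f i) v)"
    unfolding cinner_sum_left[symmetric] by (rule cinner_commute)
  also have "\<dots> = (\<Sum>i\<in>F. cinner v (f i))"
    unfolding cnj_sum by (intro sum.cong refl) (rule cinner_commute[symmetric])
  finally show ?thesis .
qed

lemma cinner_delta: "cinner u (delta a) = Rep_ell2 u a"
proof -
  have "cinner u (delta a) = (\<Sum>\<^sub>\<infinity>x. Rep_ell2 u x * cnj (if x = a then 1 else 0))"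
    by (simp add: cinner.rep_eq delta.rep_eq)
  also have "\<dots> = (\<Sum>\<^sub>\<infinity>x\<in>{a}. Rep_ell2 u x * cnj (if x = a then 1 else 0))"
    by (rule infsum_cong_neutral) auto
  finally show ?thesis by simp
qed

lemma cinner_delta_delta: "cinner (delta a) (delta b) = (if a = b then 1 else 0)"
  by (simp add: cinner_delta delta.rep_eq)

lemma Rep_ell2_simps:
  "Rep_ell2 (u + v) x = Rep_ell2 u x + Rep_ell2 v x"
  "Rep_ell2 (u - v) x = Rep_ell2 u x - Rep_ell2 v x"
  "Rep_ell2 (c *\<^sub>C u) x = c * Rep_ell2 u x"
  by (simp_all add: cinner_delta[symmetric] cinner_add_left cinner_diff_left cinner_scaleC_left)

lemma norm_ell2_square: "((\<lambda>x. (cmod (Rep_ell2 u x))\<^sup>2) has_sum (norm u)\<^sup>2) UNIV"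
proof -
  have "((\<lambda>x. Rep_ell2 u x * cnj (Rep_ell2 u x)) has_sum cinner u u) UNIV"
    unfolding cinner.rep_eq using Rep_ell2[of u] by (intro has_sum_infsum square_summable_mult) auto
  from has_sum_Re[OF this] show ?thesis
    by (simp add: cinner_self complex_norm_square[symmetric] del: of_real_power)
qed

lemma sum_cmod_Rep_ell2_le:
  "finite F \<Longrightarrow> (\<Sum>x\<in>F. (cmod (Rep_ell2 u x))\<^sup>2) \<le> (norm u)\<^sup>2"
  by (rule has_sum_mono2[OF has_sum_finite norm_ell2_square]) auto

text \<open>Completeness is what gives meaning to infinite eigenvector expansions. The limit is
  taken coordinatewise, and the Cauchy bound survives because it is tested on finite sets of
  coordinates only.\<close>

instance ell2 :: (type) complete_space
proof
  fix X :: "nat \<Rightarrow> 'a ell2"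
  assume X: "Cauchy X"
  have "Cauchy (\<lambda>n. Rep_ell2 (X n) x)" for x
    unfolding cinner_delta[symmetric]
    by (rule bounded_linear.Cauchy[OF bounded_linear_cinner_left X])
  then have "\<exists>l. \<forall>x. (\<lambda>n. Rep_ell2 (X n) x) \<longlonglongrightarrow> l x"
    by (intro choice allI) (use Cauchy_convergent in \<open>unfold convergent_def, blast\<close>)
  then obtain l where l: "\<And>x. (\<lambda>n. Rep_ell2 (X n) x) \<longlonglongrightarrow> l x" by blast
  have bound: "(\<Sum>x\<in>F. (cmod (Rep_ell2 (X n) x - l x))\<^sup>2) \<le> \<epsilon>\<^sup>2"
    if "finite F" "\<forall>m\<ge>N. \<forall>n\<ge>N. norm (X m - X n) < \<epsilon>" "n \<ge> N" for F \<epsilon> n N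
  proof (rule tendsto_upperbound)
    show "(\<lambda>m. \<Sum>x\<in>F. (cmod (Rep_ell2 (X n) x - Rep_ell2 (X m) x))\<^sup>2) \<longlonglongrightarrow>
       (\<Sum>x\<in>F. (cmod (Rep_ell2 (X n) x - l x))\<^sup>2)"
      by (intro tendsto_intros l)
    have "(\<Sum>x\<in>F. (cmod (Rep_ell2 (X n) x - Rep_ell2 (X m) x))\<^sup>2) \<le> \<epsilon>\<^sup>2" if "m \<ge> N" for m
    proof -
      have "(\<Sum>x\<in>F. (cmod (Rep_ell2 (X n - X m) x))\<^sup>2) \<le> (norm (X n - X m))\<^sup>2"
        by (rule sum_cmod_Rep_ell2_le) fact
      also have "\<dots> \<le> \<epsilon>\<^sup>2" using that \<open>n \<ge> N\<close> \<open>\<forall>m\<ge>N. _\<close>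
        by (intro power_mono) (auto simp: less_imp_le)
      finally show ?thesis by (simp add: Rep_ell2_simps)
    qed
    then show "\<forall>\<^sub>F m in sequentially. (\<Sum>x\<in>F. (cmod (Rep_ell2 (X n) x - Rep_ell2 (X m) x))\<^sup>2) \<le> \<epsilon>\<^sup>2"
      by (auto simp: eventually_sequentially)
  qed simp
  have N: "\<exists>N. \<forall>m\<ge>N. \<forall>n\<ge>N. norm (X m - X n) < \<epsilon>" if "\<epsilon> > 0" for \<epsilon>
    using X that unfolding Cauchy_def dist_norm by blast
  have "(\<lambda>x. (cmod (l x))\<^sup>2) summable_on UNIV"
  proof -
    obtain N where N: "\<forall>m\<ge>N. \<forall>n\<ge>N. norm (X m - X n) < 1" using N[of 1] by auto
    have "(\<lambda>x. (cmod (l x - Rep_ell2 (X N) x))\<^sup>2) summable_on UNIV"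
      by (rule nonneg_bounded_partial_sums_imp_summable_on[where C = "1\<^sup>2"])
        (use bound[OF _ N order_refl] in \<open>auto simp: norm_minus_commute intro!: eventually_finite_subsets_at_top_weakI\<close>)
    from square_summable_add[OF this Rep_ell2[of "X N", simplified]] show ?thesis by simp
  qed
  then obtain L where L: "Rep_ell2 L = l" by (metis Abs_ell2_inverse mem_Collect_eq)
  have "X \<longlonglongrightarrow> L"
  proof (rule LIMSEQ_I)
    fix \<epsilon> :: real assume "\<epsilon> > 0"
    then obtain N where N: "\<forall>m\<ge>N. \<forall>n\<ge>N. norm (X m - X n) < \<epsilon> / 2" using N[of "\<epsilon> / 2"] by auto
    have "norm (X n - L) < \<epsilon>" if "n \<ge> N" for n
    proof -
      have "(norm (X n - L))\<^sup>2 \<le> (\<epsilon> / 2)\<^sup>2"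
        by (rule has_sum_le_finite_sums[OF norm_ell2_square])
          (use bound[OF _ N that] in \<open>auto simp: Rep_ell2_simps L\<close>)
      then have "norm (X n - L) \<le> \<epsilon> / 2"
        by (rule power2_le_imp_le) (use \<open>\<epsilon> > 0\<close> in auto)
      then show ?thesis using \<open>\<epsilon> > 0\<close> by simp
    qed
    then show "\<exists>no. \<forall>n\<ge>no. norm (X n - L) < \<epsilon>" by blast
  qed
  then show "convergent X" by (auto simp: convergent_def)
qed

instance ell2 :: (type) banach ..

subsection \<open>Orthonormal bases\<close>

locale orthonormal_family =
  fixes X :: "'i set" and e :: "'i \<Rightarrow> 'a ell2"
  assumes orth: "x \<in> X \<Longrightarrow> y \<in> X \<Longrightarrow> cinner (e x) (e y) = (if x = y then 1 else 0)"
begin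

lemma norm_e: "x \<in> X \<Longrightarrow> norm (e x) = 1"
proof -
  assume "x \<in> X"
  then have "(norm (e x))\<^sup>2 = 1"
    using orth[of x x] cinner_self[of "e x"] by (metis of_real_eq_1_iff)
  then show "norm (e x) = 1"
    by (metis norm_ge_zero one_power2 power2_eq_iff_nonneg zero_le_one)
qed

lemma cinner_sum_e:
  assumes "finite F" "F \<subseteq> X" "y \<in> X"
  shows "cinner (\<Sum>x\<in>F. c x *\<^sub>C e x) (e y) = (if y \<in> F then c y else 0)"
proof -
  have "cinner (\<Sum>x\<in>F. c x *\<^sub>C e x) (e y) = (\<Sum>x\<in>F. if x = y then c x else 0)"
    unfolding cinner_sum_left cinner_scaleC_left using assms
    by (intro sum.cong refl) (auto simp: orth subset_iff)
  then show ?thesis using assms by simp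
qed

lemma norm_sum_e:
  assumes "finite F" "F \<subseteq> X"
  shows "(norm (\<Sum>x\<in>F. c x *\<^sub>C e x))\<^sup>2 = (\<Sum>x\<in>F. (cmod (c x))\<^sup>2)"
proof -
  have "complex_of_real ((norm (\<Sum>x\<in>F. c x *\<^sub>C e x))\<^sup>2) = (\<Sum>x\<in>F. cnj (c x) * c x)"
    unfolding cinner_self[symmetric] cinner_sum_right cinner_scaleC_right
    using assms by (intro sum.cong refl) (simp add: cinner_sum_e subset_iff)
  also have "\<dots> = complex_of_real (\<Sum>x\<in>F. (cmod (c x))\<^sup>2)"
    unfolding of_real_sum complex_norm_square by (simp add: mult.commute)
  finally show ?thesis unfolding of_real_eq_iff .
qed

lemma norm_diff_projection:
  assumes "finite F" "F \<subseteq> X"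
  shows "(norm (u - (\<Sum>x\<in>F. cinner u (e x) *\<^sub>C e x)))\<^sup>2
    = (norm u)\<^sup>2 - (\<Sum>x\<in>F. (cmod (cinner u (e x)))\<^sup>2)"
proof -
  let ?s = "\<Sum>x\<in>F. cinner u (e x) *\<^sub>C e x"
  let ?S = "\<Sum>x\<in>F. (cmod (cinner u (e x)))\<^sup>2"
  have us: "cinner u ?s = complex_of_real ?S"
    unfolding cinner_sum_right cinner_scaleC_right of_real_sum complex_norm_square
    by (simp add: mult.commute)
  have ss: "cinner ?s ?s = complex_of_real ?S"
    unfolding cinner_self norm_sum_e[OF assms] ..
  have "complex_of_real ((norm (u - ?s))\<^sup>2) = complex_of_real ((norm u)\<^sup>2 - ?S)"
    unfolding cinner_self[symmetric] cinner_diff_left cinner_diff_right us ss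
    using cinner_commute[of ?s u] us by (simp add: cinner_self)
  then show ?thesis unfolding of_real_eq_iff .
qed

lemma bessel:
  assumes "finite F" "F \<subseteq> X"
  shows "(\<Sum>x\<in>F. (cmod (cinner u (e x)))\<^sup>2) \<le> (norm u)\<^sup>2"
  using norm_diff_projection[OF assms, of u] zero_le_power2 by (metis diff_ge_0_iff_ge)

lemma summable_bessel: "Y \<subseteq> X \<Longrightarrow> (\<lambda>x. (cmod (cinner u (e x)))\<^sup>2) summable_on Y"
  by (rule nonneg_bounded_partial_sums_imp_summable_on[where C = "(norm u)\<^sup>2"])
    (auto intro!: eventually_finite_subsets_at_top_weakI bessel)

text \<open>The squared norm of a difference of nested finite sums is a finite tail of the summable
  squares, so the finite sums form a Cauchy net.\<close>

lemma riesz_fischer: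
  assumes g: "(\<lambda>x. (cmod (c x))\<^sup>2) summable_on Y" and Y: "Y \<subseteq> X"
  shows "(\<lambda>x. c x *\<^sub>C e x) summable_on Y"
proof -
  define f where "f x = c x *\<^sub>C e x" for x
  define g where "g x = (cmod (c x))\<^sup>2" for x
  have "g summable_on Y"
    using assms(1) unfolding g_def[abs_def] .
  then obtain L where "(g has_sum L) Y"
    using has_sum_infsum by blast
  then have lim: "(sum g \<longlongrightarrow> L) (finite_subsets_at_top Y)"
    unfolding has_sum_def .
  have "\<exists>P. eventually P (finite_subsets_at_top Y) \<and>
          (\<forall>F F'. P F \<and> P F' \<longrightarrow> dist (sum f F) (sum f F') < \<epsilon>)" if "\<epsilon> > 0" for \<epsilon>
  proof -
    \<comment> \<open>Two sums of squares within \<open>d\<close> of the limit differ by less than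
      \<open>2 * d\<close>, which is the square of \<epsilon>/2.\<close>
    define d where "d = \<epsilon>\<^sup>2 / 8"
    have d: "d > 0" using that by (simp add: d_def)
    obtain F0 where F0: "finite F0" "F0 \<subseteq> Y"
      and "\<forall>F. finite F \<and> F0 \<subseteq> F \<and> F \<subseteq> Y \<longrightarrow> dist (sum g F) L < d"
      using tendstoD[OF lim d] unfolding eventually_finite_subsets_at_top by auto
    then have close: "\<And>F. finite F \<Longrightarrow> F0 \<subseteq> F \<Longrightarrow> F \<subseteq> Y \<Longrightarrow> dist (sum g F) L < d"
      by simp
    have half: "dist (sum f F) (sum f F0) < \<epsilon> / 2" if F: "finite F" "F0 \<subseteq> F" "F \<subseteq> Y" for F
    proof -
      have "(norm (sum f F - sum f F0))\<^sup>2 = (norm (sum f (F - F0)))\<^sup>2"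
        using F by (simp add: sum_diff)
      also have "\<dots> = sum g (F - F0)"
        unfolding f_def g_def using F Y by (intro norm_sum_e) auto
      also have "\<dots> = sum g F - sum g F0" using F by (simp add: sum_diff)
      also have "\<dots> < 2 * d" using close[OF F] close[OF F0(1) order_refl F0(2)]
        unfolding dist_real_def by linarith
      finally have "(norm (sum f F - sum f F0))\<^sup>2 < (\<epsilon> / 2)\<^sup>2"
        by (simp add: d_def power_divide)
      then show ?thesis
        unfolding dist_norm
        by (rule power_less_imp_less_base[where n = 2]) (use \<open>\<epsilon> > 0\<close> in simp)
    qed
    let ?P = "\<lambda>F. finite F \<and> F0 \<subseteq> F \<and> F \<subseteq> Y"
    have "eventually ?P (finite_subsets_at_top Y)"
      unfolding eventually_finite_subsets_at_top using F0 by auto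
    moreover have "dist (sum f F) (sum f F') < \<epsilon>" if "?P F" "?P F'" for F F'
      by (rule dist_triangle_half_l[where y = "sum f F0"]) (use that half in auto)
    ultimately show ?thesis
      by (intro exI[of _ ?P] conjI allI impI) simp_all
  qed
  then have "cauchy_filter (filtermap (sum f) (finite_subsets_at_top Y))"
    by (simp add: cauchy_filter_metric_filtermap)
  then obtain L' where "(sum f \<longlongrightarrow> L') (finite_subsets_at_top Y)"
    unfolding filterlim_def convergent_filter_iff_cauchy[symmetric] convergent_filter_iff by blast
  then show ?thesis
    unfolding summable_on_def has_sum_def f_def[abs_def] by (rule exI)
qed

lemma has_sum_cinner:
  assumes "((\<lambda>x. f x) has_sum u) Y"
  shows "((\<lambda>x. cinner (f x) v) has_sum cinner u v) Y"
  by (rule has_sum_bounded_linear[OF bounded_linear_cinner_left assms])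

lemma has_sum_e_cinner:
  assumes s: "((\<lambda>x. c x *\<^sub>C e x) has_sum u) Y" and Y: "Y \<subseteq> X" and y: "y \<in> X"
  shows "cinner u (e y) = (if y \<in> Y then c y else 0)"
proof -
  have "((\<lambda>x. cinner (c x *\<^sub>C e x) (e y)) has_sum cinner u (e y)) Y"
    by (rule has_sum_cinner[OF s])
  then have "((\<lambda>x. if x = y then c x else 0) has_sum cinner u (e y)) Y"
    by (rule has_sum_cong[THEN iffD1, rotated]) (use Y y in \<open>auto simp: cinner_scaleC_left orth subset_iff\<close>)
  moreover have "((\<lambda>x. if x = y then c x else 0) has_sum (if y \<in> Y then c y else 0)) Y"
  proof -
    have "((\<lambda>x. if x = y then c x else 0) has_sum (\<Sum>x\<in>Y \<inter> {y}. if x = y then c x else 0)) (Y \<inter> {y})"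
      by (rule has_sum_finite) simp
    moreover have "(\<Sum>x\<in>Y \<inter> {y}. if x = y then c x else 0) = (if y \<in> Y then c y else 0)"
      by simp
    moreover have "((\<lambda>x. if x = y then c x else 0) has_sum t) (Y \<inter> {y}) \<longleftrightarrow>
        ((\<lambda>x. if x = y then c x else 0) has_sum t) Y" for t
      by (rule has_sum_cong_neutral) auto
    ultimately show ?thesis by simp
  qed
  ultimately show ?thesis using has_sum_unique by blast
qed

end

text \<open>Completeness is required as a trivial orthogonal complement, the form that can be
  checked on coordinates; density of the span is derived in \<open>closure_cspan\<close>.\<close>

locale onb = orthonormal_family X e for X :: "'i set" and e :: "'i \<Rightarrow> 'a ell2" +
  assumes total: "(\<And>x. x \<in> X \<Longrightarrow> cinner u (e x) = 0) \<Longrightarrow> u = 0"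
begin

lemma ext_cinner: "(\<And>x. x \<in> X \<Longrightarrow> cinner u (e x) = cinner v (e x)) \<Longrightarrow> u = v"
  using total[of "u - v"] by (simp add: cinner_diff_left)

lemma has_sum_expansion: "((\<lambda>x. cinner u (e x) *\<^sub>C e x) has_sum u) X"
proof -
  have "(\<lambda>x. cinner u (e x) *\<^sub>C e x) summable_on X"
    by (rule riesz_fischer[OF summable_bessel]) auto
  then obtain v where v: "((\<lambda>x. cinner u (e x) *\<^sub>C e x) has_sum v) X"
    unfolding summable_on_def by blast
  have "v = u"
    by (rule ext_cinner) (simp add: has_sum_e_cinner[OF v])
  then show ?thesis using v by simp
qed

lemma parseval: "((\<lambda>x. cinner u (e x) * cnj (cinner v (e x))) has_sum cinner u v) X"
  using has_sum_cinner[OF has_sum_expansion, of u v]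
  by (simp add: cinner_scaleC_left cinner_commute[of "e _" v])

lemma parseval_norm: "((\<lambda>x. (cmod (cinner u (e x)))\<^sup>2) has_sum (norm u)\<^sup>2) X"
  using has_sum_Re[OF parseval[of u u]]
  by (simp add: cinner_self complex_norm_square[symmetric] del: of_real_power)

lemma closure_cspan: "closure (cspan (e ` X)) = UNIV"
proof -
  have "u \<in> closure (cspan (e ` X))" for u
  proof (rule Lim_in_closed_set[OF closed_closure])
    show "((\<lambda>F. \<Sum>x\<in>F. cinner u (e x) *\<^sub>C e x) \<longlongrightarrow> u) (finite_subsets_at_top X)"
      using has_sum_expansion[of u] unfolding has_sum_def .
    show "\<forall>\<^sub>F F in finite_subsets_at_top X.
        (\<Sum>x\<in>F. cinner u (e x) *\<^sub>C e x) \<in> closure (cspan (e ` X))"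
      by (intro eventually_finite_subsets_at_top_weakI subsetD[OF closure_subset]
          ell2.span_sum ell2.span_scale ell2.span_base) auto
  qed simp
  then show ?thesis by blast
qed

lemma orthonormal_basis_image: "orthonormal_basis (e ` X)"
  unfolding orthonormal_basis_def by (auto simp: closure_cspan norm_e orth)

end

subsection \<open>Spectral resolutions of diagonal operators\<close>

lemma sets_scalar_measure [simp]: "sets (scalar_measure E u) = sets borel"
  and space_scalar_measure [simp]: "space (scalar_measure E u) = UNIV"
  using sets.sigma_sets_eq[of "borel :: real measure"] by (simp_all add: scalar_measure_def)

locale pvm =
  fixes E :: "real set \<Rightarrow> 'a ell2 \<Rightarrow> 'a ell2"
  assumes pvm: "projection_valued_measure E"
begin

lemma symmetric: "B \<in> sets borel \<Longrightarrow> cinner (E B u) v = cinner u (E B v)"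
  using pvm unfolding projection_valued_measure_def orthogonal_projection_def by blast

lemma idem: "B \<in> sets borel \<Longrightarrow> E B (E B u) = E B u"
  using pvm unfolding projection_valued_measure_def orthogonal_projection_def by blast

lemma E_UNIV: "E UNIV u = u"
  using pvm unfolding projection_valued_measure_def by blast

lemma E_Int: "B \<in> sets borel \<Longrightarrow> C \<in> sets borel \<Longrightarrow> E (B \<inter> C) u = E B (E C u)"
  using pvm unfolding projection_valued_measure_def by blast

lemma E_sums: "range B \<subseteq> sets borel \<Longrightarrow> disjoint_family B \<Longrightarrow> (\<lambda>n. E (B n) u) sums E (\<Union>n. B n) u"
  using pvm unfolding projection_valued_measure_def by blast

text \<open>The empty sets form a disjoint sequence with empty union, so the constant series of
  \<open>E {} u\<close> converges and its terms tend to 0.\<close>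

lemma E_empty: "E {} u = 0"
proof -
  have "(\<lambda>n :: nat. E {} u) sums E {} u"
    using E_sums[of "\<lambda>_. {}" u] by (simp add: disjoint_family_on_def)
  from summable_LIMSEQ_zero[OF sums_summable[OF this]] show ?thesis
    by (simp add: LIMSEQ_const_iff)
qed

lemma E_Compl:
  assumes B: "B \<in> sets borel"
  shows "E (- B) u = u - E B u"
proof -
  have "(\<lambda>n. E (binaryset B (- B) n) u) sums (E B u + E (- B) u)"
    by (rule binaryset_sums[where f = "\<lambda>C. E C u"]) (rule E_empty)
  moreover have "(\<lambda>n. E (binaryset B (- B) n) u) sums E (\<Union>n. binaryset B (- B) n) u"
    using B by (intro E_sums) (auto simp: range_binaryset_eq disjoint_family_on_def binaryset_def)
  ultimately have "E B u + E (- B) u = u"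
    using sums_unique2 by (fastforce simp: UN_binaryset_eq E_UNIV)
  then show ?thesis by (simp add: algebra_simps)
qed

lemma cinner_E_E: "B \<in> sets borel \<Longrightarrow> Re (cinner (E B u) u) = (norm (E B u))\<^sup>2"
  using symmetric[of B "E B u" u] by (metis idem cinner_self Re_complex_of_real)

text \<open>\<open>measure_of\<close> returns the intended values only for a countably additive
  function; additivity comes from \<open>E_sums\<close>, nonnegativity from \<open>E B\<close> being
  a projection.\<close>

lemma emeasure_scalar_measure:
  assumes "B \<in> sets borel"
  shows "emeasure (scalar_measure E u) B = ennreal ((norm (E B u))\<^sup>2)"
proof -
  have "emeasure (scalar_measure E u) B = ennreal (Re (cinner (E B u) u))"
    unfolding scalar_measure_def
  proof (rule emeasure_measure_of_sigma)
    show "sigma_algebra UNIV (sets (borel :: real measure))"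
      using sets.sigma_algebra_axioms[of borel] by simp
    show "positive (sets borel) (\<lambda>B. ennreal (Re (cinner (E B u) u)))"
      by (simp add: positive_def E_empty)
    show "countably_additive (sets borel) (\<lambda>B. ennreal (Re (cinner (E B u) u)))"
    proof (rule countably_additiveI)
      fix A :: "nat \<Rightarrow> real set"
      assume A: "range A \<subseteq> sets borel" "disjoint_family A"
      have "(\<lambda>n. Re (cinner (E (A n) u) u)) sums Re (cinner (E (\<Union>n. A n) u) u)"
        by (intro sums_Re bounded_linear.sums[OF bounded_linear_cinner_left] E_sums A)
      moreover have "0 \<le> Re (cinner (E (A n) u) u)" for n
        using A(1) by (subst cinner_E_E) auto
      ultimately show "suminf (\<lambda>n. ennreal (Re (cinner (E (A n) u) u))) =
          ennreal (Re (cinner (E (\<Union>n. A n) u) u))"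
        by (simp add: suminf_ennreal2 sums_iff)
    qed
  qed fact
  then show ?thesis by (simp add: cinner_E_E assms)
qed

lemma finite_measure_scalar_measure: "finite_measure (scalar_measure E u)"
  by (rule finite_measureI) (simp add: emeasure_scalar_measure)

lemma scalar_measure_E:
  assumes B: "B \<in> sets borel"
  shows "scalar_measure E (E B u) = density (scalar_measure E u) (indicator B)"
proof (rule measure_eqI)
  fix C assume "C \<in> sets (scalar_measure E (E B u))"
  then have C: "C \<in> sets borel" by simp
  then have "emeasure (density (scalar_measure E u) (indicator B)) C
      = emeasure (scalar_measure E u) (C \<inter> B)"
    using B by (subst emeasure_density[OF borel_measurable_indicator])
      (simp_all add: indicator_inter_arith[symmetric] Int_commute)
  then show "emeasure (scalar_measure E (E B u)) C
      = emeasure (density (scalar_measure E u) (indicator B)) C"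
    using B C by (simp add: emeasure_scalar_measure E_Int)
qed simp

end

lemma spectral_resolution_pvm: "spectral_resolution A E \<Longrightarrow> pvm E"
  by (simp add: spectral_resolution_def pvm_def)

text \<open>The eigenvector equation is imposed on the coefficients of \<open>A u\<close>, which is
  what matrix entries provide; additivity and symmetry of \<open>A\<close> then follow by comparing
  coefficients.\<close>

locale diagonal = onb X e for X :: "'i set" and e :: "'i \<Rightarrow> 'a ell2" +
  fixes A :: "'a ell2 \<Rightarrow> 'a ell2" and lam :: "'i \<Rightarrow> real"
  assumes A_coord: "x \<in> X \<Longrightarrow> cinner (A u) (e x) = of_real (lam x) * cinner u (e x)"
begin

lemma A_e: "x \<in> X \<Longrightarrow> A (e x) = of_real (lam x) *\<^sub>C e x"
  by (rule ext_cinner) (auto simp: A_coord cinner_scaleC_left orth)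

lemma A_diff: "A (u - v) = A u - A v"
  by (rule ext_cinner) (simp add: A_coord cinner_diff_left algebra_simps)

lemma A_symmetric: "cinner (A u) v = cinner u (A v)"
proof (rule has_sum_unique[OF parseval])
  show "((\<lambda>x. cinner (A u) (e x) * cnj (cinner v (e x))) has_sum cinner u (A v)) X"
    by (rule has_sum_cong[THEN iffD1, OF _ parseval[of u "A v"]]) (simp add: A_coord)
qed

lemma eigenvalues_eq: "eigenvalues A = complex_of_real ` lam ` X"
proof safe
  fix z assume "z \<in> eigenvalues A"
  then obtain u where u: "u \<noteq> 0" "A u = z *\<^sub>C u" by (auto simp: eigenvalues_def)
  then obtain x where x: "x \<in> X" "cinner u (e x) \<noteq> 0" using total by blast
  then have "z = of_real (lam x)"
    using A_coord[OF x(1), of u] by (simp add: u cinner_scaleC_left)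
  then show "z \<in> complex_of_real ` lam ` X" using x(1) by blast
next
  fix x assume x: "x \<in> X"
  then have "e x \<noteq> 0" using norm_e by force
  then show "complex_of_real (lam x) \<in> eigenvalues A"
    unfolding eigenvalues_def using A_e[OF x] by blast
qed

lemma pure_point: "pure_point A"
  unfolding pure_point_def using orthonormal_basis_image A_e by blast

text \<open>The functional calculus of \<open>A\<close>, with the function given on indices:
  \<open>h = 1 / (lam - z)\<close> yields the resolvent and
  \<open>h = indicator B \<circ> lam\<close> the spectral projections.\<close>

definition D :: "('i \<Rightarrow> complex) \<Rightarrow> 'a ell2 \<Rightarrow> 'a ell2" where
  "D h u = (\<Sum>\<^sub>\<infinity>x\<in>X. (h x * cinner u (e x)) *\<^sub>C e x)"

context
  fixes h :: "'i \<Rightarrow> complex" and C :: real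
  assumes h: "\<And>x. x \<in> X \<Longrightarrow> cmod (h x) \<le> C"
begin

lemma D_bound_coord: "x \<in> X \<Longrightarrow> (cmod (h x * cinner u (e x)))\<^sup>2 \<le> C\<^sup>2 * (cmod (cinner u (e x)))\<^sup>2"
  by (auto simp: norm_mult power_mult_distrib h intro!: mult_right_mono power_mono)

lemma D_has_sum: "((\<lambda>x. (h x * cinner u (e x)) *\<^sub>C e x) has_sum D h u) X"
  unfolding D_def
proof (rule has_sum_infsum[OF riesz_fischer])
  show "(\<lambda>x. (cmod (h x * cinner u (e x)))\<^sup>2) summable_on X"
    by (rule summable_on_comparison_test[OF summable_on_cmult_right[OF summable_bessel]])
      (auto intro: D_bound_coord)
qed simp

lemma D_coord: "x \<in> X \<Longrightarrow> cinner (D h u) (e x) = h x * cinner u (e x)"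
  using has_sum_e_cinner[OF D_has_sum] by simp

lemma norm_D_le: "norm (D h u) \<le> \<bar>C\<bar> * norm u"
proof -
  have "(norm (D h u))\<^sup>2 \<le> C\<^sup>2 * (norm u)\<^sup>2"
    by (rule has_sum_mono[OF parseval_norm has_sum_cmult_right[OF parseval_norm]])
      (simp add: D_coord D_bound_coord)
  also have "\<dots> = (\<bar>C\<bar> * norm u)\<^sup>2" by (simp add: power_mult_distrib)
  finally show ?thesis by (rule power2_le_imp_le) simp
qed

lemma bounded_clinear_D: "bounded_clinear (D h)"
  unfolding bounded_clinear_def
proof safe
  have add: "D h (u + v) = D h u + D h v" for u v
    by (rule ext_cinner) (simp add: D_coord cinner_add_left algebra_simps)
  show scale: "D h (c *\<^sub>C u) = c *\<^sub>C D h u" for c u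
    by (rule ext_cinner) (simp add: D_coord cinner_scaleC_left)
  show "bounded_linear (D h)"
    by (rule bounded_linear_intro[where K = "\<bar>C\<bar>"])
      (auto simp: add scale scaleR_scaleC norm_D_le mult.commute)
qed

end

text \<open>If \<open>A - z\<close> had an inverse bounded by \<open>K\<close>, no eigenvalue could
  lie within \<open>1 / K\<close> of \<open>z\<close>.\<close>

lemma closure_eigenvalues_le_spectrum: "closure (eigenvalues A) \<subseteq> spectrum A"
proof
  fix z assume z: "z \<in> closure (eigenvalues A)"
  show "z \<in> spectrum A"
  proof (rule ccontr)
    assume "z \<notin> spectrum A"
    then obtain R where R: "bounded_clinear R" "\<And>u. R (A u - z *\<^sub>C u) = u"
      unfolding spectrum_def by blast
    obtain K where K: "K > 0" "\<And>u. norm (R u) \<le> norm u * K"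
      using bounded_linear.pos_bounded R(1) unfolding bounded_clinear_def by blast
    obtain w where w: "w \<in> eigenvalues A" "dist w z < 1 / K"
      using z K(1) unfolding closure_approachable by (meson zero_less_divide_1_iff)
    then obtain u where u: "u \<noteq> 0" "A u = w *\<^sub>C u" by (auto simp: eigenvalues_def)
    have "R ((w - z) *\<^sub>C u) = u"
      using R(2)[of u] by (simp add: u ell2.scale_left_diff_distrib)
    then have "norm u \<le> cmod (w - z) * norm u * K"
      using K(2)[of "(w - z) *\<^sub>C u"] by (simp add: norm_scaleC)
    also have "\<dots> < 1 / K * norm u * K"
      using w(2) u(1) K(1) by (intro mult_strict_right_mono) (auto simp: dist_norm)
    also have "\<dots> = norm u" using K(1) by simp
    finally show False by simp
  qed
qed

text \<open>At distance at least \<open>d > 0\<close> from all eigenvalues the diagonal operator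
  with entries \<open>1 / (lam x - z)\<close> is bounded by \<open>1 / d\<close> and inverts
  \<open>A - z\<close>.\<close>

lemma spectrum_eq: "spectrum A = closure (eigenvalues A)"
proof (rule antisym[OF _ closure_eigenvalues_le_spectrum], rule subsetI, rule ccontr)
  fix z assume z: "z \<in> spectrum A" "z \<notin> closure (eigenvalues A)"
  then obtain d where d: "d > 0" "\<And>w. w \<in> eigenvalues A \<Longrightarrow> d \<le> dist w z"
    unfolding closure_approachable by (meson not_less)
  define h where "h x = 1 / (complex_of_real (lam x) - z)" for x
  have dz: "d \<le> cmod (complex_of_real (lam x) - z)" if "x \<in> X" for x
    using d(2)[of "complex_of_real (lam x)"] that unfolding eigenvalues_eq dist_norm by blast
  then have nz: "complex_of_real (lam x) - z \<noteq> 0" if "x \<in> X" for x using d(1) that by fastforce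
  have h: "cmod (h x) \<le> 1 / d" if "x \<in> X" for x
    unfolding h_def norm_divide norm_one using dz[OF that] d(1) by (intro frac_le) auto
  note Dh = D_coord[of h, OF h]
  have "\<exists>R. bounded_clinear R \<and> (\<forall>u. R (A u - z *\<^sub>C u) = u) \<and> (\<forall>u. A (R u) - z *\<^sub>C R u = u)"
  proof (intro exI[of _ "D h"] conjI allI)
    show "bounded_clinear (D h)" by (rule bounded_clinear_D[OF h])
    show "D h (A u - z *\<^sub>C u) = u" for u
    proof (rule ext_cinner)
      fix x assume x: "x \<in> X"
      have "cinner (D h (A u - z *\<^sub>C u)) (e x) = h x * (complex_of_real (lam x) - z) * cinner u (e x)"
        using x by (simp add: Dh A_coord cinner_diff_left cinner_scaleC_left algebra_simps)
      then show "cinner (D h (A u - z *\<^sub>C u)) (e x) = cinner u (e x)" using nz[OF x] by (simp add: h_def)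
    qed
    show "A (D h u) - z *\<^sub>C D h u = u" for u
    proof (rule ext_cinner)
      fix x assume x: "x \<in> X"
      have "cinner (A (D h u) - z *\<^sub>C D h u) (e x) = h x * (complex_of_real (lam x) - z) * cinner u (e x)"
        using x by (simp add: Dh A_coord cinner_diff_left cinner_scaleC_left algebra_simps)
      then show "cinner (A (D h u) - z *\<^sub>C D h u) (e x) = cinner u (e x)" using nz[OF x] by (simp add: h_def)
    qed
  qed
  then show False using z(1) unfolding spectrum_def by blast
qed

definition E :: "real set \<Rightarrow> 'a ell2 \<Rightarrow> 'a ell2" where
  "E B = D (\<lambda>x. indicator B (lam x))"

lemma cmod_indicator_le: "cmod (indicator B t) \<le> 1"
  by (simp add: indicator_def)

lemma E_coord: "x \<in> X \<Longrightarrow> cinner (E B u) (e x) = indicator B (lam x) * cinner u (e x)"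
  unfolding E_def by (rule D_coord[OF cmod_indicator_le])

text \<open>Writing the projection as a sum over a restricted index set turns countable additivity
  into regrouping one sum over disjoint index sets.\<close>

lemma E_has_sum: "((\<lambda>x. cinner u (e x) *\<^sub>C e x) has_sum E B u) {x \<in> X. lam x \<in> B}"
proof -
  have "(\<lambda>x. cinner u (e x) *\<^sub>C e x) summable_on {x \<in> X. lam x \<in> B}"
    by (rule riesz_fischer[OF summable_bessel]) auto
  then obtain v where v: "((\<lambda>x. cinner u (e x) *\<^sub>C e x) has_sum v) {x \<in> X. lam x \<in> B}"
    unfolding summable_on_def by blast
  have "v = E B u"
    by (rule ext_cinner) (simp add: has_sum_e_cinner[OF v] E_coord indicator_def)
  then show ?thesis using v by simp
qed

lemma E_sums:
  assumes "disjoint_family B"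
  shows "(\<lambda>n. E (B n) u) sums E (\<Union>n. B n) u"
proof (rule has_sum_imp_sums, rule has_sum_SigmaD)
  let ?Y = "\<lambda>n. {x \<in> X. lam x \<in> B n}"
  have "bij_betw snd (Sigma UNIV ?Y) {x \<in> X. lam x \<in> (\<Union>n. B n)}"
    using assms by (auto simp: bij_betw_def inj_on_def disjoint_family_on_def image_iff)
  from has_sum_reindex_bij_betw[OF this, of "\<lambda>x. cinner u (e x) *\<^sub>C e x"] E_has_sum
  show "((\<lambda>p. cinner u (e (snd p)) *\<^sub>C e (snd p)) has_sum E (\<Union>n. B n) u) (Sigma UNIV ?Y)"
    by blast
  show "((\<lambda>x. cinner u (e (snd (n, x))) *\<^sub>C e (snd (n, x))) has_sum E (B n) u) (?Y n)" for n
    using E_has_sum by simp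
qed

lemma E_symmetric: "cinner (E B u) v = cinner u (E B v)"
proof (rule has_sum_unique[OF parseval])
  show "((\<lambda>x. cinner (E B u) (e x) * cnj (cinner v (e x))) has_sum cinner u (E B v)) X"
    by (rule has_sum_cong[THEN iffD1, OF _ parseval[of u "E B v"]])
      (simp add: E_coord indicator_def)
qed

lemma projection_valued_measure_E: "projection_valued_measure E"
  unfolding projection_valued_measure_def orthogonal_projection_def
proof (intro conjI ballI allI impI)
  show "bounded_clinear (E B)" for B
    unfolding E_def by (rule bounded_clinear_D[OF cmod_indicator_le])
  show "E B (E B u) = E B u" for B u
    by (rule ext_cinner) (simp add: E_coord indicator_def)
  show "E UNIV u = u" for u
    by (rule ext_cinner) (simp add: E_coord)
  show "E (B \<inter> C) u = E B (E C u)" for B C u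
    by (rule ext_cinner) (simp add: E_coord indicator_def)
qed (rule E_symmetric E_sums, assumption?)+

text \<open>The spectral measure of \<open>u\<close> is the image under \<open>lam\<close> of the
  weights given by the squared coefficients of \<open>u\<close>; integrals against it thereby become
  sums over \<open>X\<close>.\<close>

lemma emeasure_E:
  "emeasure (distr (density (count_space X) (\<lambda>x. ennreal ((cmod (cinner u (e x)))\<^sup>2))) borel lam) B
    = ennreal ((norm (E B u))\<^sup>2)" if B: "B \<in> sets borel"
proof -
  let ?f = "\<lambda>x. (cmod (cinner (E B u) (e x)))\<^sup>2"
  have "emeasure (distr (density (count_space X) (\<lambda>x. ennreal ((cmod (cinner u (e x)))\<^sup>2))) borel lam) B
    = (\<integral>\<^sup>+x. ennreal ((cmod (cinner u (e x)))\<^sup>2) * indicator (lam -` B \<inter> X) x \<partial>count_space X)"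
    using B by (subst emeasure_distr) (auto simp: emeasure_density)
  also have "\<dots> = (\<integral>\<^sup>+x. ennreal (?f x) \<partial>count_space X)"
    by (rule nn_integral_cong) (auto simp: E_coord indicator_def)
  also have "\<dots> = ennreal (infsetsum ?f X)"
    by (rule nn_integral_conv_infsetsum)
      (use summable_bessel[of X "E B u"] in \<open>auto simp: abs_summable_equivalent[symmetric]\<close>)
  also have "infsetsum ?f X = infsum ?f X"
    by (rule infsetsum_infsum)
      (use summable_bessel[of X "E B u"] in \<open>auto simp: abs_summable_equivalent[symmetric]\<close>)
  also have "\<dots> = (norm (E B u))\<^sup>2"
    by (rule infsumI[OF parseval_norm])
  finally show ?thesis .
qed

lemma spectral_resolution_E: "spectral_resolution A E"
  unfolding spectral_resolution_def
proof (intro conjI allI projection_valued_measure_E)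
  interpret pvm E by standard (rule projection_valued_measure_E)
  fix u
  let ?c = "\<lambda>x. (cmod (cinner u (e x)))\<^sup>2"
  let ?M = "density (count_space X) (\<lambda>x. ennreal (?c x))"
  have scalar: "scalar_measure E u = distr ?M borel lam"
    by (rule measure_eqI) (simp_all add: emeasure_scalar_measure emeasure_E)
  have sum: "((\<lambda>x. ?c x * lam x) has_sum Re (cinner (A u) u)) X"
  proof (rule has_sum_cong[THEN iffD1, OF _ has_sum_Re[OF parseval[of "A u" u]]])
    fix x assume "x \<in> X"
    then have "cinner (A u) (e x) * cnj (cinner u (e x)) = complex_of_real (lam x * ?c x)"
      by (simp only: A_coord mult.assoc complex_norm_square of_real_mult)
    then show "Re (cinner (A u) (e x) * cnj (cinner u (e x))) = ?c x * lam x"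
      by (metis Re_complex_of_real mult.commute)
  qed
  \<comment> \<open>Each term is a product of a coefficient of \<open>u\<close> and one of
    \<open>A u\<close>, and both families are square-summable.\<close>
  have abs: "(\<lambda>x. norm (?c x * lam x)) summable_on X"
  proof (rule summable_on_comparison_test[OF summable_on_add[OF summable_bessel summable_bessel]])
    fix x assume x: "x \<in> X"
    have "norm (?c x * lam x) = cmod (cinner u (e x)) * cmod (cinner (A u) (e x))"
      using x by (simp add: A_coord norm_mult abs_mult power2_eq_square)
    then show "norm (?c x * lam x) \<le> (cmod (cinner u (e x)))\<^sup>2 + (cmod (cinner (A u) (e x)))\<^sup>2"
      using sum_squares_bound[of "cmod (cinner u (e x))" "cmod (cinner (A u) (e x))"]
        mult_nonneg_nonneg[OF norm_ge_zero norm_ge_zero, of "cinner u (e x)" "cinner (A u) (e x)"]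
      by linarith
  qed auto
  then have int: "integrable (count_space X) (\<lambda>x. ?c x * lam x)"
    unfolding abs_summable_equivalent abs_summable_on_def .
  then show "integrable (scalar_measure E u) (\<lambda>t. t)"
    unfolding scalar by (subst integrable_distr_eq)
      (use int in \<open>auto simp: integrable_density\<close>)
  have "(\<integral>t. t \<partial>scalar_measure E u) = infsetsum (\<lambda>x. ?c x * lam x) X"
    unfolding scalar by (subst integral_distr) (auto simp: integral_density infsetsum_def)
  also have "\<dots> = Re (cinner (A u) u)"
    using infsetsum_infsum[unfolded abs_summable_on_def, OF int] infsumI[OF sum] by simp
  moreover have "Im (cinner (A u) u) = 0"
    using cinner_commute[of u "A u"] A_symmetric[of u u] by (simp add: complex_eq_iff)
  ultimately show "cinner (A u) u = complex_of_real (\<integral>t. t \<partial>scalar_measure E u)"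
    by (simp add: complex_eq_iff)
qed

text \<open>
  With \<open>w = F B v\<close>, the measure of \<open>v\<close> splits into those of \<open>w\<close> and \<open>v - w\<close>; expanding the quadratic
  form of \<open>A\<close> at \<open>v - w\<close> gives \<open>\<integral>\<^sub>B (t - lam x) = 0\<close>, which for \<open>B\<close> on one side of \<open>lam x\<close> forces
  \<open>B\<close> to be null.
\<close>

lemma spectral_resolution_moment:
  assumes F: "spectral_resolution A F" and x: "x \<in> X" and B: "B \<in> sets borel"
  shows "integrable (scalar_measure F (e x)) (\<lambda>t. indicator B t *\<^sub>R (t - lam x))"
    and "(\<integral>t. indicator B t *\<^sub>R (t - lam x) \<partial>scalar_measure F (e x)) = 0"
proof -
  interpret pvm F by (rule spectral_resolution_pvm[OF F])
  define v where "v = e x"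
  define w where "w = F B v"
  have q: "integrable (scalar_measure F u) (\<lambda>t. t)"
      "Re (cinner (A u) u) = (\<integral>t. t \<partial>scalar_measure F u)" for u
    using F unfolding spectral_resolution_def by (metis Re_complex_of_real)+
  interpret finite_measure "scalar_measure F v" by (rule finite_measure_scalar_measure)
  have int: "integrable (scalar_measure F v) (\<lambda>t. indicator C t *\<^sub>R t)" if "C \<in> sets borel" for C
    by (rule integrable_mult_indicator) (use that q(1)[of v] in auto)
  have piece: "Re (cinner (A (F C v)) (F C v)) = (\<integral>t. indicator C t *\<^sub>R t \<partial>scalar_measure F v)"
    if "C \<in> sets borel" for C
  proof -
    have dens: "scalar_measure F (F C v) = density (scalar_measure F v) (\<lambda>t. ennreal (indicator C t))"
      unfolding scalar_measure_E[OF that] by (simp add: ennreal_indicator)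
    show ?thesis
      unfolding q(2) dens using that
      by (subst integral_density) (simp_all add: measurable_cong_sets[OF sets_scalar_measure refl])
  qed
  have "(\<integral>t. indicator B t *\<^sub>R t \<partial>scalar_measure F v)
      + (\<integral>t. indicator (- B) t *\<^sub>R t \<partial>scalar_measure F v) = (\<integral>t. t \<partial>scalar_measure F v)"
  proof (subst Bochner_Integration.integral_add[symmetric])
    show "integrable (scalar_measure F v) (\<lambda>t. indicator B t *\<^sub>R t)"
      "integrable (scalar_measure F v) (\<lambda>t. indicator (- B) t *\<^sub>R t)"
      using B by (auto intro!: int simp del: real_scaleR_def)
  qed (auto intro!: Bochner_Integration.integral_cong simp: indicator_def)
  then have add: "Re (cinner (A w) w) + Re (cinner (A (v - w)) (v - w)) = Re (cinner (A v) v)"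
    using piece[OF B] piece[of "- B"] B by (simp add: w_def E_Compl q(2)[of v])
  have Av: "A v = of_real (lam x) *\<^sub>C v" using A_e[OF x] by (simp add: v_def)
  have wv: "cinner w v = of_real ((norm w)\<^sup>2)" "cinner v w = of_real ((norm w)\<^sup>2)"
    using symmetric[OF B, of v w] symmetric[OF B, of w v] idem[OF B, of v] cinner_self[of w]
    by (simp_all add: w_def del: of_real_power)
  have "Re (cinner (A w) v) = lam x * (norm w)\<^sup>2"
    unfolding A_symmetric Av cinner_scaleC_right wv by simp
  moreover have "Re (cinner (A v) w) = lam x * (norm w)\<^sup>2"
    unfolding Av cinner_scaleC_left wv by simp
  \<comment> \<open>Expanding the form at \<open>v - w\<close> turns \<open>add\<close> into twice
    the form at \<open>w\<close> being equal to the sum of the two mixed terms just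
    computed.\<close>
  ultimately have "Re (cinner (A w) w) = lam x * (norm w)\<^sup>2"
    using add by (simp add: A_diff cinner_diff_left cinner_diff_right)
  moreover have "measure (scalar_measure F v) B = (norm w)\<^sup>2"
    using emeasure_scalar_measure[OF B, of v] by (simp add: measure_def w_def)
  ultimately have eq: "(\<integral>t. indicator B t *\<^sub>R t \<partial>scalar_measure F v) = lam x * measure (scalar_measure F v) B"
    using piece[OF B] by (simp add: w_def)
  have intB: "integrable (scalar_measure F v) (indicator B :: real \<Rightarrow> real)"
    using B by (intro integrable_real_indicator) (auto simp: emeasure_scalar_measure)
  show "integrable (scalar_measure F (e x)) (\<lambda>t. indicator B t *\<^sub>R (t - lam x))"
    using Bochner_Integration.integrable_diff[OF int[OF B] integrable_mult_left[OF intB, of "lam x"]]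
    by (simp add: v_def algebra_simps)
  show "(\<integral>t. indicator B t *\<^sub>R (t - lam x) \<partial>scalar_measure F (e x)) = 0"
    using Bochner_Integration.integral_diff[OF int[OF B] integrable_mult_left[OF intB, of "lam x"]] eq B
    by (simp add: v_def algebra_simps)
qed

text \<open>\<open>s\<close> only carries the sign of \<open>t - lam x\<close> on \<open>B\<close>:
  a nonnegative integrand with vanishing integral is zero almost everywhere, and here it is positive
  on \<open>B\<close>.\<close>

lemma spectral_resolution_one_sided:
  assumes F: "spectral_resolution A F" and x: "x \<in> X"
    and B: "B \<in> sets borel" "s \<noteq> 0" "\<And>t. t \<in> B \<Longrightarrow> s * (t - lam x) > (0 :: real)"
  shows "F B (e x) = 0"
proof -
  interpret pvm F by (rule spectral_resolution_pvm[OF F])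
  let ?m = "scalar_measure F (e x)"
  let ?g = "\<lambda>t. s * (indicator B t *\<^sub>R (t - lam x))"
  note mom = spectral_resolution_moment[OF F x B(1)]
  have "AE t in ?m. ?g t = 0"
  proof (subst integral_nonneg_eq_0_iff_AE[symmetric])
    show "integrable ?m ?g" by (rule integrable_mult_right) (rule mom)
    show "AE t in ?m. 0 \<le> ?g t"
      using B(3) by (intro AE_I2) (force simp: indicator_def less_imp_le)
    show "integral\<^sup>L ?m ?g = 0" using mom(2) by simp
  qed
  then have "AE t in ?m. t \<notin> B"
    by eventually_elim (use B in \<open>force simp: indicator_def\<close>)
  then have "emeasure ?m B = 0"
    using B(1) by (subst (asm) AE_iff_measurable[of B]) auto
  then show ?thesis using B(1) by (simp add: emeasure_scalar_measure)
qed

text \<open>Both open half-lines beside \<open>lam x\<close> annihilate \<open>e x\<close>, so the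
  projection of the single point \<open>lam x\<close> fixes it.\<close>

lemma spectral_resolution_e:
  assumes F: "spectral_resolution A F" and x: "x \<in> X" and B: "B \<in> sets borel"
  shows "F B (e x) = indicator B (lam x) *\<^sub>C e x"
proof -
  interpret pvm F by (rule spectral_resolution_pvm[OF F])
  have "F {..<lam x} (e x) = 0"
    by (rule spectral_resolution_one_sided[OF F x, where s = "-1"]) auto
  moreover have "F {lam x<..} (e x) = 0"
    by (rule spectral_resolution_one_sided[OF F x, where s = 1]) auto
  ultimately have "F {lam x..} (e x) = e x" "F {..lam x} (e x) = e x"
    using E_Compl[of "{..<lam x}" "e x"] E_Compl[of "{lam x<..}" "e x"]
    by (simp_all add: Compl_lessThan Compl_greaterThan)
  moreover have "{lam x..} \<inter> {..lam x} = {lam x}" by auto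
  ultimately have "F {lam x} (e x) = e x"
    using E_Int[of "{lam x..}" "{..lam x}" "e x"] by simp
  then have "F B (e x) = F (B \<inter> {lam x}) (e x)"
    using E_Int[OF B, of "{lam x}" "e x"] by simp
  also have "\<dots> = indicator B (lam x) *\<^sub>C e x"
    using \<open>F {lam x} (e x) = e x\<close> by (simp add: indicator_def Int_insert_right E_empty)
  finally show ?thesis .
qed

text \<open>Symmetry of \<open>F B\<close> moves it onto the basis vectors, where it is already
  known. This identifies the resolution picked by \<open>spectral_projections\<close> on Borel
  sets.\<close>

lemma spectral_resolution_unique:
  assumes F: "spectral_resolution A F" and B: "B \<in> sets borel"
  shows "F B u = E B u"
proof (rule ext_cinner)
  interpret pvm F by (rule spectral_resolution_pvm[OF F])
  fix x assume x: "x \<in> X"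
  show "cinner (F B u) (e x) = cinner (E B u) (e x)"
    unfolding symmetric[OF B] spectral_resolution_e[OF F x B] E_coord[OF x] cinner_scaleC_right
    by (simp add: indicator_def)
qed

lemma sets_spectral_measure: "sets (spectral_measure A u) = sets borel"
  by (simp add: spectral_measure_def)

theorem emeasure_spectral_measure:
  assumes B: "B \<in> sets borel"
  shows "emeasure (spectral_measure A u) B
    = ennreal (\<Sum>\<^sub>\<infinity>x\<in>X. (cmod (cinner u (e x)))\<^sup>2 * indicator B (lam x))"
proof -
  have res: "spectral_resolution A (spectral_projections A)"
    unfolding spectral_projections_def by (rule someI[where P = "spectral_resolution A", OF spectral_resolution_E])
  have "emeasure (spectral_measure A u) B = ennreal ((norm (E B u))\<^sup>2)"
    using pvm.emeasure_scalar_measure[OF spectral_resolution_pvm[OF res] B, of u]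
    by (simp add: spectral_measure_def spectral_resolution_unique[OF res B])
  also have "(norm (E B u))\<^sup>2 = (\<Sum>\<^sub>\<infinity>x\<in>X. (cmod (cinner (E B u) (e x)))\<^sup>2)"
    by (rule infsumI[OF parseval_norm, symmetric])
  also have "\<dots> = (\<Sum>\<^sub>\<infinity>x\<in>X. (cmod (cinner u (e x)))\<^sup>2 * indicator B (lam x))"
    by (rule infsum_cong) (simp add: E_coord indicator_def)
  finally show ?thesis .
qed

end

subsection \<open>Jacobi blocks and Chebyshev polynomials\<close>

text \<open>Stated over any commutative ring, beside the real polynomials \<open>cheb_U\<close>,
  because roots must be handled over the complex numbers before they are known to be real.\<close>

fun chebyshev_U :: "nat \<Rightarrow> 'a :: comm_ring_1 \<Rightarrow> 'a" where
  "chebyshev_U 0 x = 1"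
| "chebyshev_U (Suc 0) x = 2 * x"
| "chebyshev_U (Suc (Suc n)) x = 2 * x * chebyshev_U (Suc n) x - chebyshev_U n x"

lemma poly_cheb_U: "poly (cheb_U n) x = chebyshev_U n x"
  by (induction n rule: cheb_U.induct) (simp_all add: mult.commute)

lemma degree_cheb_U_le: "degree (cheb_U n) \<le> n"
proof (induction n rule: cheb_U.induct)
  case (3 n)
  have "degree ([:0, 2:] * cheb_U (Suc n)) \<le> Suc (Suc n)"
    by (rule order_trans[OF degree_mult_le]) (use 3 in simp)
  then show ?case using 3 by (simp del: mult_pCons_left) (intro degree_diff_le, auto)
qed auto

lemma chebyshev_U_minus: "chebyshev_U n (- x) = (- 1) ^ n * chebyshev_U n x"
  by (induction n x rule: chebyshev_U.induct) (simp_all add: algebra_simps)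

lemma chebyshev_U_of_real: "chebyshev_U n (complex_of_real x) = of_real (chebyshev_U n x)"
  by (induction n x rule: chebyshev_U.induct) simp_all

lemma cnj_chebyshev_U: "cnj (chebyshev_U n x) = chebyshev_U n (cnj x)"
  by (induction n x rule: chebyshev_U.induct) simp_all

text \<open>By the recurrence, passing from \<open>n\<close> to \<open>n + 1\<close> changes the
  right side by exactly the new summand times 2 (x - y).\<close>

lemma christoffel_darboux:
  "2 * (x - y) * (\<Sum>j\<le>n. chebyshev_U j x * chebyshev_U j y)
    = chebyshev_U (Suc n) x * chebyshev_U n y - chebyshev_U n x * chebyshev_U (Suc n) y"
  for x y :: "'a :: comm_ring_1"
  by (induction n) (simp_all add: algebra_simps)

fun chebyshev_poly :: "nat \<Rightarrow> complex poly" where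
  "chebyshev_poly 0 = 1"
| "chebyshev_poly (Suc 0) = [:0, 2:]"
| "chebyshev_poly (Suc (Suc n)) = [:0, 2:] * chebyshev_poly (Suc n) - chebyshev_poly n"

lemma poly_chebyshev_poly: "poly (chebyshev_poly n) x = chebyshev_U n x"
  by (induction n rule: chebyshev_poly.induct) (simp_all add: mult.commute)

lemma degree_chebyshev_poly: "degree (chebyshev_poly n) = n"
proof (induction n rule: chebyshev_poly.induct)
  case (3 n)
  have "chebyshev_poly (Suc n) \<noteq> 0" using 3 by auto
  then have *: "degree ([:0, 2:] * chebyshev_poly (Suc n)) = Suc (Suc n)"
    using 3 by (subst degree_mult_eq) auto
  show ?case
    unfolding chebyshev_poly.simps diff_conv_add_uminus
    by (subst degree_add_eq_left) (use 3 * in simp_all)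
qed auto

text \<open>The last row of the eigenvector equation for the block of size \<open>n + 1\<close>, in
  the variable \<open>c = (r + \<mu>) / 4\<close>. The index is one less than the size.\<close>

definition jacobi_char :: "real \<Rightarrow> nat \<Rightarrow> real \<Rightarrow> real" where
  "jacobi_char \<mu> n c = chebyshev_U (Suc n) c - \<mu> * chebyshev_U n c"

lemma jacobi_char_christoffel:
  "2 * (x - y) * (\<Sum>j\<le>n. chebyshev_U j x * chebyshev_U j y)
    = jacobi_char \<mu> n x * chebyshev_U n y - jacobi_char \<mu> n y * chebyshev_U n x"
  unfolding christoffel_darboux jacobi_char_def by (simp add: algebra_simps)

definition jacobi_cpoly :: "real \<Rightarrow> nat \<Rightarrow> complex poly" where
  "jacobi_cpoly \<mu> n = chebyshev_poly (Suc n) - smult (of_real \<mu>) (chebyshev_poly n)"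

lemma poly_jacobi_cpoly:
  "poly (jacobi_cpoly \<mu> n) x = chebyshev_U (Suc n) x - of_real \<mu> * chebyshev_U n x"
  by (simp add: jacobi_cpoly_def poly_chebyshev_poly)

lemma degree_jacobi_cpoly: "degree (jacobi_cpoly \<mu> n) = Suc n"
  unfolding jacobi_cpoly_def diff_conv_add_uminus
  by (subst degree_add_eq_left) (auto simp: degree_chebyshev_poly)

lemma jacobi_cpoly_christoffel:
  "2 * (x - y) * (\<Sum>j\<le>n. chebyshev_U j x * chebyshev_U j y)
    = poly (jacobi_cpoly \<mu> n) x * chebyshev_U n y - poly (jacobi_cpoly \<mu> n) y * chebyshev_U n x"
  unfolding christoffel_darboux poly_jacobi_cpoly by (simp add: algebra_simps)

text \<open>The Christoffel-Darboux identity at a root and its conjugate has right side 0, while its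
  sum of squared moduli is at least the term 1 of degree 0.\<close>

lemma jacobi_cpoly_root_real:
  assumes "poly (jacobi_cpoly \<mu> n) x = 0"
  shows "x \<in> \<real>"
proof -
  have "poly (jacobi_cpoly \<mu> n) (cnj x) = cnj (poly (jacobi_cpoly \<mu> n) x)"
    by (simp add: poly_jacobi_cpoly cnj_chebyshev_U)
  then have "(x - cnj x) * (\<Sum>j\<le>n. chebyshev_U j x * chebyshev_U j (cnj x)) = 0"
    using jacobi_cpoly_christoffel[of x "cnj x" n \<mu>] assms by simp
  moreover have "(\<Sum>j\<le>n. chebyshev_U j x * chebyshev_U j (cnj x))
      = complex_of_real (\<Sum>j\<le>n. (cmod (chebyshev_U j x))\<^sup>2)"
    unfolding cnj_chebyshev_U[symmetric] complex_norm_square[symmetric] by simp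
  moreover have "(\<Sum>j\<le>n. (cmod (chebyshev_U j x))\<^sup>2) \<noteq> 0"
    using sum_mono2[of "{..n}" "{..0}" "\<lambda>j. (cmod (chebyshev_U j x))\<^sup>2"] by auto
  ultimately have "x - cnj x = 0" by (metis mult_eq_0_iff of_real_eq_0_iff)
  then have "x = cnj x" by simp
  then show ?thesis by (simp add: Reals_cnj_iff)
qed

text \<open>With one variable fixed at a root, differentiating the Christoffel-Darboux identity
  there shows that a double root would make the sum of the squares of the U_j vanish; the root is
  real, so this is impossible.\<close>

lemma jacobi_cpoly_rsquarefree: "rsquarefree (jacobi_cpoly \<mu> n)"
  unfolding rsquarefree_roots
proof (intro allI notI)
  fix y assume y: "poly (jacobi_cpoly \<mu> n) y = 0 \<and> poly (pderiv (jacobi_cpoly \<mu> n)) y = 0"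
  define S where "S = (\<Sum>j\<le>n. smult (chebyshev_U j y) (chebyshev_poly j))"
  have "[:- 2 * y, 2:] * S = smult (chebyshev_U n y) (jacobi_cpoly \<mu> n)"
  proof (rule poly_eq_poly_eq_iff[THEN iffD1], rule ext)
    fix x
    have "poly ([:- 2 * y, 2:] * S) x = 2 * (x - y) * (\<Sum>j\<le>n. chebyshev_U j x * chebyshev_U j y)"
      by (simp add: S_def poly_sum poly_chebyshev_poly algebra_simps)
    also have "\<dots> = poly (smult (chebyshev_U n y) (jacobi_cpoly \<mu> n)) x"
      unfolding jacobi_cpoly_christoffel[of x y n \<mu>] using y by simp
    finally show "poly ([:- 2 * y, 2:] * S) x = poly (smult (chebyshev_U n y) (jacobi_cpoly \<mu> n)) x" .
  qed
  then have "poly (pderiv ([:- 2 * y, 2:] * S)) y = 0"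
    using y by (simp add: pderiv_smult del: mult_pCons_left)
  then have "poly S y = 0"
    by (simp add: pderiv_mult pderiv_pCons del: mult_pCons_left)
  moreover obtain c where c: "y = complex_of_real c"
    using jacobi_cpoly_root_real[of \<mu> n y] y by (auto elim: Reals_cases)
  ultimately have "complex_of_real (\<Sum>j\<le>n. (chebyshev_U j c)\<^sup>2) = 0"
    by (simp add: S_def poly_sum poly_chebyshev_poly chebyshev_U_of_real power2_eq_square)
  moreover have "(\<Sum>j\<le>n. (chebyshev_U j c)\<^sup>2) \<ge> (\<Sum>j\<le>0. (chebyshev_U j c)\<^sup>2)"
    by (rule sum_mono2) auto
  ultimately show False by (auto simp del: of_real_sum)
qed

text \<open>Over the complex numbers a squarefree polynomial has as many roots as its degree, and
  all of them are real.\<close>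

lemma card_jacobi_char_roots: "card {c. jacobi_char \<mu> n c = 0} = Suc n"
proof -
  let ?Z = "{z. poly (jacobi_cpoly \<mu> n) z = 0}"
  have nz: "jacobi_cpoly \<mu> n \<noteq> 0" using degree_jacobi_cpoly[of \<mu> n] by auto
  have "Suc n = degree (smult (lead_coeff (jacobi_cpoly \<mu> n)) (\<Prod>z\<in>?Z. [:- z, 1:]))"
    by (subst complex_poly_decompose_rsquarefree[OF jacobi_cpoly_rsquarefree])
      (simp add: degree_jacobi_cpoly)
  also have "\<dots> = card ?Z"
    using nz by (simp add: degree_prod_eq_sum_degree)
  also have "?Z = complex_of_real ` {c. jacobi_char \<mu> n c = 0}"
  proof -
    have *: "poly (jacobi_cpoly \<mu> n) (complex_of_real c) = complex_of_real (jacobi_char \<mu> n c)" for c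
      by (simp only: poly_jacobi_cpoly jacobi_char_def chebyshev_U_of_real of_real_diff of_real_mult)
    show ?thesis
    proof safe
      fix z assume "poly (jacobi_cpoly \<mu> n) z = 0"
      moreover from this obtain c where "z = complex_of_real c"
        using jacobi_cpoly_root_real Reals_cases by metis
      ultimately show "z \<in> complex_of_real ` {c. jacobi_char \<mu> n c = 0}"
        by (simp add: *)
    qed (simp add: *)
  qed
  also have "card \<dots> = card {c. jacobi_char \<mu> n c = 0}"
    by (rule card_image) (simp add: inj_on_def)
  finally show ?thesis by simp
qed

text \<open>The eigenvalues of the block of size \<open>k\<close>. For \<open>k = 0\<close> the
  truncated \<open>k - 1\<close> turns \<open>G_poly\<close> into the constant 1 + \<mu>, which
  describes no block.\<close>

definition jacobi_roots :: "real \<Rightarrow> nat \<Rightarrow> real set" where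
  "jacobi_roots \<mu> k = {r. poly (G_poly k \<mu>) r = 0}"

lemma poly_G_poly:
  "poly (G_poly (Suc n) \<mu>) r = (- 2) ^ Suc n * jacobi_char \<mu> n ((r + \<mu>) / 4)"
proof -
  have arg: "poly [:- \<mu> / 4, - 1 / 4:] r = - ((r + \<mu>) / 4)" by (simp add: field_simps)
  have "(- 2 :: real) ^ Suc n = (- 1) ^ Suc n * 2 ^ Suc n"
    by (simp only: power_mult_distrib[symmetric]) simp
  then show ?thesis
    unfolding G_poly_def jacobi_char_def
    by (simp only: poly_smult poly_add poly_pcompose arg poly_cheb_U chebyshev_U_minus diff_Suc_1)
      (simp add: algebra_simps del: chebyshev_U.simps)
qed

lemma jacobi_roots_Suc: "jacobi_roots \<mu> (Suc n) = {r. jacobi_char \<mu> n ((r + \<mu>) / 4) = 0}"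
  by (simp add: jacobi_roots_def poly_G_poly)

lemma card_jacobi_roots_Suc: "card (jacobi_roots \<mu> (Suc n)) = Suc n"
proof -
  have "bij_betw (\<lambda>r. (r + \<mu>) / 4) (jacobi_roots \<mu> (Suc n)) {c. jacobi_char \<mu> n c = 0}"
    by (rule bij_betw_byWitness[where f' = "\<lambda>c. 4 * c - \<mu>"])
      (auto simp: jacobi_roots_Suc add_divide_distrib diff_divide_distrib)
  from bij_betw_same_card[OF this] show ?thesis by (simp add: card_jacobi_char_roots)
qed

lemma card_jacobi_roots: "k \<ge> 1 \<Longrightarrow> card (jacobi_roots \<mu> k) = k"
  by (cases k) (simp_all add: card_jacobi_roots_Suc)

lemma finite_jacobi_roots: "k \<ge> 1 \<Longrightarrow> finite (jacobi_roots \<mu> k)"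
  using card_jacobi_roots[of k \<mu>] by (intro card_ge_0_finite) simp

lemma degree_G_poly_le: "degree (G_poly k \<mu>) \<le> k"
proof -
  have "degree (pcompose (cheb_U n) [:- \<mu> / 4, - 1 / 4:]) \<le> n" for n
    using degree_cheb_U_le[of n] by (simp add: degree_pcompose)
  then show ?thesis
    unfolding G_poly_def
    by (intro order_trans[OF degree_smult_le] degree_add_le) (auto intro: order_trans[OF _ diff_le_self])
qed

text \<open>There are already \<open>k\<close> distinct roots, so none of them is multiple.\<close>

lemma proots_G_poly:
  assumes "k \<ge> 1"
  shows "proots (G_poly k \<mu>) = mset_set (jacobi_roots \<mu> k)"
proof -
  have nz: "G_poly k \<mu> \<noteq> 0"
  proof
    assume "G_poly k \<mu> = 0"
    then have "jacobi_roots \<mu> k = UNIV" by (simp add: jacobi_roots_def)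
    then show False using finite_jacobi_roots[OF assms, of \<mu>] infinite_UNIV_char_0 by metis
  qed
  have "mset_set (set_mset (proots (G_poly k \<mu>))) \<subseteq># proots (G_poly k \<mu>)"
    by (rule mset_set_set_mset_msubset)
  moreover have set: "set_mset (proots (G_poly k \<mu>)) = jacobi_roots \<mu> k"
    using nz by (simp add: jacobi_roots_def)
  moreover have "size (proots (G_poly k \<mu>)) \<le> k"
    by (rule order_trans[OF size_proots_le degree_G_poly_le])
  ultimately show ?thesis
    using card_jacobi_roots[OF assms, of \<mu>]
    by (metis leD mset_subset_size size_mset_set subset_mset.le_imp_less_or_eq)
qed

section \<open>Orthonormal eigenvectors of a block\<close>

definition jacobi_vec :: "real \<Rightarrow> nat \<Rightarrow> real \<Rightarrow> nat \<Rightarrow> real" where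
  "jacobi_vec \<mu> k r j = chebyshev_U j ((r + \<mu>) / 4) / sqrt (\<Sum>i<k. (chebyshev_U i ((r + \<mu>) / 4))\<^sup>2)"

lemma sum_chebyshev_U_ge_1: "k \<ge> 1 \<Longrightarrow> (\<Sum>i<k. (chebyshev_U i (c :: real))\<^sup>2) \<ge> 1"
  using sum_mono2[of "{..<k}" "{..<1}" "\<lambda>i. (chebyshev_U i c)\<^sup>2"] by simp

lemma jacobi_vec_rows:
  assumes k: "k \<ge> 1" and r: "r \<in> jacobi_roots \<mu> k" and s: "s \<in> jacobi_roots \<mu> k"
  shows "(\<Sum>j<k. jacobi_vec \<mu> k r j * jacobi_vec \<mu> k s j) = (if r = s then 1 else 0)"
proof -
  obtain n where n: "k = Suc n" using k by (cases k) auto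
  let ?N = "\<lambda>r. \<Sum>i<k. (chebyshev_U i ((r + \<mu>) / 4))\<^sup>2"
  have N: "?N r \<ge> 1" for r by (rule sum_chebyshev_U_ge_1[OF k])
  have "(\<Sum>j<k. jacobi_vec \<mu> k r j * jacobi_vec \<mu> k s j)
    = (\<Sum>j<k. chebyshev_U j ((r + \<mu>) / 4) * chebyshev_U j ((s + \<mu>) / 4)) / (sqrt (?N r) * sqrt (?N s))"
    by (simp add: jacobi_vec_def sum_divide_distrib)
  moreover have "(\<Sum>j<k. chebyshev_U j ((r + \<mu>) / 4) * chebyshev_U j ((s + \<mu>) / 4)) = 0" if "r \<noteq> s"
    using jacobi_char_christoffel[of "(r + \<mu>) / 4" "(s + \<mu>) / 4" n \<mu>] r s that
    by (simp add: n jacobi_roots_Suc lessThan_Suc_atMost del: sum.lessThan_Suc)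
  moreover have "(\<Sum>j<k. chebyshev_U j ((r + \<mu>) / 4) * chebyshev_U j ((r + \<mu>) / 4)) = sqrt (?N r) * sqrt (?N r)"
    using N[of r] by (simp add: power2_eq_square[symmetric])
  moreover have "sqrt (?N r) \<noteq> 0" using N[of r] by simp
  ultimately show ?thesis by auto
qed

text \<open>
  By Bessel every column has norm at most one, and the squares of these norms add up to \<open>k\<close>.
\<close>

lemma orthonormal_rows_imp_columns:
  fixes f :: "'r \<Rightarrow> nat \<Rightarrow> real"
  assumes S: "finite S" "card S = k"
    and rows: "\<And>r s. r \<in> S \<Longrightarrow> s \<in> S \<Longrightarrow> (\<Sum>j<k. f r j * f s j) = (if r = s then 1 else 0)"
    and ij: "i < k" "j < k"
  shows "(\<Sum>r\<in>S. f r i * f r j) = (if i = j then 1 else 0)"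
proof -
  \<comment> \<open>The defect of the column Gram matrix from the identity. Its squared entries
    along row \<open>i\<close> add up to the amount by which the squared norm of column
    \<open>i\<close> falls short of 1.\<close>
  define d where "d i j = (if i = j then 1 else 0) - (\<Sum>r\<in>S. f r i * f r j)" for i j
  have defect: "(\<Sum>j<k. (d i j)\<^sup>2) = 1 - (\<Sum>r\<in>S. (f r i)\<^sup>2)" if i: "i < k" for i
  proof -
    have "(\<Sum>j<k. (\<Sum>r\<in>S. f r i * f r j)\<^sup>2) = (\<Sum>j<k. \<Sum>r\<in>S. \<Sum>s\<in>S. f r i * f s i * (f r j * f s j))"
      by (simp add: power2_eq_square sum_product mult_ac)
    also have "\<dots> = (\<Sum>r\<in>S. \<Sum>s\<in>S. f r i * f s i * (\<Sum>j<k. f r j * f s j))"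
      unfolding sum_distrib_left by (subst sum.swap, intro sum.cong refl, rule sum.swap)
    also have "\<dots> = (\<Sum>r\<in>S. \<Sum>s\<in>S. if r = s then (f r i)\<^sup>2 else 0)"
      by (intro sum.cong refl) (simp add: rows power2_eq_square)
    finally have sq: "(\<Sum>j<k. (\<Sum>r\<in>S. f r i * f r j)\<^sup>2) = (\<Sum>r\<in>S. (f r i)\<^sup>2)"
      using S by simp
    have "(\<Sum>j<k. (d i j)\<^sup>2) = (\<Sum>j<k. (if i = j then 1 - 2 * (\<Sum>r\<in>S. f r i * f r j) else 0)
        + (\<Sum>r\<in>S. f r i * f r j)\<^sup>2)"
      by (intro sum.cong refl) (simp add: d_def power2_eq_square algebra_simps)
    also have "\<dots> = 1 - (\<Sum>r\<in>S. (f r i)\<^sup>2)"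
      using i by (simp add: sum.distrib sq) (simp add: power2_eq_square)
    finally show ?thesis .
  qed
  have "(\<Sum>i<k. \<Sum>j<k. (d i j)\<^sup>2) = real k - (\<Sum>i<k. \<Sum>r\<in>S. (f r i)\<^sup>2)"
    by (simp add: defect sum_subtractf)
  also have "(\<Sum>i<k. \<Sum>r\<in>S. (f r i)\<^sup>2) = (\<Sum>r\<in>S. \<Sum>i<k. f r i * f r i)"
    unfolding power2_eq_square by (rule sum.swap)
  also have "\<dots> = real k" using S by (simp add: rows)
  finally have "(\<Sum>i<k. \<Sum>j<k. (d i j)\<^sup>2) = 0" by simp
  then have "(\<Sum>j<k. (d i j)\<^sup>2) = 0"
    using ij by (subst (asm) sum_nonneg_eq_0_iff) (auto intro: sum_nonneg)
  then have "(d i j)\<^sup>2 = 0"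
    using ij by (subst (asm) sum_nonneg_eq_0_iff) auto
  then show ?thesis by (simp add: d_def)
qed

lemma jacobi_vec_columns:
  assumes k: "k \<ge> 1" and "i < k" "j < k"
  shows "(\<Sum>r\<in>jacobi_roots \<mu> k. jacobi_vec \<mu> k r i * jacobi_vec \<mu> k r j) = (if i = j then 1 else 0)"
  by (rule orthonormal_rows_imp_columns[OF finite_jacobi_roots[OF k] card_jacobi_roots[OF k]])
    (use assms jacobi_vec_rows in auto)

text \<open>All rows but the last are the recurrence with r + \<mu> = 4c; in the last row the entry
  \<mu> replaces -\<mu>, and the root equation supplies what the missing neighbour would
  contribute.\<close>

lemma jacobi_vec_eigen:
  assumes "k \<ge> 1" and r: "r \<in> jacobi_roots \<mu> k" and "j < k"
  shows "2 * (if j = 0 then 0 else jacobi_vec \<mu> k r (j - 1))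
    + (if Suc j = k then \<mu> else - \<mu>) * jacobi_vec \<mu> k r j
    + 2 * (if Suc j = k then 0 else jacobi_vec \<mu> k r (Suc j)) = r * jacobi_vec \<mu> k r j"
proof -
  define N where "N = sqrt (\<Sum>i<k. (chebyshev_U i ((r + \<mu>) / 4))\<^sup>2)"
  define U where "U j = chebyshev_U j ((r + \<mu>) / 4)" for j
  have vec: "jacobi_vec \<mu> k r j = U j / N" for j by (simp add: jacobi_vec_def U_def N_def)
  have rec: "2 * (if j = 0 then 0 else U (j - 1)) + 2 * U (Suc j) = (r + \<mu>) * U j"
    by (cases j) (simp_all add: U_def field_simps)
  have last: "U (Suc j) = \<mu> * U j" if "Suc j = k"
    using r that by (auto simp: jacobi_roots_Suc jacobi_char_def U_def)
  have "2 * (if j = 0 then 0 else U (j - 1)) + (if Suc j = k then \<mu> else - \<mu>) * U j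
      + 2 * (if Suc j = k then 0 else U (Suc j)) = r * U j"
    using rec last by (auto simp: algebra_simps)
  then have "(2 * (if j = 0 then 0 else U (j - 1)) + (if Suc j = k then \<mu> else - \<mu>) * U j
      + 2 * (if Suc j = k then 0 else U (Suc j))) / N = r * U j / N"
    by simp
  then show ?thesis
    unfolding vec by (auto simp: add_divide_distrib diff_divide_distrib split: if_splits)
qed

text \<open>The vector of the U_j at an arbitrary \<open>z\<close> satisfies the eigenvector
  equation except in the last row, where the error is twice \<open>jacobi_char\<close> up to sign. A
  symmetric matrix has an eigenvalue within the quotient of the residual and the norm of a trial
  vector.\<close>

lemma jacobi_root_near:
  "\<exists>r\<in>jacobi_roots \<mu> (Suc n). (z - r)\<^sup>2 * (\<Sum>j<Suc n. (chebyshev_U j ((z + \<mu>) / 4))\<^sup>2)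
    \<le> 4 * (jacobi_char \<mu> n ((z + \<mu>) / 4))\<^sup>2"
proof (rule ccontr)
  let ?k = "Suc n" and ?c = "(z + \<mu>) / 4" and ?R = "jacobi_roots \<mu> (Suc n)"
  define N where "N = (\<Sum>j<?k. (chebyshev_U j ?c)\<^sup>2)"
  define W where "W = jacobi_char \<mu> n ?c"
  define t where "t r = (\<Sum>j<?k. chebyshev_U j ?c * jacobi_vec \<mu> ?k r j)" for r
  assume "\<not> ?thesis"
  then have far: "4 * W\<^sup>2 < (z - r)\<^sup>2 * N" if "r \<in> ?R" for r
    using that unfolding N_def W_def by (meson not_less)
  \<comment> \<open>In the eigenbasis the residual has the coefficient \<open>(z - r) * t r\<close>;
    it is supported on the last site \<open>n\<close>.\<close>
  have t: "(z - r) * t r = 2 * W * jacobi_vec \<mu> ?k r n" if r: "r \<in> ?R" for r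
  proof -
    define M where "M = sqrt (\<Sum>i<?k. (chebyshev_U i ((r + \<mu>) / 4))\<^sup>2)"
    have "(z - r) * (\<Sum>j<?k. chebyshev_U j ?c * chebyshev_U j ((r + \<mu>) / 4))
        = 2 * W * chebyshev_U n ((r + \<mu>) / 4)"
      using jacobi_char_christoffel[of ?c "(r + \<mu>) / 4" n \<mu>] r
      by (simp add: W_def jacobi_roots_Suc lessThan_Suc_atMost del: sum.lessThan_Suc)
        (simp add: field_simps)
    then have "(z - r) * (\<Sum>j<?k. chebyshev_U j ?c * chebyshev_U j ((r + \<mu>) / 4)) / M
        = 2 * W * chebyshev_U n ((r + \<mu>) / 4) / M" by simp
    then show ?thesis
      unfolding t_def jacobi_vec_def M_def[symmetric]
      by (simp only: times_divide_eq_right sum_divide_distrib[symmetric])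
  qed
  have fin: "finite ?R" by (rule finite_jacobi_roots) simp
  have "(\<Sum>r\<in>?R. (t r)\<^sup>2) = (\<Sum>r\<in>?R. \<Sum>i<?k. \<Sum>j<?k. chebyshev_U i ?c * chebyshev_U j ?c
      * (jacobi_vec \<mu> ?k r i * jacobi_vec \<mu> ?k r j))"
    unfolding t_def power2_eq_square sum_product by (simp only: mult_ac)
  also have "\<dots> = (\<Sum>i<?k. \<Sum>j<?k. chebyshev_U i ?c * chebyshev_U j ?c
      * (\<Sum>r\<in>?R. jacobi_vec \<mu> ?k r i * jacobi_vec \<mu> ?k r j))"
    unfolding sum_distrib_left by (subst sum.swap, intro sum.cong refl, rule sum.swap)
  also have "\<dots> = (\<Sum>i<?k. \<Sum>j<?k. if i = j then (chebyshev_U i ?c)\<^sup>2 else 0)"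
    by (intro sum.cong refl) (simp add: jacobi_vec_columns power2_eq_square)
  also have "\<dots> = N" unfolding N_def by (simp del: sum.lessThan_Suc)
  finally have tN: "(\<Sum>r\<in>?R. (t r)\<^sup>2) = N" .
  have N1: "N \<ge> 1" unfolding N_def by (rule sum_chebyshev_U_ge_1) simp
  have "\<exists>r\<in>?R. t r \<noteq> 0"
  proof (rule ccontr)
    assume "\<not> ?thesis"
    then have "(\<Sum>r\<in>?R. (t r)\<^sup>2) = 0" by (intro sum.neutral) simp
    then show False using tN N1 by simp
  qed
  then obtain r0 where r0: "r0 \<in> ?R" "t r0 \<noteq> 0" by blast
  \<comment> \<open>Summing the strict bounds with the weights \<open>(t r)\<^sup>2\<close> and
    using that column \<open>n\<close> has norm 1 gives the same number
    \<open>4 * W\<^sup>2 * N\<close> on both sides.\<close>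
  have "(\<Sum>r\<in>?R. 4 * W\<^sup>2 * (t r)\<^sup>2) < (\<Sum>r\<in>?R. (z - r)\<^sup>2 * N * (t r)\<^sup>2)"
  proof (rule sum_strict_mono_ex1[OF fin])
    show "\<forall>r\<in>?R. 4 * W\<^sup>2 * (t r)\<^sup>2 \<le> (z - r)\<^sup>2 * N * (t r)\<^sup>2"
      using far by (intro ballI mult_right_mono) (auto simp: less_imp_le)
    show "\<exists>r\<in>?R. 4 * W\<^sup>2 * (t r)\<^sup>2 < (z - r)\<^sup>2 * N * (t r)\<^sup>2"
      using r0 far by (intro bexI[of _ r0] mult_strict_right_mono) auto
  qed
  also have "(\<Sum>r\<in>?R. (z - r)\<^sup>2 * N * (t r)\<^sup>2) = (\<Sum>r\<in>?R. N * ((z - r) * t r)\<^sup>2)"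
    by (intro sum.cong refl) (simp add: power_mult_distrib)
  also have "\<dots> = (\<Sum>r\<in>?R. N * (4 * W\<^sup>2) * (jacobi_vec \<mu> ?k r n * jacobi_vec \<mu> ?k r n))"
    by (intro sum.cong refl) (simp add: t power2_eq_square)
  also have "\<dots> = N * (4 * W\<^sup>2)"
    unfolding sum_distrib_left[symmetric] by (subst jacobi_vec_columns) auto
  also have "(\<Sum>r\<in>?R. 4 * W\<^sup>2 * (t r)\<^sup>2) = 4 * W\<^sup>2 * N"
    unfolding sum_distrib_left[symmetric] tN ..
  finally show False by simp
qed

text \<open>A quadratic form conserved by the recurrence. For |c| < 1 it is definite and bounds
  consecutive values above; for |c| \<le> 1 it bounds their squares below by 1/2 in total.\<close>

lemma chebyshev_U_invariant:
  "(chebyshev_U (Suc n) c)\<^sup>2 + (chebyshev_U n c)\<^sup>2 - 2 * c * chebyshev_U n c * chebyshev_U (Suc n) c = 1"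
  for c :: "'a :: comm_ring_1"
  by (induction n) (simp_all add: power2_eq_square algebra_simps)

lemma two_mult_le_abs: "2 * c * a * b \<le> \<bar>c\<bar> * (a\<^sup>2 + b\<^sup>2)" "- (\<bar>c\<bar> * (a\<^sup>2 + b\<^sup>2)) \<le> 2 * c * a * b"
  for a b c :: real
proof -
  have "\<bar>2 * c * a * b\<bar> = \<bar>c\<bar> * (2 * \<bar>a\<bar> * \<bar>b\<bar>)" by (simp add: abs_mult)
  also have "\<dots> \<le> \<bar>c\<bar> * (a\<^sup>2 + b\<^sup>2)"
    using sum_squares_bound[of "\<bar>a\<bar>" "\<bar>b\<bar>"] by (intro mult_left_mono) auto
  finally show "2 * c * a * b \<le> \<bar>c\<bar> * (a\<^sup>2 + b\<^sup>2)" "- (\<bar>c\<bar> * (a\<^sup>2 + b\<^sup>2)) \<le> 2 * c * a * b"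
    by linarith+
qed

lemma chebyshev_U_pair_ge:
  assumes "\<bar>c\<bar> \<le> (1 :: real)"
  shows "1 / 2 \<le> (chebyshev_U n c)\<^sup>2 + (chebyshev_U (Suc n) c)\<^sup>2"
proof -
  let ?s = "(chebyshev_U n c)\<^sup>2 + (chebyshev_U (Suc n) c)\<^sup>2"
  have "1 \<le> ?s + \<bar>c\<bar> * ?s"
    using chebyshev_U_invariant[of n c] two_mult_le_abs(2)[of c "chebyshev_U n c" "chebyshev_U (Suc n) c"]
    by linarith
  also have "\<dots> \<le> ?s + 1 * ?s" using assms by (intro add_left_mono mult_right_mono) auto
  finally show ?thesis by simp
qed

lemma chebyshev_U_square_le:
  assumes "\<bar>c\<bar> < (1 :: real)"
  shows "(chebyshev_U n c)\<^sup>2 \<le> 1 / (1 - \<bar>c\<bar>)" "(chebyshev_U (Suc n) c)\<^sup>2 \<le> 1 / (1 - \<bar>c\<bar>)"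
proof -
  let ?s = "(chebyshev_U n c)\<^sup>2 + (chebyshev_U (Suc n) c)\<^sup>2"
  have "?s - \<bar>c\<bar> * ?s \<le> 1"
    using chebyshev_U_invariant[of n c] two_mult_le_abs(1)[of c "chebyshev_U n c" "chebyshev_U (Suc n) c"]
    by linarith
  then have "?s \<le> 1 / (1 - \<bar>c\<bar>)"
    using assms by (simp add: pos_le_divide_eq algebra_simps)
  then show "(chebyshev_U n c)\<^sup>2 \<le> 1 / (1 - \<bar>c\<bar>)" "(chebyshev_U (Suc n) c)\<^sup>2 \<le> 1 / (1 - \<bar>c\<bar>)"
    using zero_le_power2[of "chebyshev_U n c"] zero_le_power2[of "chebyshev_U (Suc n) c"] by linarith+
qed

lemma sum_chebyshev_U_ge:
  assumes "\<bar>c\<bar> \<le> (1 :: real)"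
  shows "real m / 2 \<le> (\<Sum>j<2 * m. (chebyshev_U j c)\<^sup>2)"
proof (induction m)
  case (Suc m)
  then show ?case using chebyshev_U_pair_ge[OF assms, of "2 * m"] by simp
qed simp

text \<open>Inside the open band the residual stays bounded while the squared norm of the trial
  vector grows linearly with the block, so some root comes arbitrarily close. The bound degenerates
  at the ends of the band, which are recovered later by closure.\<close>

lemma jacobi_roots_dense:
  assumes z: "z \<in> {- 4 - \<mu><..<4 - \<mu>}" and "\<epsilon> > 0"
  shows "\<exists>k\<ge>1. \<exists>r\<in>jacobi_roots \<mu> k. \<bar>z - r\<bar> < \<epsilon>"
proof -
  let ?c = "(z + \<mu>) / 4"
  have c: "\<bar>?c\<bar> < 1" using z by auto
  \<comment> \<open>Both values in \<open>jacobi_char\<close> have square at most 1 / (1 - |c|), and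
    the factor 4 is the one in \<open>jacobi_root_near\<close>.\<close>
  define K where "K = 4 * ((1 + \<bar>\<mu>\<bar>)\<^sup>2 * (1 / (1 - \<bar>?c\<bar>)))"
  have bound: "4 * (jacobi_char \<mu> n ?c)\<^sup>2 \<le> K" for n
  proof -
    define q where "q = sqrt (1 / (1 - \<bar>?c\<bar>))"
    have q: "\<bar>chebyshev_U n ?c\<bar> \<le> q" "\<bar>chebyshev_U (Suc n) ?c\<bar> \<le> q"
      unfolding q_def using chebyshev_U_square_le[OF c, of n] by (auto intro!: real_le_rsqrt simp: power2_abs)
    have "\<bar>jacobi_char \<mu> n ?c\<bar> \<le> \<bar>chebyshev_U (Suc n) ?c\<bar> + \<bar>\<mu>\<bar> * \<bar>chebyshev_U n ?c\<bar>"
      unfolding jacobi_char_def abs_mult[symmetric] by (rule abs_triangle_ineq4)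
    also have "\<dots> \<le> q + \<bar>\<mu>\<bar> * q" using q by (intro add_mono mult_left_mono) auto
    also have "\<dots> = (1 + \<bar>\<mu>\<bar>) * q" by (simp add: algebra_simps)
    finally have "(jacobi_char \<mu> n ?c)\<^sup>2 \<le> ((1 + \<bar>\<mu>\<bar>) * q)\<^sup>2"
      by (rule abs_le_square_iff[THEN iffD1, OF order_trans]) simp
    also have "\<dots> = (1 + \<bar>\<mu>\<bar>)\<^sup>2 * (1 / (1 - \<bar>?c\<bar>))"
      using c by (simp add: power_mult_distrib q_def)
    finally show ?thesis by (simp add: K_def)
  qed
  \<comment> \<open>A block of size \<open>2 * m\<close> consists of \<open>m\<close> consecutive
    pairs, each contributing at least 1/2 to the squared norm.\<close>
  obtain m where m: "real m > 2 * K / \<epsilon>\<^sup>2" using reals_Archimedean2 by blast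
  have K0: "K \<ge> 0" using c by (auto simp: K_def)
  then have "real m > 0" using m \<open>\<epsilon> > 0\<close> by (metis divide_nonneg_pos le_less_trans mult_nonneg_nonneg zero_le_numeral zero_less_power)
  then have k: "2 * m \<ge> 1" by simp
  then obtain n where n: "2 * m = Suc n" by (cases "2 * m") auto
  obtain r where r: "r \<in> jacobi_roots \<mu> (Suc n)"
    "(z - r)\<^sup>2 * (\<Sum>j<Suc n. (chebyshev_U j ?c)\<^sup>2) \<le> 4 * (jacobi_char \<mu> n ?c)\<^sup>2"
    using jacobi_root_near by blast
  have "(z - r)\<^sup>2 * (real m / 2) \<le> (z - r)\<^sup>2 * (\<Sum>j<Suc n. (chebyshev_U j ?c)\<^sup>2)"
    using sum_chebyshev_U_ge[of ?c m] c unfolding n by (intro mult_left_mono) auto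
  also have "\<dots> \<le> K" using r(2) bound[of n] by linarith
  also have "K < \<epsilon>\<^sup>2 * (real m / 2)"
    using m \<open>\<epsilon> > 0\<close> by (simp add: field_simps)
  finally have "(z - r)\<^sup>2 < \<epsilon>\<^sup>2" using \<open>real m > 0\<close> by simp
  then have "\<bar>z - r\<bar> < \<epsilon>" using \<open>\<epsilon> > 0\<close>
    by (intro power_less_imp_less_base[of "\<bar>z - r\<bar>" 2 \<epsilon>]) (simp_all add: less_imp_le)
  then show ?thesis using r(1) by (intro exI[of _ "Suc n"]) auto
qed

lemma abs_chebyshev_U_strict_mono:
  assumes "\<bar>c\<bar> > (1 :: real)"
  shows "\<bar>chebyshev_U n c\<bar> < \<bar>chebyshev_U (Suc n) c\<bar>"
proof (induction n)
  case (Suc n)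
  have "2 * \<bar>chebyshev_U (Suc n) c\<bar> \<le> \<bar>2 * c\<bar> * \<bar>chebyshev_U (Suc n) c\<bar>"
    using assms by (intro mult_right_mono) auto
  also have "\<dots> = \<bar>chebyshev_U (Suc (Suc n)) c + chebyshev_U n c\<bar>"
    by (simp add: abs_mult)
  finally show ?case using Suc abs_triangle_ineq[of "chebyshev_U (Suc (Suc n)) c" "chebyshev_U n c"]
    by linarith
qed (use assms in simp)

text \<open>Outside the band |U_n| is strictly increasing in \<open>n\<close>, which contradicts
  U_(n+1) = \<mu> U_n when |\<mu>| \<le> 1.\<close>

lemma jacobi_roots_subset:
  assumes "\<bar>\<mu>\<bar> \<le> 1" "k \<ge> 1"
  shows "jacobi_roots \<mu> k \<subseteq> {- 4 - \<mu>..4 - \<mu>}"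
proof
  fix r assume r: "r \<in> jacobi_roots \<mu> k"
  obtain n where n: "k = Suc n" using assms by (cases k) auto
  let ?c = "(r + \<mu>) / 4"
  have "\<bar>?c\<bar> \<le> 1"
  proof (rule ccontr)
    assume "\<not> \<bar>?c\<bar> \<le> 1"
    then have "\<bar>chebyshev_U n ?c\<bar> < \<bar>chebyshev_U (Suc n) ?c\<bar>"
      by (intro abs_chebyshev_U_strict_mono) simp
    moreover have "chebyshev_U (Suc n) ?c = \<mu> * chebyshev_U n ?c"
      using r by (simp add: n jacobi_roots_Suc jacobi_char_def)
    moreover have "\<bar>\<mu> * chebyshev_U n ?c\<bar> \<le> 1 * \<bar>chebyshev_U n ?c\<bar>"
      unfolding abs_mult using assms by (intro mult_right_mono) auto
    ultimately show False by simp
  qed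
  then show "r \<in> {- 4 - \<mu>..4 - \<mu>}" by (auto simp: abs_le_iff)
qed

text \<open>At this \<open>c\<close> the recurrence has the characteristic roots \<mu> and 1/\<mu>;
  forming U_(n+1) - \<mu> U_n removes the powers of \<mu> and leaves those of 1/\<mu>.\<close>

lemma jacobi_char_edge:
  assumes "\<mu> \<noteq> 0"
  shows "jacobi_char \<mu> n ((\<mu> + 1 / \<mu>) / 2) = (1 / \<mu>) ^ Suc n"
proof (induction n)
  case (Suc n)
  let ?c = "(\<mu> + 1 / \<mu>) / 2"
  have "jacobi_char \<mu> (Suc n) ?c = 1 / \<mu> * jacobi_char \<mu> n ?c"
    using assms unfolding jacobi_char_def chebyshev_U.simps(3) by (simp add: field_simps)
  then show ?case by (simp add: Suc)
qed (use assms in \<open>simp add: jacobi_char_def field_simps\<close>)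

text \<open>The trial vector at \<mu> + 2/\<mu> has norm at least 1 and a residual that decays
  geometrically without ever being 0: the roots approach the point but never reach it.\<close>

lemma jacobi_roots_edge:
  assumes "\<bar>\<mu>\<bar> > 1"
  shows "k \<ge> 1 \<Longrightarrow> \<mu> + 2 / \<mu> \<notin> jacobi_roots \<mu> k"
    and "\<epsilon> > 0 \<Longrightarrow> \<exists>k\<ge>1. \<exists>r\<in>jacobi_roots \<mu> k. \<bar>\<mu> + 2 / \<mu> - r\<bar> < \<epsilon>"
proof -
  let ?z = "\<mu> + 2 / \<mu>"
  have c: "(?z + \<mu>) / 4 = (\<mu> + 1 / \<mu>) / 2" by (simp add: field_simps)
  have \<mu>: "\<mu> \<noteq> 0" using assms by auto
  show "?z \<notin> jacobi_roots \<mu> k" if k: "k \<ge> 1"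
  proof -
    obtain n where n: "k = Suc n" using k by (cases k) auto
    show ?thesis
      unfolding n jacobi_roots_Suc mem_Collect_eq c jacobi_char_edge[OF \<mu>] using \<mu> by simp
  qed
  show "\<exists>k\<ge>1. \<exists>r\<in>jacobi_roots \<mu> k. \<bar>?z - r\<bar> < \<epsilon>" if \<epsilon>: "\<epsilon> > 0"
  proof -
    have "\<bar>1 / \<mu>\<bar> < 1" using assms by (simp add: field_simps)
    then obtain n where n: "\<bar>1 / \<mu>\<bar> ^ n < \<epsilon> / 2"
      using real_arch_pow_inv[of "\<epsilon> / 2" "\<bar>1 / \<mu>\<bar>"] \<epsilon> by auto
    obtain r where r: "r \<in> jacobi_roots \<mu> (Suc n)"
      "(?z - r)\<^sup>2 * (\<Sum>j<Suc n. (chebyshev_U j ((?z + \<mu>) / 4))\<^sup>2) \<le> 4 * (jacobi_char \<mu> n ((?z + \<mu>) / 4))\<^sup>2"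
      using jacobi_root_near by blast
    have "(?z - r)\<^sup>2 * 1 \<le> (?z - r)\<^sup>2 * (\<Sum>j<Suc n. (chebyshev_U j ((?z + \<mu>) / 4))\<^sup>2)"
      by (intro mult_left_mono sum_chebyshev_U_ge_1) auto
    also have "\<dots> \<le> (2 * (1 / \<mu>) ^ Suc n)\<^sup>2"
      using r(2) by (simp only: c jacobi_char_edge[OF \<mu>] power_mult_distrib) simp
    finally have "\<bar>?z - r\<bar> \<le> \<bar>2 * (1 / \<mu>) ^ Suc n\<bar>"
      unfolding abs_le_square_iff by simp
    also have "\<dots> = 2 * (\<bar>1 / \<mu>\<bar> * \<bar>1 / \<mu>\<bar> ^ n)"
      by (simp add: abs_mult power_abs)
    also have "\<dots> \<le> 2 * (1 * \<bar>1 / \<mu>\<bar> ^ n)"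
      using \<open>\<bar>1 / \<mu>\<bar> < 1\<close> by (intro mult_left_mono mult_right_mono) auto
    also have "\<dots> < \<epsilon>" using n by simp
    finally show ?thesis using r(1) by (intro exI[of _ "Suc n"]) auto
  qed
qed

text \<open>In the variable \<open>c\<close> the claim is |\<mu> + 1/\<mu>| > 2, that is, (|\<mu>| -
  1)^2 > 0.\<close>

lemma edge_notin_band:
  assumes "\<bar>\<mu>\<bar> > (1 :: real)"
  shows "\<mu> + 2 / \<mu> \<notin> {- 4 - \<mu>..4 - \<mu>}"
proof -
  have "(\<bar>\<mu>\<bar> - 1)\<^sup>2 > 0" using assms by simp
  then have "2 * \<bar>\<mu>\<bar> < \<mu>\<^sup>2 + 1" by (simp add: power2_eq_square algebra_simps)
  then show ?thesis
    using assms by (cases "\<mu> > 0") (auto simp: field_simps power2_eq_square)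
qed

subsection \<open>Orthogonal sums of Jacobi blocks\<close>

text \<open>The mass of \<open>B\<close> under the spectral measure of the finite block at its site
  \<open>j\<close>.\<close>

definition jacobi_measure :: "real \<Rightarrow> nat \<Rightarrow> nat \<Rightarrow> real set \<Rightarrow> real" where
  "jacobi_measure \<mu> k j B = (\<Sum>r\<in>jacobi_roots \<mu> k. (jacobi_vec \<mu> k r j)\<^sup>2 * indicator B r)"

lemma jacobi_measure_nonneg: "jacobi_measure \<mu> k j B \<ge> 0"
  unfolding jacobi_measure_def by (rule sum_nonneg) simp

text \<open>The trace of a spectral projection: each eigenvector is a unit vector, so its weights
  over all sites add up to 1.\<close>

lemma sum_jacobi_measure:
  assumes "k \<ge> 1"
  shows "(\<Sum>j<k. jacobi_measure \<mu> k j B) = (\<Sum>r\<in>jacobi_roots \<mu> k. indicator B r)"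
proof -
  have "(\<Sum>j<k. jacobi_measure \<mu> k j B)
      = (\<Sum>r\<in>jacobi_roots \<mu> k. \<Sum>j<k. (jacobi_vec \<mu> k r j)\<^sup>2 * indicator B r)"
    unfolding jacobi_measure_def by (rule sum.swap)
  also have "\<dots> = (\<Sum>r\<in>jacobi_roots \<mu> k. indicator B r)"
  proof (rule sum.cong[OF refl])
    fix r assume r: "r \<in> jacobi_roots \<mu> k"
    have "(\<Sum>j<k. (jacobi_vec \<mu> k r j)\<^sup>2) = 1"
      using jacobi_vec_rows[OF assms r r] by (simp add: power2_eq_square)
    then show "(\<Sum>j<k. (jacobi_vec \<mu> k r j)\<^sup>2 * indicator B r) = (indicator B r :: real)"
      unfolding sum_distrib_right[symmetric] by simp
  qed
  finally show ?thesis .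
qed

text \<open>The truncated left and right shifts are adjoint to each other, which is the symmetry of
  the off-diagonal part of a block.\<close>

lemma sum_shift_adjoint:
  fixes w c :: "nat \<Rightarrow> 'a :: comm_ring_1"
  assumes "k \<ge> 1"
  shows "(\<Sum>j<k. w j * (if j = 0 then 0 else c (j - 1))) = (\<Sum>j<k. (if Suc j = k then 0 else w (Suc j)) * c j)"
proof -
  obtain n where n: "k = Suc n" using assms by (cases k) auto
  have "(\<Sum>j<Suc n. (if Suc j = Suc n then 0 else w (Suc j)) * c j) = (\<Sum>j<n. w (Suc j) * c j)"
    by simp
  then show ?thesis unfolding n by (subst sum.lessThan_Suc_shift) simp
qed

text \<open>A common interface for the chain, where \<open>\<phi>\<close> consists of delta
  functions at sites, and for the group, where it consists of characters on windows. The sites of a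
  block are numbered from 0, and only the last carries \<mu> instead of -\<mu>.\<close>

locale block_operator =
  fixes I :: "'b set" and k :: "'b \<Rightarrow> nat" and \<phi> :: "'b \<Rightarrow> nat \<Rightarrow> 'a ell2"
    and A :: "'a ell2 \<Rightarrow> 'a ell2" and \<mu> :: real
  assumes k_ge_1: "\<beta> \<in> I \<Longrightarrow> k \<beta> \<ge> 1"
    and phi_orth: "\<beta> \<in> I \<Longrightarrow> j < k \<beta> \<Longrightarrow> \<gamma> \<in> I \<Longrightarrow> i < k \<gamma> \<Longrightarrow>
      cinner (\<phi> \<beta> j) (\<phi> \<gamma> i) = (if \<beta> = \<gamma> \<and> j = i then 1 else 0)"
    and phi_total: "(\<And>\<beta> j. \<beta> \<in> I \<Longrightarrow> j < k \<beta> \<Longrightarrow> cinner u (\<phi> \<beta> j) = 0) \<Longrightarrow> u = 0"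
    and A_phi: "\<beta> \<in> I \<Longrightarrow> j < k \<beta> \<Longrightarrow> cinner (A u) (\<phi> \<beta> j) =
      2 * (if j = 0 then 0 else cinner u (\<phi> \<beta> (j - 1)))
      + of_real (if Suc j = k \<beta> then \<mu> else - \<mu>) * cinner u (\<phi> \<beta> j)
      + 2 * (if Suc j = k \<beta> then 0 else cinner u (\<phi> \<beta> (Suc j)))"
begin

definition eigen_index :: "('b \<times> real) set" where
  "eigen_index = Sigma I (\<lambda>\<beta>. jacobi_roots \<mu> (k \<beta>))"

definition eigen_vec :: "'b \<times> real \<Rightarrow> 'a ell2" where
  "eigen_vec = (\<lambda>(\<beta>, r). \<Sum>j<k \<beta>. complex_of_real (jacobi_vec \<mu> (k \<beta>) r j) *\<^sub>C \<phi> \<beta> j)"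

lemma cinner_eigen_vec:
  "cinner u (eigen_vec (\<beta>, r)) = (\<Sum>j<k \<beta>. complex_of_real (jacobi_vec \<mu> (k \<beta>) r j) * cinner u (\<phi> \<beta> j))"
  by (simp add: eigen_vec_def cinner_sum_right cinner_scaleC_right)

lemma cinner_phi_eigen_vec:
  assumes "\<beta> \<in> I" "j < k \<beta>" "\<gamma> \<in> I"
  shows "cinner (\<phi> \<beta> j) (eigen_vec (\<gamma>, r)) = (if \<gamma> = \<beta> then complex_of_real (jacobi_vec \<mu> (k \<beta>) r j) else 0)"
proof -
  have "cinner (\<phi> \<beta> j) (eigen_vec (\<gamma>, r))
      = (\<Sum>i<k \<gamma>. if i = j then (if \<gamma> = \<beta> then complex_of_real (jacobi_vec \<mu> (k \<gamma>) r j) else 0) else 0)"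
    unfolding cinner_eigen_vec using assms by (intro sum.cong refl) (auto simp: phi_orth)
  then show ?thesis using assms by auto
qed

text \<open>Orthonormality of the columns recovers the coefficients at sites from those at
  eigenvectors, so totality passes from \<open>\<phi>\<close> to the eigenvectors.\<close>

lemma cinner_phi:
  assumes "\<beta> \<in> I" "j < k \<beta>"
  shows "cinner u (\<phi> \<beta> j)
    = (\<Sum>r\<in>jacobi_roots \<mu> (k \<beta>). complex_of_real (jacobi_vec \<mu> (k \<beta>) r j) * cinner u (eigen_vec (\<beta>, r)))"
proof -
  let ?w = "\<lambda>r j. jacobi_vec \<mu> (k \<beta>) r j" and ?R = "jacobi_roots \<mu> (k \<beta>)"
  have "(\<Sum>r\<in>?R. complex_of_real (?w r j) * cinner u (eigen_vec (\<beta>, r)))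
      = (\<Sum>i<k \<beta>. (\<Sum>r\<in>?R. complex_of_real (?w r j * ?w r i)) * cinner u (\<phi> \<beta> i))"
    unfolding cinner_eigen_vec sum_distrib_left sum_distrib_right
    by (subst sum.swap) (simp add: mult_ac)
  also have "\<dots> = (\<Sum>i<k \<beta>. if i = j then cinner u (\<phi> \<beta> i) else 0)"
    unfolding of_real_sum[symmetric] using assms k_ge_1
    by (intro sum.cong refl) (auto simp: jacobi_vec_columns)
  finally show ?thesis using assms by simp
qed

sublocale diagonal eigen_index eigen_vec A snd
proof
  fix x y assume x: "x \<in> eigen_index" and y: "y \<in> eigen_index"
  obtain \<beta> r \<gamma> s where xy: "x = (\<beta>, r)" "y = (\<gamma>, s)" by (cases x, cases y)
  have "cinner (eigen_vec x) (eigen_vec y)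
      = (\<Sum>j<k \<beta>. complex_of_real (jacobi_vec \<mu> (k \<beta>) r j) * cinner (\<phi> \<beta> j) (eigen_vec (\<gamma>, s)))"
    by (simp add: xy eigen_vec_def[of] cinner_sum_left cinner_scaleC_left)
  also have "\<dots> = (\<Sum>j<k \<beta>. if \<gamma> = \<beta> then complex_of_real (jacobi_vec \<mu> (k \<beta>) r j * jacobi_vec \<mu> (k \<beta>) s j) else 0)"
    using x y by (intro sum.cong refl) (simp add: xy eigen_index_def cinner_phi_eigen_vec)
  also have "\<dots> = (if \<gamma> = \<beta> then complex_of_real (\<Sum>j<k \<beta>. jacobi_vec \<mu> (k \<beta>) r j * jacobi_vec \<mu> (k \<beta>) s j) else 0)"
    by (cases "\<gamma> = \<beta>") simp_all
  also have "\<dots> = (if x = y then 1 else 0)"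
  proof (cases "\<gamma> = \<beta>")
    case True
    then have "\<beta> \<in> I" "r \<in> jacobi_roots \<mu> (k \<beta>)" "s \<in> jacobi_roots \<mu> (k \<beta>)"
      using x y by (auto simp: xy eigen_index_def)
    then show ?thesis using jacobi_vec_rows[OF k_ge_1] True by (simp add: xy del: of_real_sum)
  qed (simp add: xy)
  finally show "cinner (eigen_vec x) (eigen_vec y) = (if x = y then 1 else 0)" .
next
  fix u assume "\<And>x. x \<in> eigen_index \<Longrightarrow> cinner u (eigen_vec x) = 0"
  then show "u = 0"
    by (intro phi_total) (simp add: cinner_phi eigen_index_def)
next
  fix x u assume x: "x \<in> eigen_index"
  obtain \<beta> r where xr: "x = (\<beta>, r)" by (cases x)
  have \<beta>: "\<beta> \<in> I" and r: "r \<in> jacobi_roots \<mu> (k \<beta>)" using x by (auto simp: xr eigen_index_def)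
  note k = k_ge_1[OF \<beta>]
  define w where "w j = complex_of_real (jacobi_vec \<mu> (k \<beta>) r j)" for j
  define c where "c j = cinner u (\<phi> \<beta> j)" for j
  define d where "d j = complex_of_real (if Suc j = k \<beta> then \<mu> else - \<mu>)" for j
  have "cinner (A u) (eigen_vec x) = (\<Sum>j<k \<beta>. w j * (2 * (if j = 0 then 0 else c (j - 1))
      + d j * c j + 2 * (if Suc j = k \<beta> then 0 else c (Suc j))))"
    unfolding xr cinner_eigen_vec w_def c_def d_def by (intro sum.cong refl) (simp add: A_phi \<beta>)
  also have "\<dots> = 2 * (\<Sum>j<k \<beta>. w j * (if j = 0 then 0 else c (j - 1))) + (\<Sum>j<k \<beta>. w j * d j * c j)
      + 2 * (\<Sum>j<k \<beta>. (if Suc j = k \<beta> then 0 else c (Suc j)) * w j)"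
    by (simp add: sum_distrib_left sum.distrib[symmetric] algebra_simps)
  \<comment> \<open>Both shifts are moved from the coefficients of \<open>u\<close> to the
    eigenvector, so that its eigenvector equation applies entry by entry.\<close>
  also have "\<dots> = (\<Sum>j<k \<beta>. (2 * (if j = 0 then 0 else w (j - 1)) + d j * w j
      + 2 * (if Suc j = k \<beta> then 0 else w (Suc j))) * c j)"
    unfolding sum_shift_adjoint[OF k, of w c] sum_shift_adjoint[OF k, of c w, symmetric]
    by (simp add: sum_distrib_left sum.distrib[symmetric] algebra_simps)
  also have "\<dots> = (\<Sum>j<k \<beta>. complex_of_real r * w j * c j)"
  proof (intro sum.cong refl)
    fix j assume "j \<in> {..<k \<beta>}"
    then have "complex_of_real (2 * (if j = 0 then 0 else jacobi_vec \<mu> (k \<beta>) r (j - 1))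
      + (if Suc j = k \<beta> then \<mu> else - \<mu>) * jacobi_vec \<mu> (k \<beta>) r j
      + 2 * (if Suc j = k \<beta> then 0 else jacobi_vec \<mu> (k \<beta>) r (Suc j))) = complex_of_real (r * jacobi_vec \<mu> (k \<beta>) r j)"
      using jacobi_vec_eigen[OF k r] by simp
    then show "(2 * (if j = 0 then 0 else w (j - 1)) + d j * w j
      + 2 * (if Suc j = k \<beta> then 0 else w (Suc j))) * c j = complex_of_real r * w j * c j"
      by (auto simp: w_def d_def)
  qed
  also have "\<dots> = complex_of_real (snd x) * cinner u (eigen_vec x)"
    by (simp add: xr cinner_eigen_vec w_def c_def sum_distrib_left mult.assoc)
  finally show "cinner (A u) (eigen_vec x) = complex_of_real (snd x) * cinner u (eigen_vec x)" .
qed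

lemma eigenvalues_block: "eigenvalues A = complex_of_real ` (\<Union>\<beta>\<in>I. jacobi_roots \<mu> (k \<beta>))"
  unfolding eigenvalues_eq eigen_index_def by force

text \<open>A site vector meets only the eigenvectors of its own block, so the spectral sum is
  finite.\<close>

lemma emeasure_spectral_measure_phi:
  assumes \<beta>: "\<beta> \<in> I" "j < k \<beta>" and B: "B \<in> sets borel"
  shows "emeasure (spectral_measure A (\<phi> \<beta> j)) B = ennreal (jacobi_measure \<mu> (k \<beta>) j B)"
proof -
  let ?f = "\<lambda>x. (cmod (cinner (\<phi> \<beta> j) (eigen_vec x)))\<^sup>2 * indicator B (snd x) :: real"
  have fin: "finite (jacobi_roots \<mu> (k \<beta>))" by (rule finite_jacobi_roots[OF k_ge_1[OF \<beta>(1)]])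
  have "infsum ?f eigen_index = infsum ?f (Pair \<beta> ` jacobi_roots \<mu> (k \<beta>))"
    by (rule infsum_cong_neutral) (use \<beta> in \<open>auto simp: eigen_index_def cinner_phi_eigen_vec\<close>)
  also have "\<dots> = sum ?f (Pair \<beta> ` jacobi_roots \<mu> (k \<beta>))"
    using fin by (intro infsum_finite finite_imageI)
  also have "\<dots> = (\<Sum>r\<in>jacobi_roots \<mu> (k \<beta>). ?f (\<beta>, r))"
    by (rule sum.reindex[unfolded o_def]) (simp add: inj_on_def)
  also have "\<dots> = jacobi_measure \<mu> (k \<beta>) j B"
    unfolding jacobi_measure_def using \<beta> by (simp add: cinner_phi_eigen_vec)
  finally show ?thesis unfolding emeasure_spectral_measure[OF B] by simp
qed

end

subsection \<open>The lamplighter operator\<close>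

text \<open>The rule would rewrite \<open>Poly_Mapping.single 0 1\<close>, the lamp at position 0,
  into the numeral 1.\<close>

declare single_one [simp del]

lemma translate_single: "translate m (Poly_Mapping.single s v) = Poly_Mapping.single (s + m) v"
  by (rule poly_mapping_eqI) (auto simp: translate.rep_eq lookup_single when_def)

lemma lamp_mult: "(x, m) \<otimes>\<^bsub>lamplighter\<^esub> (y, n) = (x + translate m y, m + n)"
  by (simp add: lamplighter_def)

text \<open>The element \<open>a\<^sup>i y\<close> of the group, for \<open>y\<close> in the base group.\<close>

definition coset_elt :: "int \<Rightarrow> (int \<Rightarrow>\<^sub>0 bit) \<Rightarrow> lamp" where
  "coset_elt i y = (translate i y, i)"

lemma coset_elt_eq_iff: "coset_elt i y = coset_elt j z \<longleftrightarrow> i = j \<and> y = z"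
proof -
  have "y = z" if "translate i y = translate i z"
    using arg_cong[OF that, of "translate (- i)"] by (simp add: translate_simps)
  then show ?thesis by (auto simp: coset_elt_def)
qed

lemma coset_elt_surj: "\<exists>i y. g = coset_elt i y"
proof (cases g)
  case (Pair x m)
  then have "g = coset_elt m (translate (- m) x)" by (simp add: coset_elt_def translate_simps)
  then show ?thesis by blast
qed

lemma lamp_inv_eqI: "h \<otimes>\<^bsub>lamplighter\<^esub> g = (0, 0) \<Longrightarrow> inv\<^bsub>lamplighter\<^esub> g = h"
  by (rule group.inv_equality[OF group_lamplighter]) (auto simp: lamplighter_def)

lemma single_add_single_bit: "Poly_Mapping.single s (1 :: bit) + Poly_Mapping.single s 1 = 0"
  unfolding Poly_Mapping.single_add[symmetric] by simp

lemma gen_b_eq: "gen_b = (Poly_Mapping.single 1 1, 1)"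
  by (simp add: gen_b_def gen_a_def gen_c_def lamp_mult translate_single)

lemma inv_gens:
  "inv\<^bsub>lamplighter\<^esub> gen_a = (0, - 1)"
  "inv\<^bsub>lamplighter\<^esub> gen_b = (Poly_Mapping.single 0 1, - 1)"
  "inv\<^bsub>lamplighter\<^esub> gen_c = gen_c"
  "inv\<^bsub>lamplighter\<^esub> (0, - 1) = gen_a"
  "inv\<^bsub>lamplighter\<^esub> (Poly_Mapping.single 0 1, - 1) = gen_b"
  by (rule lamp_inv_eqI; simp add: gen_a_def gen_b_eq gen_c_def lamp_mult translate_single
      translate_simps single_add_single_bit)+

text \<open>Since b = a c and its inverse is c a^(-1), every toggle is a \<open>c\<close> to the
  left of a power of \<open>a\<close>: moved past a^i it acts at \<open>- i\<close>, past a^(i-1) at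
  \<open>1 - i\<close>.\<close>

lemma gens_mult_coset_elt:
  "(0, - 1) \<otimes>\<^bsub>lamplighter\<^esub> coset_elt i y = coset_elt (i - 1) y"
  "gen_a \<otimes>\<^bsub>lamplighter\<^esub> coset_elt i y = coset_elt (i + 1) y"
  "(Poly_Mapping.single 0 1, - 1) \<otimes>\<^bsub>lamplighter\<^esub> coset_elt i y
    = coset_elt (i - 1) (y + Poly_Mapping.single (1 - i) 1)"
  "gen_b \<otimes>\<^bsub>lamplighter\<^esub> coset_elt i y = coset_elt (i + 1) (y + Poly_Mapping.single (- i) 1)"
  "gen_c \<otimes>\<^bsub>lamplighter\<^esub> coset_elt i y = coset_elt i (y + Poly_Mapping.single (- i) 1)"
  by (simp_all add: coset_elt_def gen_a_def gen_b_eq gen_c_def lamp_mult translate_simps translate_single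
      add.commute)

lemma convolution_superset:
  assumes "finite S" "Poly_Mapping.keys p \<subseteq> S"
  shows "convolution p u = (\<Sum>g\<in>S. Poly_Mapping.lookup p g *\<^sub>C left_regular g u)"
  unfolding convolution_def using assms
  by (intro sum.mono_neutral_left) (auto simp: in_keys_iff)

lemma convolution_add: "convolution (p + q) u = convolution p u + convolution q u"
proof -
  let ?S = "Poly_Mapping.keys p \<union> Poly_Mapping.keys q"
  have "convolution (p + q) u = (\<Sum>g\<in>?S. Poly_Mapping.lookup (p + q) g *\<^sub>C left_regular g u)"
    by (rule convolution_superset) (use keys_add[of p q] in auto)
  also have "\<dots> = convolution p u + convolution q u"
    by (simp add: lookup_add ell2.scale_left_distrib sum.distrib convolution_superset[of ?S])
  finally show ?thesis .
qed

lemma convolution_diff: "convolution (p - q) u = convolution p u - convolution q u"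
  using convolution_add[of "p - q" q u] by simp

lemma convolution_single: "convolution (Poly_Mapping.single g c) u = c *\<^sub>C left_regular g u"
  by (subst convolution_superset[of "{g}"]) auto

text \<open>In these coordinates \<open>y\<close> changes only by toggling lamp
  \<open>1 - i\<close>, in the terms leading to site \<open>i - 1\<close>, or lamp
  \<open>- i\<close>, in those leading to \<open>i + 1\<close> and in the term of \<mu>. A character
  in \<open>y\<close> replaces each toggle by a sign.\<close>

lemma M_op_apply:
  fixes \<mu> :: real
  shows "Rep_ell2 (M_op \<mu> u) (coset_elt i y) =
    Rep_ell2 u (coset_elt (i - 1) y) + Rep_ell2 u (coset_elt (i + 1) y)
    + Rep_ell2 u (coset_elt (i - 1) (y + Poly_Mapping.single (1 - i) 1))
    + Rep_ell2 u (coset_elt (i + 1) (y + Poly_Mapping.single (- i) 1))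
    - of_real \<mu> * Rep_ell2 u (coset_elt i (y + Poly_Mapping.single (- i) 1))"
  unfolding M_op_def convolution_add convolution_diff convolution_single
  by (simp add: Rep_ell2_simps left_regular.rep_eq inv_gens gens_mult_coset_elt)

section \<open>Characters and Fourier transforms over finite sets of lamps\<close>

definition indicator_lamp :: "int set \<Rightarrow> int \<Rightarrow>\<^sub>0 bit" where
  "indicator_lamp X = (\<Sum>s\<in>X. Poly_Mapping.single s 1)"

lemma lookup_indicator_lamp:
  assumes "finite X"
  shows "Poly_Mapping.lookup (indicator_lamp X) s = (if s \<in> X then 1 else 0)"
  using assms unfolding indicator_lamp_def
  by (induction X) (auto simp: lookup_add lookup_single when_def)

definition flip :: "'a \<Rightarrow> 'a set \<Rightarrow> 'a set" where
  "flip s X = (if s \<in> X then X - {s} else insert s X)"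

lemma flip_flip: "flip s (flip s X) = X"
  by (auto simp: flip_def)

lemma indicator_lamp_flip:
  assumes "finite X"
  shows "indicator_lamp (flip s X) = indicator_lamp X + Poly_Mapping.single s 1"
proof (cases "s \<in> X")
  case True
  have "indicator_lamp X = Poly_Mapping.single s 1 + indicator_lamp (X - {s})"
    unfolding indicator_lamp_def using assms True by (rule sum.remove)
  then show ?thesis using True by (simp add: flip_def ac_simps single_add_single_bit
        add.assoc[symmetric])
next
  case False
  then show ?thesis using assms by (simp add: flip_def indicator_lamp_def add.commute)
qed

definition character :: "int set \<Rightarrow> int set \<Rightarrow> real" where
  "character Z X = (- 1) ^ card (X \<inter> Z)"

lemma character_flip:
  assumes "finite X"
  shows "character Z (flip s X) = (if s \<in> Z then - 1 else 1) * character Z X"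
proof (cases "s \<in> X")
  case True
  have "X \<inter> Z = insert s ((X - {s}) \<inter> Z)" if "s \<in> Z" using True that by auto
  moreover have "(X - {s}) \<inter> Z = X \<inter> Z" if "s \<notin> Z" using that by auto
  ultimately show ?thesis using assms True by (auto simp: character_def flip_def)
next
  case False
  then show ?thesis using assms by (auto simp: character_def flip_def)
qed

lemma character_square: "character Z X * character Z X = 1"
  by (simp add: character_def power_add[symmetric] flip: mult_2)

text \<open>A partial, unnormalised transform: lamps in \<open>F\<close> are summed against a
  character, all others stay as in \<open>y\<close>.\<close>

definition fourier :: "int set \<Rightarrow> int set \<Rightarrow> ((int \<Rightarrow>\<^sub>0 bit) \<Rightarrow> complex) \<Rightarrow> (int \<Rightarrow>\<^sub>0 bit) \<Rightarrow> complex" where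
  "fourier F Z u y = (\<Sum>X\<in>Pow F. of_real (character Z X) * u (y + indicator_lamp X))"

text \<open>Reindexing by the involution \<open>flip s\<close> absorbs the toggle at the cost of the
  sign of the character at \<open>s\<close>.\<close>

lemma fourier_shift:
  assumes F: "finite F" and s: "s \<in> F"
  shows "fourier F Z (\<lambda>y. u (y + Poly_Mapping.single s 1)) y = (if s \<in> Z then - 1 else 1) * fourier F Z u y"
  unfolding fourier_def sum_distrib_left
proof (rule sum.reindex_bij_witness[of _ "flip s" "flip s"])
  fix X assume X: "X \<in> Pow F"
  then have "finite X" using F finite_subset by auto
  show "(if s \<in> Z then - 1 else 1) * (complex_of_real (character Z (flip s X)) * u (y + indicator_lamp (flip s X)))
      = of_real (character Z X) * u (y + indicator_lamp X + Poly_Mapping.single s 1)"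
    by (simp add: character_flip indicator_lamp_flip \<open>finite X\<close> add.assoc)
  show "flip s X \<in> Pow F" using X s by (auto simp: flip_def)
  then show "flip s X \<in> Pow F" .
qed (simp_all add: flip_flip)

lemma fourier_add: "fourier F Z (\<lambda>y. u y + v y) y = fourier F Z u y + fourier F Z v y"
  and fourier_diff: "fourier F Z (\<lambda>y. u y - v y) y = fourier F Z u y - fourier F Z v y"
  and fourier_mult: "fourier F Z (\<lambda>y. c * u y) y = c * fourier F Z u y"
  by (simp_all add: fourier_def sum.distrib sum_subtractf sum_distrib_left algebra_simps)

text \<open>
  The bond between the sites \<open>i\<close> and \<open>i + 1\<close> is governed by the lamp at position \<open>- i\<close>, since
  \<open>c a\<^sup>i = a\<^sup>i c\<^sub>-\<^sub>i\<close> with \<open>c\<^sub>-\<^sub>i\<close> the conjugate of \<open>c\<close> that toggles this lamp.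
  The block \<open>(m, k, y)\<close> occupies the sites \<open>m, \<dots>, m + k - 1\<close>; its window consists of the positions of
  the \<open>k + 1\<close> bonds that touch it, the two bonds at the ends being the ones that are cut.
\<close>

type_synonym lamp_block = "int \<times> nat \<times> (int \<Rightarrow>\<^sub>0 bit)"

definition window :: "int \<Rightarrow> nat \<Rightarrow> int set" where
  "window m k = {1 - m - int k..1 - m}"

text \<open>The positions where the character is -1. There adding a toggle to the identity gives 0,
  which cuts the bond; at inner positions it gives 2, the off-diagonal entry of a block.\<close>

definition window_ends :: "int \<Rightarrow> nat \<Rightarrow> int set" where
  "window_ends m k = {1 - m - int k, 1 - m}"

text \<open>\<open>y\<close> vanishes on the window so as to be the one representative of its class
  modulo toggles inside the window; no vector is then indexed twice.\<close>

definition lamp_blocks :: "lamp_block set" where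
  "lamp_blocks = {(m, k, y). k \<ge> 1 \<and> (\<forall>s\<in>window m k. Poly_Mapping.lookup y s = 0)}"

lemma zero_block: "k \<ge> 1 \<Longrightarrow> (m, k, 0) \<in> lamp_blocks"
  by (simp add: lamp_blocks_def)

definition block_size :: "lamp_block \<Rightarrow> nat" where
  "block_size = (\<lambda>(m, k, y). k)"

lemma block_size_apply [simp]: "block_size (m, k, y) = k"
  by (simp add: block_size_def)

definition block_vec :: "lamp_block \<Rightarrow> nat \<Rightarrow> lamp ell2" where
  "block_vec = (\<lambda>(m, k, y) j. \<Sum>X\<in>Pow (window m k).
     complex_of_real (character (window_ends m k) X / sqrt (2 ^ (k + 1)))
       *\<^sub>C delta (coset_elt (m + int j) (y + indicator_lamp X)))"

lemma finite_window [simp]: "finite (window m k)"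
  by (simp add: window_def)

lemma card_Pow_window: "card (Pow (window m k)) = 2 ^ (k + 1)"
  by (simp add: card_Pow window_def nat_add_distrib)

lemma cinner_block_vec:
  "cinner u (block_vec (m, k, y) j)
    = of_real (1 / sqrt (2 ^ (k + 1))) *
      fourier (window m k) (window_ends m k) (\<lambda>z. Rep_ell2 u (coset_elt (m + int j) z)) y"
  by (simp add: block_vec_def cinner_sum_right cinner_scaleC_right cinner_delta fourier_def sum_distrib_left)

lemma Rep_block_vec:
  "Rep_ell2 (block_vec (m, k, y) j) (coset_elt i z) =
    (if i = m + int j then of_real (1 / sqrt (2 ^ (k + 1))) *
      fourier (window m k) (window_ends m k) (\<lambda>v. if v = z then 1 else 0) y else 0)"
  unfolding cinner_delta[symmetric] block_vec_def
  by (auto simp: cinner_sum_left cinner_scaleC_left cinner_delta_delta coset_elt_eq_iff fourier_def sum_distrib_left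
      intro!: sum.cong)

lemma add_single_bit_eq_iff:
  "v + Poly_Mapping.single s (1 :: bit) = z \<longleftrightarrow> v = z + Poly_Mapping.single s 1"
proof -
  have "x + Poly_Mapping.single s (1 :: bit) + Poly_Mapping.single s 1 = x" for x
    by (simp only: add.assoc single_add_single_bit add_0_right)
  then show ?thesis by auto
qed

text \<open>A block vector is an eigenfunction of each toggle in its window; the sign is what
  separates blocks in \<open>block_vec_orth\<close>.\<close>

lemma Rep_block_vec_shift:
  assumes s: "s \<in> window m k"
  shows "Rep_ell2 (block_vec (m, k, y) j) (coset_elt i (z + Poly_Mapping.single s 1)) =
    (if s \<in> window_ends m k then - 1 else 1) * Rep_ell2 (block_vec (m, k, y) j) (coset_elt i z)"
  using fourier_shift[OF finite_window s, of "window_ends m k" "\<lambda>v. if v = z then 1 else 0" y]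
  unfolding Rep_block_vec add_single_bit_eq_iff by simp

lemma add_indicator_lamp_eq_iff:
  assumes y: "\<forall>s\<in>F. Poly_Mapping.lookup y s = 0" and z: "\<forall>s\<in>F. Poly_Mapping.lookup z s = 0"
    and F: "finite F" and X: "X \<subseteq> F" "Y \<subseteq> F"
  shows "y + indicator_lamp X = z + indicator_lamp Y \<longleftrightarrow> y = z \<and> X = Y"
proof
  assume eq: "y + indicator_lamp X = z + indicator_lamp Y"
  have fin: "finite X" "finite Y" using F X finite_subset by auto
  have "s \<in> X \<longleftrightarrow> s \<in> Y" for s
  proof (cases "s \<in> F")
    case True
    then show ?thesis
      using arg_cong[OF eq, of "\<lambda>p. Poly_Mapping.lookup p s"] y z fin
      by (auto simp: lookup_add lookup_indicator_lamp split: if_splits)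
  qed (use X in auto)
  then have "X = Y" by blast
  then show "y = z \<and> X = Y" using eq by simp
qed simp

text \<open>When two different blocks share a site, a cut bond of one is an intact bond of the
  other; the witnesses are these cut bonds.\<close>

lemma windows_conflict:
  assumes "(m, k) \<noteq> (m', k')" and "m \<le> i" "i < m + int k" and "m' \<le> i" "i < m' + int k'"
  shows "\<exists>s\<in>window m k \<inter> window m' k'. s \<in> window_ends m k \<longleftrightarrow> s \<notin> window_ends m' k'"
proof -
  consider "m < m'" | "m' < m" | "m = m'" "k < k'" | "m = m'" "k' < k"
    using assms(1) by (metis linorder_neqE_nat linorder_neqE)
  then show ?thesis
  proof cases
    case 1 then show ?thesis using assms by (intro bexI[of _ "1 - m'"]) (auto simp: window_def window_ends_def)
  next
    case 2 then show ?thesis using assms by (intro bexI[of _ "1 - m"]) (auto simp: window_def window_ends_def)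
  next
    case 3 then show ?thesis using assms by (intro bexI[of _ "1 - m - int k"]) (auto simp: window_def window_ends_def)
  next
    case 4 then show ?thesis using assms by (intro bexI[of _ "1 - m - int k'"]) (auto simp: window_def window_ends_def)
  qed
qed

lemma block_vec_orth:
  assumes \<beta>: "\<beta> \<in> lamp_blocks" "j < block_size \<beta>" and \<gamma>: "\<gamma> \<in> lamp_blocks" "i < block_size \<gamma>"
  shows "cinner (block_vec \<beta> j) (block_vec \<gamma> i) = (if \<beta> = \<gamma> \<and> j = i then 1 else 0)"
proof -
  obtain m k y where b: "\<beta> = (m, k, y)" by (cases \<beta>)
  obtain m' k' y' where c: "\<gamma> = (m', k', y')" by (cases \<gamma>)
  have j: "j < k" and i: "i < k'" using \<beta> \<gamma> by (auto simp: b c block_size_def)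
  have y: "\<forall>s\<in>window m k. Poly_Mapping.lookup y s = 0" "\<forall>s\<in>window m' k'. Poly_Mapping.lookup y' s = 0"
    using \<beta> \<gamma> by (auto simp: b c lamp_blocks_def)
  let ?T = "fourier (window m' k') (window_ends m' k')"
  let ?g = "\<lambda>z. Rep_ell2 (block_vec (m, k, y) j) (coset_elt (m' + int i) z)"
  show ?thesis
  proof (cases "m' + int i = m + int j")
    case False
    then have "?g = (\<lambda>z. 0)" by (auto simp: Rep_block_vec)
    then show ?thesis using False by (auto simp: b c cinner_block_vec fourier_def)
  next
    case site: True
    show ?thesis
    proof (cases "(m, k) = (m', k')")
      case False
      then obtain s where s: "s \<in> window m k" "s \<in> window m' k'" "s \<in> window_ends m k \<longleftrightarrow> s \<notin> window_ends m' k'"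
        using windows_conflict[of m k m' k' "m + int j"] site i j by auto
      \<comment> \<open>The toggle at \<open>s\<close> is evaluated once through the transform and
        once through the vector; the signs differ, so the inner product vanishes.\<close>
      have "?T (\<lambda>z. ?g (z + Poly_Mapping.single s 1)) y' = (if s \<in> window_ends m' k' then - 1 else 1) * ?T ?g y'"
        by (rule fourier_shift[OF finite_window s(2)])
      moreover have "?T (\<lambda>z. ?g (z + Poly_Mapping.single s 1)) y' = (if s \<in> window_ends m k then - 1 else 1) * ?T ?g y'"
        unfolding Rep_block_vec_shift[OF s(1)] fourier_mult ..
      ultimately have "?T ?g y' = 0" using s(3) by (auto split: if_splits)
      then show ?thesis using False by (auto simp: b c cinner_block_vec)
    next
      case True
      let ?N = "complex_of_real (1 / sqrt (2 ^ (k + 1)))" and ?P = "Pow (window m k)"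
      let ?ch = "\<lambda>X. complex_of_real (character (window_ends m k) X)"
      have "?T ?g y' = (\<Sum>Y\<in>?P. ?ch Y * (?N * (\<Sum>X\<in>?P. ?ch X * (if y = y' \<and> X = Y then 1 else 0))))"
        using True site y unfolding fourier_def Rep_block_vec
        by (intro sum.cong refl arg_cong2[where f = "(*)"])
          (auto intro!: sum.cong simp: add_indicator_lamp_eq_iff[OF _ _ finite_window] fourier_def)
      also have "\<dots> = (\<Sum>Y\<in>?P. if y = y' then ?N else 0)"
        by (intro sum.cong refl)
          (auto simp: of_real_mult[symmetric] character_square mult.left_commute if_distrib[of "(*) _"]
            simp del: of_real_mult cong: if_cong)
      finally have "?T ?g y' = (if y = y' then of_nat (2 ^ (k + 1)) * ?N else 0)"
        unfolding sum_constant card_Pow_window by simp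
      moreover have "?N * (of_nat (2 ^ (k + 1)) * ?N) = 1"
      proof -
        have "1 / sqrt (2 ^ (k + 1)) * (real (2 ^ (k + 1)) * (1 / sqrt (2 ^ (k + 1)))) = 1"
          by (simp add: field_simps)
        from arg_cong[OF this, of complex_of_real] show ?thesis
          by (simp only: of_real_mult of_real_of_nat_eq of_real_1)
      qed
      ultimately show ?thesis using True site by (auto simp: b c cinner_block_vec)
    qed
  qed
qed

text \<open>The factor \<open>k\<close> counts the places a given site can take in a block of size
  \<open>k\<close>.\<close>

lemma sum_block_weights: "(\<Sum>k=1..n. real k / 2 ^ (k + 1)) = 1 - (real n + 2) / 2 ^ (n + 1)"
  by (induction n) (simp_all add: field_simps)

text \<open>
  The blocks of size at most \<open>n\<close> that contain the site \<open>i\<close> carry the fraction \<open>1 - (n + 2) / 2\<^sup>n\<^sup>+\<^sup>1\<close>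
  of the squared norm of \<open>delta (coset_elt i y)\<close>, which tends to \<open>1\<close>.
\<close>

lemma block_vec_total:
  assumes u: "\<And>\<beta> j. \<beta> \<in> lamp_blocks \<Longrightarrow> j < block_size \<beta> \<Longrightarrow> cinner u (block_vec \<beta> j) = 0"
  shows "u = 0"
proof (rule ell2_eqI)
  fix g
  obtain i y0 where g: "g = coset_elt i y0" using coset_elt_surj by blast
  let ?d = "delta g"
  define X where "X = {(\<beta>, j). \<beta> \<in> lamp_blocks \<and> j < block_size \<beta>}"
  interpret orthonormal_family X "\<lambda>(\<beta>, j). block_vec \<beta> j"
  proof
    show "cinner (case x of (\<beta>, j) \<Rightarrow> block_vec \<beta> j) (case y of (\<beta>, j) \<Rightarrow> block_vec \<beta> j)
        = (if x = y then 1 else 0)" if "x \<in> X" "y \<in> X" for x y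
      using that by (cases x, cases y) (simp add: X_def block_vec_orth)
  qed
  \<comment> \<open>The lit lamps of \<open>y0\<close> inside the window; adding them again switches
    them off, so \<open>off\<close> is the representative demanded by
    \<open>lamp_blocks\<close>.\<close>
  define supp where "supp m k = {s \<in> window m k. Poly_Mapping.lookup y0 s = 1}" for m k
  define off where "off m k = y0 + indicator_lamp (supp m k)" for m k
  \<comment> \<open>The block of size \<open>k\<close> in which site \<open>i\<close> has number
    \<open>j\<close>, paired with that number.\<close>
  define idx where "idx = (\<lambda>(k, j). ((i - int j, k, off (i - int j) k), j :: nat))"
  define K where "K n = Sigma {1..n :: nat} (\<lambda>k. {..<k})" for n
  have supp: "supp m k \<subseteq> window m k" for m k by (auto simp: supp_def)
  then have fin: "finite (supp m k)" for m k by (rule finite_subset) simp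
  have off_block: "(m, k, off m k) \<in> lamp_blocks" if "k \<ge> 1" for m k
    using that by (auto simp: lamp_blocks_def off_def lookup_add lookup_indicator_lamp fin supp_def)
  have "indicator_lamp S + indicator_lamp S = 0" if "finite S" for S
    by (rule poly_mapping_eqI) (simp only: lookup_add lookup_indicator_lamp[OF that], simp)
  then have y0: "y0 = off m k + indicator_lamp (supp m k)" for m k
    using fin by (simp add: off_def add.assoc)
  have inX: "idx ` K n \<subseteq> X" for n
    by (auto simp: idx_def K_def X_def block_size_def off_block)
  have coeff: "(cmod (cinner ?d (block_vec (fst (idx p)) (snd (idx p)))))\<^sup>2 = 1 / 2 ^ (fst p + 1)"
    if "p \<in> K n" for p n
  proof -
    obtain k j where p: "p = (k, j)" by (cases p)
    let ?m = "i - int j"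
    have k: "k \<ge> 1" using that by (auto simp: K_def p)
    have "fourier (window ?m k) (window_ends ?m k) (\<lambda>v. if v = y0 then 1 else 0) (off ?m k)
        = (\<Sum>X\<in>Pow (window ?m k). if X = supp ?m k then of_real (character (window_ends ?m k) X) else 0)"
      unfolding fourier_def
    proof (rule sum.cong[OF refl])
      fix X assume "X \<in> Pow (window ?m k)"
      then have "off ?m k + indicator_lamp X = y0 \<longleftrightarrow> X = supp ?m k"
        unfolding y0[of ?m k] using off_block[OF k, of ?m] supp[of ?m k]
        by (subst add_indicator_lamp_eq_iff[of "window ?m k"]) (auto simp: lamp_blocks_def)
      then show "of_real (character (window_ends ?m k) X) * (if off ?m k + indicator_lamp X = y0 then 1 else 0)
          = (if X = supp ?m k then of_real (character (window_ends ?m k) X) else (0 :: complex))"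
        by simp
    qed
    also have "\<dots> = of_real (character (window_ends ?m k) (supp ?m k))"
      using supp[of ?m k] by simp
    finally have "cinner (block_vec (?m, k, off ?m k) j) ?d
        = of_real (1 / sqrt (2 ^ (k + 1))) * of_real (character (window_ends ?m k) (supp ?m k))"
      unfolding cinner_delta g Rep_block_vec by simp
    then have "cmod (cinner ?d (block_vec (?m, k, off ?m k) j)) = 1 / sqrt (2 ^ (k + 1))"
      by (subst cinner_commute) (simp add: norm_mult norm_divide character_def norm_power)
    then show ?thesis by (simp add: p idx_def power_divide)
  qed
  have norm_rest: "(norm (?d - (\<Sum>p\<in>idx ` K n. cinner ?d (case p of (\<beta>, j) \<Rightarrow> block_vec \<beta> j)
      *\<^sub>C (case p of (\<beta>, j) \<Rightarrow> block_vec \<beta> j))))\<^sup>2 = (real n + 2) / 2 ^ (n + 1)" for n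
  proof -
    have d: "(norm ?d)\<^sup>2 = 1" using cinner_self[of ?d] by (simp add: cinner_delta_delta del: of_real_power)
    have s1: "(\<Sum>p\<in>idx ` K n. (cmod (cinner ?d (case p of (\<beta>, j) \<Rightarrow> block_vec \<beta> j)))\<^sup>2)
        = (\<Sum>p\<in>K n. 1 / 2 ^ (fst p + 1))"
    proof -
      have "inj_on idx (K n)" by (auto simp: inj_on_def idx_def)
      then have "(\<Sum>p\<in>idx ` K n. (cmod (cinner ?d (case p of (\<beta>, j) \<Rightarrow> block_vec \<beta> j)))\<^sup>2)
          = (\<Sum>p\<in>K n. (cmod (cinner ?d (block_vec (fst (idx p)) (snd (idx p)))))\<^sup>2)"
        unfolding split_beta by (simp only: sum.reindex o_def)
      then show ?thesis using coeff by (simp cong: sum.cong)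
    qed
    have s2: "(\<Sum>p\<in>K n. 1 / 2 ^ (fst p + 1)) = (\<Sum>k=1..n. real k / 2 ^ (k + 1))"
    proof -
      have "(\<Sum>p\<in>K n. 1 / 2 ^ (fst p + 1)) = (\<Sum>(k, j)\<in>Sigma {1..n} (\<lambda>k. {..<k}). 1 / 2 ^ (k + 1) :: real)"
        by (simp add: K_def split_beta)
      also have "\<dots> = (\<Sum>k=1..n. \<Sum>j<k. 1 / 2 ^ (k + 1))"
        by (rule sum.Sigma[symmetric]) auto
      finally show ?thesis by simp
    qed
    have fin: "finite (idx ` K n)" by (simp add: K_def)
    show ?thesis
      unfolding norm_diff_projection[OF fin inX] d s1 s2 sum_block_weights by simp
  qed
  have "(cmod (Rep_ell2 u g))\<^sup>2 \<le> (norm u)\<^sup>2 * ((real n + 2) / 2 ^ (n + 1))" for n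
  proof -
    let ?s = "\<Sum>p\<in>idx ` K n. cinner ?d (case p of (\<beta>, j) \<Rightarrow> block_vec \<beta> j) *\<^sub>C (case p of (\<beta>, j) \<Rightarrow> block_vec \<beta> j)"
    \<comment> \<open>As \<open>u\<close> is orthogonal to every block vector, only the remainder
      \<open>?d - ?s\<close>, of small norm, contributes to the value of \<open>u\<close> at
      \<open>g\<close>.\<close>
    have "cinner u ?s = 0"
      unfolding cinner_sum_right cinner_scaleC_right
      by (rule sum.neutral) (use inX[of n] in \<open>auto simp: X_def u\<close>)
    then have "cinner u (?d - ?s) = Rep_ell2 u g"
      by (simp add: cinner_diff_right cinner_delta)
    then have "cmod (Rep_ell2 u g) \<le> norm u * norm (?d - ?s)"
      using cmod_cinner_le[of u "?d - ?s"] by (simp only:)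
    then have "(cmod (Rep_ell2 u g))\<^sup>2 \<le> (norm u * norm (?d - ?s))\<^sup>2" by (intro power_mono) auto
    then show ?thesis unfolding power_mult_distrib norm_rest .
  qed
  moreover have "(\<lambda>n. (norm u)\<^sup>2 * ((real n + 2) / 2 ^ (n + 1))) \<longlonglongrightarrow> (norm u)\<^sup>2 * 0"
    by (intro tendsto_mult_left) real_asymp
  ultimately have "(cmod (Rep_ell2 u g))\<^sup>2 \<le> 0"
    by (intro LIMSEQ_le_const[of _ "(norm u)\<^sup>2 * 0", simplified]) auto
  then show "Rep_ell2 u g = Rep_ell2 0 g" by (simp add: zero_ell2.rep_eq)
qed

text \<open>Each neighbouring site enters once plainly and once with a toggle of the bond lamp:
  equal signs give the entry 2, opposite signs cancel at a cut bond. The toggle in the \<mu>-term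
  gives -\<mu>, but \<mu> at the last site, whose lamp \<open>- i\<close> is a window end.\<close>

lemma M_op_block_vec:
  fixes \<mu> :: real
  assumes \<beta>: "\<beta> \<in> lamp_blocks" "j < block_size \<beta>"
  shows "cinner (M_op \<mu> u) (block_vec \<beta> j) =
      2 * (if j = 0 then 0 else cinner u (block_vec \<beta> (j - 1)))
      + of_real (if Suc j = block_size \<beta> then \<mu> else - \<mu>) * cinner u (block_vec \<beta> j)
      + 2 * (if Suc j = block_size \<beta> then 0 else cinner u (block_vec \<beta> (Suc j)))"
proof -
  obtain m k y where b: "\<beta> = (m, k, y)" by (cases \<beta>)
  have j: "j < k" using \<beta> by (simp add: b block_size_def)
  let ?i = "m + int j"
  let ?F = "window m k" and ?Z = "window_ends m k"
  let ?T = "\<lambda>i. fourier ?F ?Z (\<lambda>z. Rep_ell2 u (coset_elt i z)) y"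
  have pos: "- ?i \<in> ?F" "1 - ?i \<in> ?F" "- ?i \<in> ?Z \<longleftrightarrow> Suc j = k" "1 - ?i \<in> ?Z \<longleftrightarrow> j = 0"
    using j by (auto simp: window_def window_ends_def)
  have "fourier ?F ?Z (\<lambda>z. Rep_ell2 (M_op \<mu> u) (coset_elt ?i z)) y
      = ?T (?i - 1) + ?T (?i + 1) + (if j = 0 then - 1 else 1) * ?T (?i - 1)
        + (if Suc j = k then - 1 else 1) * ?T (?i + 1) - of_real \<mu> * ((if Suc j = k then - 1 else 1) * ?T ?i)"
    unfolding M_op_apply fourier_add fourier_diff fourier_mult
      fourier_shift[OF finite_window pos(1), of _ "\<lambda>z. Rep_ell2 u (coset_elt _ z)"]
      fourier_shift[OF finite_window pos(2), of _ "\<lambda>z. Rep_ell2 u (coset_elt _ z)"] pos(3,4) ..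
  also have "\<dots> = 2 * (if j = 0 then 0 else ?T (?i - 1)) + of_real (if Suc j = k then \<mu> else - \<mu>) * ?T ?i
      + 2 * (if Suc j = k then 0 else ?T (?i + 1))"
    by simp
  finally show ?thesis
    unfolding b cinner_block_vec block_size_def prod.case
    by (cases j) (auto simp: algebra_simps)
qed

global_interpretation M: block_operator lamp_blocks block_size block_vec "M_op \<mu>" \<mu> for \<mu> :: real
proof
  show "block_size \<beta> \<ge> 1" if "\<beta> \<in> lamp_blocks" for \<beta>
    using that by (auto simp: lamp_blocks_def block_size_def)
qed (use block_vec_orth block_vec_total M_op_block_vec in blast)+

lemma eigenvalues_M_op: "eigenvalues (M_op \<mu>) = complex_of_real ` (\<Union>k\<in>{1..}. jacobi_roots \<mu> k)"
proof -
  have "block_size ` lamp_blocks = {1..}"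
  proof safe
    fix k :: nat assume "k \<ge> 1"
    then have "(0, k, 0) \<in> lamp_blocks" by (rule zero_block)
    then show "k \<in> block_size ` lamp_blocks" by (rule rev_image_eqI) (simp add: block_size_def)
  qed (auto simp: lamp_blocks_def block_size_def)
  moreover have "(\<Union>\<beta>\<in>lamp_blocks. jacobi_roots \<mu> (block_size \<beta>))
      = (\<Union>k\<in>block_size ` lamp_blocks. jacobi_roots \<mu> k)" by simp
  ultimately show ?thesis unfolding M.eigenvalues_block by simp
qed

section \<open>The spectral measure at the unit of the group\<close>

lemma one_lamplighter: "\<one>\<^bsub>lamplighter\<^esub> = coset_elt 0 0"
  by (simp add: lamplighter_def coset_elt_def translate_simps)

text \<open>The unit is site 0 with all lamps off, so it meets the block vectors with
  \<open>y = 0\<close> at site 0, and there only through the empty set of toggles, where the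
  character is 1.\<close>

lemma cinner_one_block_vec:
  assumes "(m, k, y) \<in> lamp_blocks"
  shows "cinner (delta \<one>\<^bsub>lamplighter\<^esub>) (block_vec (m, k, y) j)
    = (if m = - int j \<and> y = 0 then complex_of_real (1 / sqrt (2 ^ (k + 1))) else 0)"
proof -
  let ?F = "window m k" and ?c = "m = - int j \<and> y = 0"
  have "fourier ?F (window_ends m k)
      (\<lambda>z. Rep_ell2 (delta (coset_elt 0 0)) (coset_elt (m + int j) z)) y
    = (\<Sum>X\<in>Pow ?F. if X = {} then (if ?c then 1 else 0) else 0)"
    unfolding fourier_def
  proof (rule sum.cong[OF refl])
    fix X assume "X \<in> Pow ?F"
    then have "y + indicator_lamp X = 0 + indicator_lamp {} \<longleftrightarrow> y = 0 \<and> X = {}"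
      using assms by (intro add_indicator_lamp_eq_iff[of ?F]) (auto simp: lamp_blocks_def)
    then have "coset_elt (m + int j) (y + indicator_lamp X) = coset_elt 0 0 \<longleftrightarrow> ?c \<and> X = {}"
      by (auto simp: coset_elt_eq_iff indicator_lamp_def)
    then show "of_real (character (window_ends m k) X) *
        Rep_ell2 (delta (coset_elt 0 0)) (coset_elt (m + int j) (y + indicator_lamp X))
      = (if X = {} then (if ?c then 1 else 0) else 0)"
      by (auto simp: delta.rep_eq character_def)
  qed
  then show ?thesis unfolding one_lamplighter cinner_block_vec by simp
qed

theorem emeasure_spectral_measure_M_op:
  assumes B: "B \<in> sets borel"
  shows "emeasure (spectral_measure (M_op \<mu>) (delta \<one>\<^bsub>lamplighter\<^esub>)) B
      = ennreal (\<Sum>\<^sub>\<infinity>k\<in>{1..}. (\<Sum>r\<in>jacobi_roots \<mu> k. indicator B r) / 2 ^ (k + 1))"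
    and "(\<lambda>k. (\<Sum>r\<in>jacobi_roots \<mu> k. indicator B r) / 2 ^ (k + 1) :: real) summable_on {1..}"
proof -
  let ?d = "delta \<one>\<^bsub>lamplighter\<^esub>"
  let ?X = "M.eigen_index \<mu>"
  let ?g = "\<lambda>x. (cmod (cinner ?d (M.eigen_vec \<mu> x)))\<^sup>2 * indicator B (snd x) :: real"
  \<comment> \<open>\<open>S\<close> labels the eigenvectors that can meet the unit by block size
    \<open>k\<close>, place \<open>j\<close> of site 0 in the block, and eigenvalue
    \<open>r\<close>; \<open>h\<close> turns a label into an eigenvector index.\<close>
  define S where "S = Sigma {1 :: nat..} (\<lambda>k. {..<k} \<times> jacobi_roots \<mu> k)"
  define h where "h = (\<lambda>(k :: nat, j :: nat, r :: real). ((- int j, k, 0 :: int \<Rightarrow>\<^sub>0 bit), r))"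
  define f where "f = (\<lambda>(k, j, r). (jacobi_vec \<mu> k r j)\<^sup>2 * indicator B r / 2 ^ (k + 1) :: real)"
  have coeff: "cinner ?d (M.eigen_vec \<mu> ((m, k, y), r))
      = (\<Sum>j<k. if m = - int j \<and> y = 0 then complex_of_real (jacobi_vec \<mu> k r j / sqrt (2 ^ (k + 1))) else 0)"
    if "(m, k, y) \<in> lamp_blocks" for m k y r
    unfolding M.cinner_eigen_vec block_size_apply cinner_one_block_vec[OF that]
    by (intro sum.cong refl) auto
  have hS: "h ` S \<subseteq> ?X"
    by (auto simp: h_def S_def M.eigen_index_def zero_block)
  have inj: "inj_on h S" by (auto simp: inj_on_def h_def)
  have gh: "?g (h p) = f p" if "p \<in> S" for p
  proof -
    obtain k j r where p: "p = (k, j, r)" by (cases p)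
    have k: "k \<ge> 1" "j < k" using that by (auto simp: S_def p)
    then have "cinner ?d (M.eigen_vec \<mu> ((- int j, k, 0), r)) = complex_of_real (jacobi_vec \<mu> k r j / sqrt (2 ^ (k + 1)))"
      by (subst coeff) (auto simp: zero_block)
    then show ?thesis
      by (simp add: p h_def f_def norm_divide power_divide)
  qed
  have zero: "?g x = 0" if "x \<in> ?X - h ` S" for x
  proof -
    obtain m k y r where x: "x = ((m, k, y), r)" by (metis prod.exhaust)
    have X: "(m, k, y) \<in> lamp_blocks" "r \<in> jacobi_roots \<mu> k"
      using that by (auto simp: x M.eigen_index_def)
    have "\<not> (m = - int j \<and> y = 0)" if "j < k" for j
    proof
      assume "m = - int j \<and> y = 0"
      then have "x = h (k, j, r)" "(k, j, r) \<in> S"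
        using X \<open>j < k\<close> by (auto simp: x h_def S_def)
      then show False using \<open>x \<in> ?X - h ` S\<close> by blast
    qed
    then have "cinner ?d (M.eigen_vec \<mu> x) = 0"
      unfolding x coeff[OF X(1)] by (intro sum.neutral) auto
    then show ?thesis by simp
  qed
  \<comment> \<open>Bessel's inequality makes the whole family summable, which justifies the later
    regrouping by block size.\<close>
  have "?g summable_on ?X"
    by (rule summable_on_comparison_test[OF M.summable_bessel[of ?X \<mu> ?d]]) (auto simp: indicator_def)
  then have "?g summable_on h ` S" by (rule summable_on_subset_banach[OF _ hS])
  then have "(?g \<circ> h) summable_on S" using inj by (simp add: summable_on_reindex)
  then have sumf: "f summable_on S"
    by (rule summable_on_cong[THEN iffD1, rotated]) (simp add: gh)
  have inner: "infsum (\<lambda>q. f (k, q)) ({..<k} \<times> jacobi_roots \<mu> k) = (\<Sum>r\<in>jacobi_roots \<mu> k. indicator B r) / 2 ^ (k + 1)"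
    if "k \<in> {1..}" for k
  proof -
    have k: "k \<ge> 1" using that by simp
    have "infsum (\<lambda>q. f (k, q)) ({..<k} \<times> jacobi_roots \<mu> k) = (\<Sum>q\<in>{..<k} \<times> jacobi_roots \<mu> k. f (k, q))"
      by (intro infsum_finite finite_cartesian_product finite_jacobi_roots[OF k]) simp
    also have "\<dots> = (\<Sum>j<k. \<Sum>r\<in>jacobi_roots \<mu> k. f (k, j, r))"
      by (simp add: sum.cartesian_product split_beta)
    also have "\<dots> = (\<Sum>j<k. jacobi_measure \<mu> k j B) / 2 ^ (k + 1)"
      by (simp only: f_def prod.case jacobi_measure_def sum_divide_distrib)
    finally show ?thesis unfolding sum_jacobi_measure[OF k] .
  qed
  have "infsum ?g ?X = infsum ?g (h ` S)"
    by (rule infsum_cong_neutral) (use hS zero in auto)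
  also have "\<dots> = infsum f S"
    by (subst infsum_reindex[OF inj], rule infsum_cong) (simp add: gh)
  also have "\<dots> = (\<Sum>\<^sub>\<infinity>k\<in>{1..}. infsum (\<lambda>q. f (k, q)) ({..<k} \<times> jacobi_roots \<mu> k))"
    unfolding S_def by (rule infsum_Sigma_banach[symmetric]) (use sumf in \<open>simp add: S_def\<close>)
  also have "\<dots> = (\<Sum>\<^sub>\<infinity>k\<in>{1..}. (\<Sum>r\<in>jacobi_roots \<mu> k. indicator B r) / 2 ^ (k + 1))"
    by (rule infsum_cong) (rule inner)
  finally show "emeasure (spectral_measure (M_op \<mu>) ?d) B
      = ennreal (\<Sum>\<^sub>\<infinity>k\<in>{1..}. (\<Sum>r\<in>jacobi_roots \<mu> k. indicator B r) / 2 ^ (k + 1))"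
    unfolding M.emeasure_spectral_measure[OF B] by simp
  have "(\<lambda>k. infsum (\<lambda>q. f (k, q)) ({..<k} \<times> jacobi_roots \<mu> k)) summable_on {1..}"
    by (rule summable_on_Sigma_banach) (use sumf in \<open>simp add: S_def split_beta\<close>)
  then show "(\<lambda>k. (\<Sum>r\<in>jacobi_roots \<mu> k. indicator B r) / 2 ^ (k + 1) :: real) summable_on {1..}"
    by (rule summable_on_cong[THEN iffD1, rotated]) (rule inner)
qed

subsection \<open>The random operators\<close>

abbreviation coin :: "nat measure" where
  "coin \<equiv> uniform_count_measure {0, 1}"

lemma prob_space_coin: "prob_space coin"
  by (rule prob_space_uniform_count_measure) auto

lemma prob_space_bernoulli: "prob_space bernoulli_measure"
  unfolding bernoulli_measure_def by (rule prob_space_PiM) (rule prob_space_coin)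

lemma emeasure_coin: "t \<in> {0, 1} \<Longrightarrow> emeasure coin {t} = ennreal (1 / 2)"
  by (subst emeasure_uniform_count_measure) auto

lemma cylinder:
  fixes x :: "int \<Rightarrow> nat"
  assumes J: "finite J" and x: "\<And>i. i \<in> J \<Longrightarrow> x i \<in> {0, 1}"
  shows cylinder_sets: "{\<omega> \<in> space bernoulli_measure. \<forall>i\<in>J. \<omega> i = x i} \<in> sets bernoulli_measure"
    and emeasure_cylinder: "emeasure bernoulli_measure {\<omega> \<in> space bernoulli_measure. \<forall>i\<in>J. \<omega> i = x i}
      = ennreal ((1 / 2) ^ card J)"
proof -
  have eq: "{\<omega> \<in> space bernoulli_measure. \<forall>i\<in>J. \<omega> i = x i} = prod_emb UNIV (\<lambda>_. coin) J (\<Pi>\<^sub>E i\<in>J. {x i})"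
    by (auto simp: prod_emb_def bernoulli_measure_def space_PiM PiE_iff)
  have meas: "{x i} \<in> sets coin" if "i \<in> J" for i
    using x[OF that] by (simp add: sets_uniform_count_measure)
  show "{\<omega> \<in> space bernoulli_measure. \<forall>i\<in>J. \<omega> i = x i} \<in> sets bernoulli_measure"
    unfolding eq unfolding bernoulli_measure_def using J meas by (intro sets_PiM_I) auto
  have "emeasure bernoulli_measure {\<omega> \<in> space bernoulli_measure. \<forall>i\<in>J. \<omega> i = x i} = (\<Prod>i\<in>J. emeasure coin {x i})"
    unfolding eq unfolding bernoulli_measure_def using J meas prob_space_coin by (intro emeasure_PiM_emb) auto
  also have "\<dots> = (\<Prod>i\<in>J. ennreal (1 / 2))"
    using x by (intro prod.cong refl emeasure_coin)
  also have "\<dots> = ennreal (\<Prod>i\<in>J. 1 / 2)"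
    by (rule prod_ennreal) simp
  also have "\<dots> = ennreal ((1 / 2) ^ card J)"
    by (simp only: prod_constant)
  finally show "emeasure bernoulli_measure {\<omega> \<in> space bernoulli_measure. \<forall>i\<in>J. \<omega> i = x i} = ennreal ((1 / 2) ^ card J)" .
qed

lemma indep_coordinates:
  "prob_space.indep_vars bernoulli_measure (\<lambda>_. coin) (\<lambda>i \<omega>. \<omega> i) (UNIV :: int set)"
proof -
  interpret prob_space bernoulli_measure by (rule prob_space_bernoulli)
  have rv: "random_variable coin (\<lambda>\<omega>. \<omega> i)" for i :: int
    unfolding bernoulli_measure_def by (rule measurable_component_singleton) simp
  have "distr bernoulli_measure coin (\<lambda>\<omega>. \<omega> i) = coin" for i :: int
    unfolding bernoulli_measure_def by (rule distr_PiM_component[OF prob_space_coin UNIV_I])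
  moreover have "distr bernoulli_measure (\<Pi>\<^sub>M i\<in>UNIV. coin) (\<lambda>x. \<lambda>i\<in>UNIV. x i) = bernoulli_measure"
    unfolding restrict_UNIV bernoulli_measure_def by (rule distr_id2) simp
  ultimately show ?thesis
    by (subst indep_vars_iff_distr_eq_PiM[OF _ rv]) (simp_all add: bernoulli_measure_def)
qed

text \<open>The argument of the second Borel-Cantelli lemma: on disjoint windows of equal size
  \<open>L\<close> failures are independent, so \<open>N + 1\<close> windows all fail with
  probability (1 - 1/2^L)^(N+1).\<close>

lemma AE_pattern:
  fixes K :: "nat \<Rightarrow> int set" and x :: "nat \<Rightarrow> int \<Rightarrow> nat"
  assumes disj: "disjoint_family K" and K: "\<And>n. finite (K n)" "\<And>n. card (K n) = L"
    and x: "\<And>n i. x n i \<in> {0, 1}"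
  shows "AE \<omega> in bernoulli_measure. \<exists>n. \<forall>i\<in>K n. \<omega> i = x n i"
proof -
  interpret prob_space bernoulli_measure by (rule prob_space_bernoulli)
  let ?C = "\<lambda>n. {\<omega> \<in> space bernoulli_measure. \<forall>i\<in>K n. \<omega> i = x n i}"
  let ?D = "\<lambda>n. {\<omega> \<in> space bernoulli_measure. \<not> (\<forall>i\<in>K n. \<omega> i = x n i)}"
  have "indep_vars (\<lambda>n. PiM (K n) (\<lambda>_. coin)) (\<lambda>n \<omega>. restrict (\<lambda>i. \<omega> i) (K n)) UNIV"
    by (rule indep_vars_restrict[OF indep_coordinates]) (use disj in auto)
  then have "indep_events (\<lambda>n. {\<omega> \<in> space bernoulli_measure. \<not> (\<forall>i\<in>K n. restrict (\<lambda>i. \<omega> i) (K n) i = x n i)}) UNIV"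
  proof (rule indep_eventsI_indep_vars)
    fix n
    let ?S = "space (PiM (K n) (\<lambda>_. coin))"
    have "f \<in> (\<Pi>\<^sub>E i\<in>K n. {x n i}) \<longleftrightarrow> (\<forall>i\<in>K n. f i = x n i)" if "f \<in> ?S" for f
      using that by (simp add: space_PiM PiE_iff)
    then have "{f \<in> ?S. \<not> (\<forall>i\<in>K n. f i = x n i)} = ?S - (\<Pi>\<^sub>E i\<in>K n. {x n i})"
      by blast
    moreover have "(\<Pi>\<^sub>E i\<in>K n. {x n i}) \<in> sets (PiM (K n) (\<lambda>_. coin))"
      using K(1) x by (intro sets_PiM_I_finite) (auto simp: sets_uniform_count_measure)
    ultimately show "{f \<in> ?S. \<not> (\<forall>i\<in>K n. f i = x n i)} \<in> sets (PiM (K n) (\<lambda>_. coin))"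
      by auto
  qed
  then have indep: "indep_events ?D UNIV" by (simp cong: ball_cong)
  have Cs: "?C n \<in> events" and Cp: "prob (?C n) = (1 / 2) ^ L" for n
    using cylinder_sets[OF K(1) x, of n "\<lambda>_. n"] emeasure_cylinder[OF K(1) x, of n "\<lambda>_. n"] K(2)[of n]
    by (simp_all add: measure_def)
  have Dc: "?D n = space bernoulli_measure - ?C n" for n by auto
  have Ds: "?D n \<in> events" and Dp: "prob (?D n) = 1 - (1 / 2) ^ L" for n
    unfolding Dc using Cs[of n] Cp[of n] by (simp_all only: prob_compl sets.compl_sets)
  have fin: "prob (\<Inter>n\<in>{..N}. ?D n) = (1 - (1 / 2) ^ L) ^ Suc N" for N
  proof -
    have "\<forall>J\<subseteq>UNIV. J \<noteq> {} \<longrightarrow> finite J \<longrightarrow> prob (\<Inter>n\<in>J. ?D n) = (\<Prod>n\<in>J. prob (?D n))"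
      using indep unfolding indep_events_def by (rule conjunct2)
    then have "prob (\<Inter>n\<in>{..N}. ?D n) = (\<Prod>n\<in>{..N}. prob (?D n))"
      by (elim allE[of _ "{..N}"]) simp_all
    then show ?thesis unfolding Dp by (simp only: prod_constant card_atMost)
  qed
  have inter: "(\<Inter>n. ?D n) \<in> events" using Ds by blast
  have "prob (\<Inter>n. ?D n) \<le> (1 - (1 / 2) ^ L) ^ Suc N" for N
    unfolding fin[symmetric] using Ds by (intro finite_measure_mono) auto
  moreover have "(\<lambda>N. (1 - (1 / 2) ^ L :: real) ^ Suc N) \<longlonglongrightarrow> 0"
    by (intro LIMSEQ_Suc LIMSEQ_realpow_zero) (auto simp: power_le_one)
  ultimately have "prob (\<Inter>n. ?D n) \<le> 0"
    by (intro LIMSEQ_le_const) auto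
  then have "emeasure bernoulli_measure (\<Inter>n. ?D n) = 0"
    by (simp add: emeasure_eq_measure measure_le_0_iff)
  then show ?thesis
    by (intro AE_I[OF _ _ inter]) auto
qed

text \<open>Bond \<open>n\<close> joins the sites \<open>n\<close> and \<open>n + 1\<close>. Sites
  \<open>m\<close> to \<open>m + k - 1\<close> lie between the cut bonds \<open>m - 1\<close> and
  \<open>m + k - 1\<close>; for \<open>k = 1\<close> no bond is intact.\<close>

definition chain_blocks :: "(int \<Rightarrow> nat) \<Rightarrow> (int \<times> nat) set" where
  "chain_blocks \<omega> = {(m, k). k \<ge> 1 \<and> \<omega> (m - 1) = 1 \<and> \<omega> (m + int k - 1) = 1
     \<and> (\<forall>i\<in>{m..m + int k - 2}. \<omega> i = 0)}"

text \<open>Cut bonds arbitrarily far on both sides make the finite blocks cover the chain; the last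
  condition makes the spectrum independent of \<open>\<omega>\<close>.\<close>

definition typical :: "(int \<Rightarrow> nat) \<Rightarrow> bool" where
  "typical \<omega> \<longleftrightarrow> (\<forall>n. \<omega> n \<in> {0, 1}) \<and> (\<forall>n. \<exists>i\<ge>n. \<omega> i = 1) \<and> (\<forall>n. \<exists>i<n. \<omega> i = 1)
     \<and> (\<forall>k\<ge>1. \<exists>m. (m, k) \<in> chain_blocks \<omega>)"

lemma AE_typical: "AE \<omega> in bernoulli_measure. typical \<omega>"
proof -
  have right: "AE \<omega> in bernoulli_measure. \<exists>i\<ge>n. \<omega> i = 1" for n :: int
  proof -
    have "AE \<omega> in bernoulli_measure. \<exists>t. \<forall>i\<in>{n + int t}. \<omega> i = (\<lambda>_ _. 1) t i"
      by (rule AE_pattern[where L = 1]) (auto simp: disjoint_family_on_def)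
    then show ?thesis
    proof eventually_elim
      fix \<omega> :: "int \<Rightarrow> nat" assume "\<exists>t. \<forall>i\<in>{n + int t}. \<omega> i = (\<lambda>_ _. 1) t i"
      then obtain t where "\<omega> (n + int t) = 1" by auto
      then show "\<exists>i\<ge>n. \<omega> i = 1" by (intro exI[of _ "n + int t"]) auto
    qed
  qed
  have left: "AE \<omega> in bernoulli_measure. \<exists>i<n. \<omega> i = 1" for n :: int
  proof -
    have "AE \<omega> in bernoulli_measure. \<exists>t. \<forall>i\<in>{n - 1 - int t}. \<omega> i = (\<lambda>_ _. 1) t i"
      by (rule AE_pattern[where L = 1]) (auto simp: disjoint_family_on_def)
    then show ?thesis
    proof eventually_elim
      fix \<omega> :: "int \<Rightarrow> nat" assume "\<exists>t. \<forall>i\<in>{n - 1 - int t}. \<omega> i = (\<lambda>_ _. 1) t i"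
      then obtain t where "\<omega> (n - 1 - int t) = 1" by auto
      then show "\<exists>i<n. \<omega> i = 1" by (intro exI[of _ "n - 1 - int t"]) auto
    qed
  qed
  have block: "AE \<omega> in bernoulli_measure. k \<ge> 1 \<longrightarrow> (\<exists>m. (m, k) \<in> chain_blocks \<omega>)" for k :: nat
  proof (cases "k \<ge> 1")
    case True
    \<comment> \<open>Adjacent windows of \<open>k + 1\<close> bonds, each tested for the pattern 1,
      0, ..., 0, 1 that isolates a block of size \<open>k\<close>.\<close>
    let ?K = "\<lambda>t. {int t * (int k + 1)..int t * (int k + 1) + int k}"
    let ?x = "\<lambda>t i. if i = int t * (int k + 1) \<or> i = int t * (int k + 1) + int k then 1 else 0"
    have "AE \<omega> in bernoulli_measure. \<exists>t. \<forall>i\<in>?K t. \<omega> i = ?x t i"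
    proof (rule AE_pattern[where L = "k + 1"])
      have "?K s \<inter> ?K t = {}" if "s < t" for s t
      proof -
        have "int (Suc s) * (int k + 1) \<le> int t * (int k + 1)"
          using that by (intro mult_right_mono) auto
        then show ?thesis by (auto simp: algebra_simps)
      qed
      then show "disjoint_family ?K"
        unfolding disjoint_family_on_def by (metis Int_commute linorder_neqE_nat)
    qed (auto simp: nat_add_distrib)
    then show ?thesis
    proof eventually_elim
      fix \<omega> :: "int \<Rightarrow> nat" assume "\<exists>t. \<forall>i\<in>?K t. \<omega> i = ?x t i"
      then obtain t where "\<forall>i\<in>?K t. \<omega> i = ?x t i" by (elim exE)
      then have t: "\<And>i. i \<in> ?K t \<Longrightarrow> \<omega> i = ?x t i" by (rule bspec)
      define s where "s = int t * (int k + 1)"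
      \<comment> \<open>Bond \<open>s\<close> is the left cut, so the first site of the block is
        \<open>s + 1\<close>.\<close>
      have "(s + 1, k) \<in> chain_blocks \<omega>"
        using True t[folded s_def] by (auto simp: chain_blocks_def)
      then show "k \<ge> 1 \<longrightarrow> (\<exists>m. (m, k) \<in> chain_blocks \<omega>)" by blast
    qed
  qed simp
  have "AE \<omega> in bernoulli_measure. \<forall>n. \<omega> n \<in> {0, 1}"
    by (rule AE_I2) (auto simp: space_bernoulli_measure)
  moreover have "AE \<omega> in bernoulli_measure. \<forall>n :: int. \<exists>i\<ge>n. \<omega> i = 1"
    unfolding AE_all_countable using right by blast
  moreover have "AE \<omega> in bernoulli_measure. \<forall>n :: int. \<exists>i<n. \<omega> i = 1"
    unfolding AE_all_countable using left by blast
  moreover have "AE \<omega> in bernoulli_measure. \<forall>k\<ge>1. \<exists>m. (m, k) \<in> chain_blocks \<omega>"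
    unfolding AE_all_countable using block by blast
  ultimately show ?thesis
    by eventually_elim (simp add: typical_def)
qed

text \<open>If two blocks sharing a site differed, a cut bond of one would be an intact bond of the
  other.\<close>

lemma chain_blocks_disjoint:
  assumes "(m, k) \<in> chain_blocks \<omega>" "j < k" "(m', k') \<in> chain_blocks \<omega>" "i < k'"
    and eq: "m + int j = m' + int i"
  shows "m = m' \<and> k = k' \<and> j = i"
proof -
  have *: "\<not> m < m'" if "(m, k) \<in> chain_blocks \<omega>" "j < k" "(m', k') \<in> chain_blocks \<omega>" "i < k'"
    "m + int j = m' + int i" for m k m' k' j i
  proof
    assume "m < m'"
    then have "m' - 1 \<in> {m..m + int k - 2}" using that by auto
    then have "\<omega> (m' - 1) = 0" using that(1) by (auto simp: chain_blocks_def)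
    then show False using that(3) by (simp add: chain_blocks_def)
  qed
  have m: "m = m'" using *[OF assms] *[OF assms(3,4,1,2) eq[symmetric]] by linarith
  have **: "\<not> k < k'" if "(m, k) \<in> chain_blocks \<omega>" "(m, k') \<in> chain_blocks \<omega>" for k k'
  proof
    assume "k < k'"
    then have "m + int k - 1 \<in> {m..m + int k' - 2}" using that by (auto simp: chain_blocks_def)
    then have "\<omega> (m + int k - 1) = 0" using that(2) by (auto simp: chain_blocks_def)
    then show False using that(1) by (simp add: chain_blocks_def)
  qed
  have "k = k'" using **[of k k'] **[of k' k] assms m by auto
  then show ?thesis using m eq by simp
qed

lemma site_in_chain_block:
  assumes "typical \<omega>"
  shows "\<exists>m k j. (m, k) \<in> chain_blocks \<omega> \<and> j < k \<and> n = m + int j"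
proof -
  have vals: "\<omega> i = 0 \<or> \<omega> i = 1" for i using assms by (auto simp: typical_def)
  obtain i where "i \<ge> n" "\<omega> i = 1" using assms unfolding typical_def by blast
  then have "\<omega> (n + int (nat (i - n))) = 1" by simp
  then have r: "\<exists>t. \<omega> (n + int t) = 1" by blast
  define t where "t = (LEAST t. \<omega> (n + int t) = 1)"
  have t: "\<omega> (n + int t) = 1" "\<And>s. s < t \<Longrightarrow> \<omega> (n + int s) \<noteq> 1"
    unfolding t_def using LeastI_ex[OF r] by (auto dest: not_less_Least)
  obtain i where "i < n" "\<omega> i = 1" using assms unfolding typical_def by blast
  then have "\<omega> (n - 1 - int (nat (n - 1 - i))) = 1" by simp
  then have l: "\<exists>t. \<omega> (n - 1 - int t) = 1" by blast
  define l where "l = (LEAST t. \<omega> (n - 1 - int t) = 1)"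
  have l: "\<omega> (n - 1 - int l) = 1" "\<And>s. s < l \<Longrightarrow> \<omega> (n - 1 - int s) \<noteq> 1"
    unfolding l_def using LeastI_ex[OF l] by (auto dest: not_less_Least)
  have "\<omega> i = 0" if "i \<in> {n - int l..n + int t - 1}" for i
  proof (cases "i \<ge> n")
    case True
    then have "\<omega> (n + int (nat (i - n))) \<noteq> 1" using that by (intro t(2)) auto
    then show ?thesis using True vals[of i] by simp
  next
    case False
    then have "\<omega> (n - 1 - int (nat (n - 1 - i))) \<noteq> 1" using that by (intro l(2)) auto
    then show ?thesis using False vals[of i] by simp
  qed
  \<comment> \<open>\<open>t\<close> and \<open>l\<close> count the intact bonds from
    \<open>n\<close> to the nearest cut on either side; with site \<open>n\<close> itself this makes
    \<open>l + t + 1\<close> sites.\<close>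
  then have "(n - int l, l + t + 1) \<in> chain_blocks \<omega>"
    using l(1) t(1) by (auto simp: chain_blocks_def algebra_simps)
  then show ?thesis by (intro exI[of _ "n - int l"] exI[of _ "l + t + 1"] exI[of _ l]) auto
qed

lemma Rep_H_op:
  "Rep_ell2 (H_op \<mu> \<omega> u) n = of_real (1 + (- 1) ^ \<omega> (n - 1)) * Rep_ell2 u (n - 1)
    + of_real (\<mu> * (- 1) ^ (\<omega> n + 1)) * Rep_ell2 u n + of_real (1 + (- 1) ^ \<omega> n) * Rep_ell2 u (n + 1)"
  by (simp add: H_op.rep_eq f_coeff_def g_coeff_def shift_power_apply)

definition site_vec :: "int \<times> nat \<Rightarrow> nat \<Rightarrow> int ell2" where
  "site_vec = (\<lambda>(m, k) j. delta (m + int j))"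

lemma site_vec_apply [simp]: "site_vec (m, k) j = delta (m + int j)"
  by (simp add: site_vec_def)

text \<open>Only the last site \<open>n\<close> of a block has \<open>\<omega> n = 1\<close>. This
  kills the hopping to the right and at the same time turns the potential from -\<mu> into
  \<mu>.\<close>

lemma H_op_block_operator:
  assumes \<omega>: "typical \<omega>"
  shows "block_operator (chain_blocks \<omega>) snd site_vec (H_op \<mu> \<omega>) \<mu>"
proof
  fix \<beta> assume "\<beta> \<in> chain_blocks \<omega>"
  then show "snd \<beta> \<ge> 1" by (auto simp: chain_blocks_def)
next
  fix \<beta> j \<gamma> i assume "\<beta> \<in> chain_blocks \<omega>" "j < snd \<beta>" "\<gamma> \<in> chain_blocks \<omega>" "i < snd \<gamma>"
  then show "cinner (site_vec \<beta> j) (site_vec \<gamma> i) = (if \<beta> = \<gamma> \<and> j = i then 1 else 0)"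
    using chain_blocks_disjoint[of "fst \<beta>" "snd \<beta>" \<omega> j "fst \<gamma>" "snd \<gamma>" i]
    by (cases \<beta>; cases \<gamma>) (auto simp: cinner_delta_delta)
next
  fix u assume u: "\<And>\<beta> j. \<beta> \<in> chain_blocks \<omega> \<Longrightarrow> j < snd \<beta> \<Longrightarrow> cinner u (site_vec \<beta> j) = 0"
  show "u = 0"
  proof (rule ell2_eqI)
    fix n
    obtain m k j where "(m, k) \<in> chain_blocks \<omega>" "j < k" "n = m + int j"
      using site_in_chain_block[OF \<omega>] by blast
    then show "Rep_ell2 u n = Rep_ell2 0 n"
      using u[of "(m, k)" j] by (simp add: cinner_delta zero_ell2.rep_eq)
  qed
next
  fix \<beta> j u assume \<beta>: "\<beta> \<in> chain_blocks \<omega>" and j: "j < snd \<beta>"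
  obtain m k where b: "\<beta> = (m, k)" by (cases \<beta>)
  have left: "\<omega> (m + int j - 1) = (if j = 0 then 1 else 0)"
    using \<beta> j by (auto simp: b chain_blocks_def)
  have right: "\<omega> (m + int j) = (if Suc j = k then 1 else 0)"
  proof (cases "Suc j = k")
    case True
    have "\<omega> (m + int k - 1) = 1" using \<beta> by (simp add: b chain_blocks_def)
    moreover have "m + int k - 1 = m + int j" using True by simp
    ultimately show ?thesis using True by simp
  qed (use \<beta> j in \<open>auto simp: b chain_blocks_def\<close>)
  show "cinner (H_op \<mu> \<omega> u) (site_vec \<beta> j) = 2 * (if j = 0 then 0 else cinner u (site_vec \<beta> (j - 1)))
      + complex_of_real (if Suc j = snd \<beta> then \<mu> else - \<mu>) * cinner u (site_vec \<beta> j)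
      + 2 * (if Suc j = snd \<beta> then 0 else cinner u (site_vec \<beta> (Suc j)))"
  proof -
    define p q where "p = Rep_ell2 u (m + int j - 1)" and "q = Rep_ell2 u (m + int j + 1)"
    have prev: "(if j = 0 then 0 else Rep_ell2 u (m + int (j - 1))) = (if j = 0 then 0 else p)"
      by (cases j) (simp_all add: p_def)
    have "m + int (Suc j) = m + int j + 1" by simp
    then have succ: "Rep_ell2 u (m + int (Suc j)) = q" by (simp only: q_def)
    show ?thesis
      unfolding b site_vec_apply cinner_delta Rep_H_op left right snd_conv prev succ
        p_def[symmetric] q_def[symmetric]
      by simp
  qed
qed

lemma chain_blocks_measure:
  assumes "k \<ge> 1"
  shows chain_blocks_sets: "{\<omega> \<in> space bernoulli_measure. (m, k) \<in> chain_blocks \<omega>} \<in> sets bernoulli_measure"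
    and emeasure_chain_blocks:
      "emeasure bernoulli_measure {\<omega> \<in> space bernoulli_measure. (m, k) \<in> chain_blocks \<omega>} = ennreal (1 / 2 ^ (k + 1))"
proof -
  define x :: "int \<Rightarrow> nat" where "x i = (if i = m - 1 \<or> i = m + int k - 1 then 1 else 0)" for i
  have "(m, k) \<in> chain_blocks \<omega> \<longleftrightarrow> (\<forall>i\<in>{m - 1..m + int k - 1}. \<omega> i = x i)" for \<omega>
    using assms by (auto simp: chain_blocks_def x_def)
  then have eq: "{\<omega> \<in> space bernoulli_measure. (m, k) \<in> chain_blocks \<omega>}
      = {\<omega> \<in> space bernoulli_measure. \<forall>i\<in>{m - 1..m + int k - 1}. \<omega> i = x i}" by simp
  have x: "x i \<in> {0, 1}" for i by (simp add: x_def)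
  have card: "card {m - 1..m + int k - 1} = k + 1" by (simp add: nat_add_distrib)
  show "{\<omega> \<in> space bernoulli_measure. (m, k) \<in> chain_blocks \<omega>} \<in> sets bernoulli_measure"
    unfolding eq by (rule cylinder_sets[OF finite_atLeastAtMost_int x])
  show "emeasure bernoulli_measure {\<omega> \<in> space bernoulli_measure. (m, k) \<in> chain_blocks \<omega>} = ennreal (1 / 2 ^ (k + 1))"
    unfolding eq emeasure_cylinder[OF finite_atLeastAtMost_int x] card power_one_over ..
qed

lemma spectrum_H_op:
  assumes \<omega>: "typical \<omega>"
  shows "spectrum (H_op \<mu> \<omega>) = closure (complex_of_real ` (\<Union>k\<in>{1..}. jacobi_roots \<mu> k))"
    and pure_point_H_op: "pure_point (H_op \<mu> \<omega>)"
proof -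
  interpret block_operator "chain_blocks \<omega>" snd site_vec "H_op \<mu> \<omega>" \<mu>
    by (rule H_op_block_operator[OF \<omega>])
  have "snd ` chain_blocks \<omega> = {1..}"
  proof safe
    fix k :: nat assume "k \<ge> 1"
    then obtain m where "(m, k) \<in> chain_blocks \<omega>" using \<omega> unfolding typical_def by blast
    then show "k \<in> snd ` chain_blocks \<omega>" by force
  qed (auto simp: chain_blocks_def)
  moreover have "(\<Union>\<beta>\<in>chain_blocks \<omega>. jacobi_roots \<mu> (snd \<beta>)) = (\<Union>k\<in>snd ` chain_blocks \<omega>. jacobi_roots \<mu> k)"
    by simp
  ultimately show "spectrum (H_op \<mu> \<omega>) = closure (complex_of_real ` (\<Union>k\<in>{1..}. jacobi_roots \<mu> k))"
    unfolding spectrum_eq eigenvalues_block by simp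
  show "pure_point (H_op \<mu> \<omega>)" by (rule pure_point)
qed

lemma spectrum_M_op: "spectrum (M_op \<mu>) = closure (eigenvalues (M_op \<mu>))"
  by (rule M.spectrum_eq)

text \<open>Exactly one pair \<open>(k, j)\<close> contributes, but the sum over all pairs lets
  \<open>\<omega>\<close> enter only through events with finitely many coins, so it can be
  integrated term by term.\<close>

lemma emeasure_spectral_measure_H_op:
  assumes \<omega>: "typical \<omega>" and B: "B \<in> sets borel"
  shows "emeasure (spectral_measure (H_op \<mu> \<omega>) (delta 0)) B
    = suminf (\<lambda>k. \<Sum>j<k. ennreal (jacobi_measure \<mu> k j B) * of_bool ((- int j, k) \<in> chain_blocks \<omega>))"
proof -
  interpret block_operator "chain_blocks \<omega>" snd site_vec "H_op \<mu> \<omega>" \<mu>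
    by (rule H_op_block_operator[OF \<omega>])
  obtain m k j where mkj: "(m, k) \<in> chain_blocks \<omega>" "j < k" "0 = m + int j"
    using site_in_chain_block[OF \<omega>, of 0] by blast
  have only: "(- int j', k') \<in> chain_blocks \<omega> \<longleftrightarrow> k' = k \<and> j' = j" if "j' < k'" for j' k'
  proof -
    have m: "m = - int j" using mkj(3) by simp
    show ?thesis
      using chain_blocks_disjoint[OF mkj(1,2), of "- int j'" k' j'] mkj(1,2) that unfolding m by auto
  qed
  have step: "(\<Sum>j<k'. ennreal (jacobi_measure \<mu> k' j B) * of_bool ((- int j, k') \<in> chain_blocks \<omega>))
      = (if k' = k then ennreal (jacobi_measure \<mu> k j B) else 0)" for k'
  proof -
    have "(\<Sum>j'<k'. ennreal (jacobi_measure \<mu> k' j' B) * of_bool ((- int j', k') \<in> chain_blocks \<omega>))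
        = (\<Sum>j'<k'. if j' = j then if k' = k then ennreal (jacobi_measure \<mu> k j B) else 0 else 0)"
      by (intro sum.cong refl) (auto simp: only)
    then show ?thesis using mkj(2) by auto
  qed
  have "suminf (\<lambda>k. \<Sum>j<k. ennreal (jacobi_measure \<mu> k j B) * of_bool ((- int j, k) \<in> chain_blocks \<omega>))
      = ennreal (jacobi_measure \<mu> k j B)"
    unfolding step by (rule sums_unique[OF sums_single, symmetric])
  moreover have "emeasure (spectral_measure (H_op \<mu> \<omega>) (site_vec (m, k) j)) B = ennreal (jacobi_measure \<mu> (snd (m, k)) j B)"
    using mkj by (intro emeasure_spectral_measure_phi B) auto
  ultimately show ?thesis using mkj(3) by simp
qed

section \<open>Averaging over the coin tosses\<close>

lemma ennreal_infsum:
  assumes "f summable_on A" "\<And>x. x \<in> A \<Longrightarrow> f x \<ge> (0 :: real)"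
  shows "ennreal (infsum f A) = (\<Sum>\<^sub>\<infinity>x\<in>A. ennreal (f x))"
proof -
  have "ennreal (infsum f A) = (SUP F\<in>{F. finite F \<and> F \<subseteq> A}. ennreal (sum f F))"
    by (rule infsum_nonneg_is_SUPREMUM_ennreal[OF assms])
  also have "\<dots> = (SUP F\<in>{F. finite F \<and> F \<subseteq> A}. \<Sum>x\<in>F. ennreal (f x))"
    using assms(2) by (intro SUP_cong refl sum_ennreal[symmetric]) auto
  also have "\<dots> = (\<Sum>\<^sub>\<infinity>x\<in>A. ennreal (f x))"
    by (rule nonneg_infsum_complete[symmetric]) simp
  finally show ?thesis .
qed

definition root_weight :: "real \<Rightarrow> real set \<Rightarrow> nat \<Rightarrow> real" where
  "root_weight \<mu> B k = (\<Sum>r\<in>jacobi_roots \<mu> k. indicator B r) / 2 ^ (k + 1)"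

lemma root_weight_nonneg: "root_weight \<mu> B k \<ge> 0"
  unfolding root_weight_def by (intro divide_nonneg_pos sum_nonneg) auto

lemma spectral_measure_M_op:
  assumes "B \<in> sets borel"
  shows "emeasure (spectral_measure (M_op \<mu>) (delta \<one>\<^bsub>lamplighter\<^esub>)) B
      = ennreal (infsum (root_weight \<mu> B) {1..})"
    and summable_root_weight: "root_weight \<mu> B summable_on {1..}"
  using emeasure_spectral_measure_M_op[OF assms, of \<mu>] unfolding root_weight_def[abs_def] by simp_all

lemma nn_integral_spectral_measure_H_op:
  assumes B: "B \<in> sets borel"
  shows "(\<integral>\<^sup>+\<omega>. emeasure (spectral_measure (H_op \<mu> \<omega>) (delta 0)) B \<partial>bernoulli_measure)
    = emeasure (spectral_measure (M_op \<mu>) (delta \<one>\<^bsub>lamplighter\<^esub>)) B"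
proof -
  let ?Ev = "\<lambda>k j. {\<omega> \<in> space bernoulli_measure. (- int j, k) \<in> chain_blocks \<omega>}"
  let ?m = "\<lambda>k j. jacobi_measure \<mu> k j B"
  let ?c = "\<lambda>k. (\<Sum>j<k. ?m k j) / 2 ^ (k + 1)"
  have c: "?c k = root_weight \<mu> B k" if "k \<ge> 1" for k
    by (simp only: root_weight_def sum_jacobi_measure[OF that])
  have "(\<integral>\<^sup>+\<omega>. emeasure (spectral_measure (H_op \<mu> \<omega>) (delta 0)) B \<partial>bernoulli_measure)
    = (\<integral>\<^sup>+\<omega>. suminf (\<lambda>k. \<Sum>j<k. ennreal (?m k j) * indicator (?Ev k j) \<omega>) \<partial>bernoulli_measure)"
  proof (rule nn_integral_cong_AE)
    show "AE \<omega> in bernoulli_measure. emeasure (spectral_measure (H_op \<mu> \<omega>) (delta 0)) B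
        = suminf (\<lambda>k. \<Sum>j<k. ennreal (?m k j) * indicator (?Ev k j) \<omega>)"
      using AE_typical AE_space
      by eventually_elim (simp add: emeasure_spectral_measure_H_op[OF _ B] indicator_def)
  qed
  also have "\<dots> = suminf (\<lambda>k. \<integral>\<^sup>+\<omega>. (\<Sum>j<k. ennreal (?m k j) * indicator (?Ev k j) \<omega>) \<partial>bernoulli_measure)"
    by (rule nn_integral_suminf) (intro borel_measurable_sum borel_measurable_times_ennreal
        borel_measurable_const borel_measurable_indicator, simp add: chain_blocks_sets)
  also have "\<dots> = suminf (\<lambda>k. ennreal (?c k))"
  proof (rule suminf_cong)
    fix k
    have "(\<integral>\<^sup>+\<omega>. (\<Sum>j<k. ennreal (?m k j) * indicator (?Ev k j) \<omega>) \<partial>bernoulli_measure)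
        = (\<Sum>j<k. \<integral>\<^sup>+\<omega>. ennreal (?m k j) * indicator (?Ev k j) \<omega> \<partial>bernoulli_measure)"
      by (rule nn_integral_sum) (intro borel_measurable_times_ennreal
        borel_measurable_const borel_measurable_indicator, simp add: chain_blocks_sets)
    also have "\<dots> = (\<Sum>j<k. ennreal (?m k j / 2 ^ (k + 1)))"
    \<comment> \<open>The probability of each event is the same for every place \<open>j\<close> of
      the origin, so the sum over \<open>j\<close> becomes a trace.\<close>
    proof (intro sum.cong refl)
      fix j assume "j \<in> {..<k}"
      then have "(\<integral>\<^sup>+\<omega>. ennreal (?m k j) * indicator (?Ev k j) \<omega> \<partial>bernoulli_measure)
          = ennreal (?m k j) * ennreal (1 / 2 ^ (k + 1))"
        by (subst nn_integral_cmult_indicator) (auto simp: chain_blocks_sets emeasure_chain_blocks)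
      then show "(\<integral>\<^sup>+\<omega>. ennreal (?m k j) * indicator (?Ev k j) \<omega> \<partial>bernoulli_measure)
          = ennreal (?m k j / 2 ^ (k + 1))"
        by (simp add: ennreal_mult[symmetric] jacobi_measure_nonneg)
    qed
    also have "\<dots> = ennreal (?c k)"
      by (subst sum_ennreal) (auto simp: jacobi_measure_nonneg sum_divide_distrib)
    finally show "(\<integral>\<^sup>+\<omega>. (\<Sum>j<k. ennreal (?m k j) * indicator (?Ev k j) \<omega>) \<partial>bernoulli_measure) = ennreal (?c k)" .
  qed
  also have "\<dots> = ennreal (infsum ?c UNIV)"
  proof -
    have "?c summable_on {1..}"
      by (rule summable_on_cong[THEN iffD1, OF c[symmetric] summable_root_weight[OF B]]) simp
    \<comment> \<open>The term for \<open>k = 0\<close> is an empty sum, hence 0.\<close>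
    then have "?c summable_on UNIV"
      by (rule summable_on_cong_neutral[THEN iffD1, rotated -1]) (auto simp: not_le)
    then have "?c sums infsum ?c UNIV" by (intro has_sum_imp_sums has_sum_infsum)
    then show ?thesis
      by (subst suminf_ennreal2) (auto simp: sums_iff jacobi_measure_nonneg intro!: divide_nonneg_pos sum_nonneg)
  qed
  also have "infsum ?c UNIV = infsum (root_weight \<mu> B) {1..}"
  proof (rule infsum_cong_neutral)
    fix k :: nat assume "k \<in> UNIV \<inter> {1..}"
    then show "?c k = root_weight \<mu> B k" by (intro c) simp
  qed (auto simp: not_le)
  finally show ?thesis unfolding spectral_measure_M_op[OF B] .
qed

text \<open>A measure formed by \<open>measure_of\<close> depends only on its set function on the
  sigma-algebra; agreement with a genuine measure also supplies countable additivity.\<close>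

lemma density_of_states_eq: "density_of_states \<mu> = spectral_measure (M_op \<mu>) (delta \<one>\<^bsub>lamplighter\<^esub>)"
proof -
  let ?N = "spectral_measure (M_op \<mu>) (delta \<one>\<^bsub>lamplighter\<^esub>)"
  have sets: "sets ?N = sets borel" by (rule M.sets_spectral_measure)
  have "density_of_states \<mu> = measure_of UNIV (sets borel) (emeasure ?N)"
    unfolding density_of_states_def
  proof (rule measure_of_eq)
    fix B assume "B \<in> sigma_sets UNIV (sets (borel :: real measure))"
    then have "B \<in> sets borel" using sets.sigma_sets_eq[of "borel :: real measure"] by simp
    then show "(\<integral>\<^sup>+\<omega>. emeasure (spectral_measure (H_op \<mu> \<omega>) (delta 0)) B \<partial>bernoulli_measure) = emeasure ?N B"
      by (rule nn_integral_spectral_measure_H_op)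
  qed simp
  also have "\<dots> = ?N"
    using measure_of_of_measure[of ?N] sets_eq_imp_space_eq[OF sets] by (simp add: sets)
  finally show ?thesis .
qed

text \<open>The separate first term is the block with one site, whose only eigenvalue is \<mu> and
  whose weight is 1/2^2. Simplicity of the roots turns the sums with multiplicity into sums over
  sets.\<close>

lemma emeasure_density_of_states:
  assumes B: "B \<in> sets borel"
  shows "emeasure (density_of_states \<mu>) B = ennreal (1 / 4) * emeasure (return borel \<mu>) B +
    (\<Sum>\<^sub>\<infinity>k\<in>{2..}. ennreal (1 / 2 ^ (k + 1)) * (\<Sum>s\<in>#proots (G_poly k \<mu>). emeasure (return borel s) B))"
proof -
  have one: "{1 :: nat..} = insert 1 {2..}" by auto
  have sum2: "root_weight \<mu> B summable_on {2..}"
    by (rule summable_on_subset_banach[OF summable_root_weight[OF B]]) auto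
  have "infsum (root_weight \<mu> B) {1..} = root_weight \<mu> B 1 + infsum (root_weight \<mu> B) {2..}"
    unfolding one by (rule infsum_insert[OF sum2]) simp
  then have "emeasure (density_of_states \<mu>) B = ennreal (root_weight \<mu> B 1) + ennreal (infsum (root_weight \<mu> B) {2..})"
    unfolding density_of_states_eq spectral_measure_M_op[OF B]
    by (simp add: ennreal_plus[symmetric] root_weight_nonneg infsum_nonneg del: ennreal_plus)
  also have "ennreal (infsum (root_weight \<mu> B) {2..}) = (\<Sum>\<^sub>\<infinity>k\<in>{2..}. ennreal (root_weight \<mu> B k))"
    by (rule ennreal_infsum[OF sum2 root_weight_nonneg])
  also have "\<dots> = (\<Sum>\<^sub>\<infinity>k\<in>{2..}. ennreal (1 / 2 ^ (k + 1)) *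
      (\<Sum>s\<in>#proots (G_poly k \<mu>). emeasure (return borel s) B))"
  proof (rule infsum_cong)
    fix k :: nat assume "k \<in> {2..}"
    then have k: "k \<ge> 1" by simp
    have "(\<Sum>s\<in>#proots (G_poly k \<mu>). emeasure (return borel s) B) = (\<Sum>s\<in>jacobi_roots \<mu> k. indicator B s)"
      using B by (simp add: proots_G_poly[OF k] sum_unfold_sum_mset)
    also have "\<dots> = ennreal (\<Sum>s\<in>jacobi_roots \<mu> k. indicator B s)"
      by (subst sum_ennreal[symmetric]) (simp_all add: ennreal_indicator)
    finally show "ennreal (root_weight \<mu> B k) = ennreal (1 / 2 ^ (k + 1)) *
        (\<Sum>s\<in>#proots (G_poly k \<mu>). emeasure (return borel s) B)"
      by (simp add: root_weight_def ennreal_mult[symmetric] sum_nonneg)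
  qed
  also have "ennreal (root_weight \<mu> B 1) = ennreal (1 / 4) * emeasure (return borel \<mu>) B"
  proof -
    have "jacobi_roots \<mu> 1 = {\<mu>}"
      using jacobi_roots_Suc[of \<mu> 0] by (auto simp: jacobi_char_def)
    then show ?thesis
      using B by (simp add: root_weight_def ennreal_indicator[symmetric] ennreal_mult[symmetric] del: ennreal_indicator)
  qed
  finally show ?thesis .
qed

section \<open>Discreteness and the shape of the spectrum\<close>

lemma countable_jacobi_roots: "countable (\<Union>k\<in>{1..}. jacobi_roots \<mu> k)"
  by (rule countable_UN) (simp_all add: countable_finite finite_jacobi_roots)

lemma discrete_density_of_states: "discrete_measure (density_of_states \<mu>)"
proof -
  let ?S = "\<Union>k\<in>{1..}. jacobi_roots \<mu> k"
  note cnt = countable_jacobi_roots[of \<mu>]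
  have sets: "sets (density_of_states \<mu>) = sets borel"
    unfolding density_of_states_eq by (rule M.sets_spectral_measure)
  have space: "space (density_of_states \<mu>) = UNIV"
    using sets_eq_imp_space_eq[OF sets] by simp
  have S: "?S \<in> sets borel" using cnt by (rule sets.countable[rotated]) auto
  have "root_weight \<mu> (UNIV - ?S) k = 0" if "k \<in> {1..}" for k
    unfolding root_weight_def using that by (subst sum.neutral) (auto simp: indicator_def)
  then have "infsum (root_weight \<mu> (UNIV - ?S)) {1..} = 0" by (rule infsum_0)
  then have "emeasure (density_of_states \<mu>) (UNIV - ?S) = 0"
    unfolding density_of_states_eq using S by (subst spectral_measure_M_op) auto
  then show ?thesis
    unfolding discrete_measure_def sets space using S cnt by blast
qed

lemma closed_of_real_Icc: "closed (complex_of_real ` {a..b})"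
  by (intro compact_imp_closed compact_continuous_image continuous_on_of_real continuous_on_id) simp

lemma band_subset_closure:
  "complex_of_real ` {- 4 - \<mu>..4 - \<mu>} \<subseteq>
    closure (complex_of_real ` (\<Union>k\<in>{1..}. jacobi_roots \<mu> k) \<inter> complex_of_real ` {- 4 - \<mu>..4 - \<mu>})"
    (is "_ \<subseteq> closure ?E")
proof -
  have "complex_of_real ` {- 4 - \<mu><..<4 - \<mu>} \<subseteq> closure ?E"
  proof safe
    fix z assume z: "z \<in> {- 4 - \<mu><..<4 - \<mu>}"
    show "complex_of_real z \<in> closure ?E"
      unfolding closure_approachable
    proof (intro allI impI)
      fix \<epsilon> :: real assume "\<epsilon> > 0"
      \<comment> \<open>The distance to both ends of the band is included in the minimum so that the
        root found also lies in the band.\<close>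
      define \<delta> where "\<delta> = min \<epsilon> (min (z - (- 4 - \<mu>)) (4 - \<mu> - z))"
      have "\<delta> > 0" using z \<open>\<epsilon> > 0\<close> by (simp add: \<delta>_def)
      then obtain k r where r: "k \<ge> 1" "r \<in> jacobi_roots \<mu> k" "\<bar>z - r\<bar> < \<delta>"
        using jacobi_roots_dense[OF z] by blast
      then have "r \<in> {- 4 - \<mu>..4 - \<mu>}" "\<bar>r - z\<bar> < \<epsilon>" by (auto simp: \<delta>_def)
      moreover have "dist (complex_of_real r) (complex_of_real z) = \<bar>r - z\<bar>"
        by (simp add: dist_norm flip: of_real_diff)
      ultimately show "\<exists>w\<in>?E. dist w (complex_of_real z) < \<epsilon>"
        using r(1,2) by (intro bexI[of _ "complex_of_real r"]) auto
    qed
  qed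
  \<comment> \<open>Continuity extends the inclusion from the open interval to its two
    endpoints.\<close>
  then have "complex_of_real ` closure {- 4 - \<mu><..<4 - \<mu>} \<subseteq> closure ?E"
    by (intro image_closure_subset continuous_on_of_real continuous_on_id) auto
  then show ?thesis by simp
qed

theorem theorem3:
  fixes \<mu> :: real
  shows
    "(AE \<omega> in bernoulli_measure.
        pure_point (H_op \<mu> \<omega>) \<and> spectrum (H_op \<mu> \<omega>) = spectrum (M_op \<mu>)) \<and>
     spectrum (M_op \<mu>) = closure (eigenvalues (M_op \<mu>)) \<and>
     (\<bar>\<mu>\<bar> \<le> 1 \<longrightarrow> spectrum (M_op \<mu>) = complex_of_real ` {- 4 - \<mu>..4 - \<mu>}) \<and>
     (\<bar>\<mu>\<bar> > 1 \<longrightarrow>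
        countable (eigenvalues (M_op \<mu>)) \<and>
        complex_of_real ` {- 4 - \<mu>..4 - \<mu>}
          \<subseteq> closure (eigenvalues (M_op \<mu>) \<inter> complex_of_real ` {- 4 - \<mu>..4 - \<mu>}) \<and>
        complex_of_real (\<mu> + 2 / \<mu>) islimpt eigenvalues (M_op \<mu>) \<and>
        \<mu> + 2 / \<mu> \<notin> {- 4 - \<mu>..4 - \<mu>}) \<and>
     discrete_measure (density_of_states \<mu>) \<and>
     (\<forall>B\<in>sets borel. emeasure (density_of_states \<mu>) B =
        ennreal (1 / 4) * emeasure (return borel \<mu>) B +
        (\<Sum>\<^sub>\<infinity>k\<in>{2..}. ennreal (1 / 2 ^ (k + 1)) *
          (\<Sum>s\<in>#proots (G_poly k \<mu>). emeasure (return borel s) B))) \<and>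
     density_of_states \<mu> = spectral_measure (M_op \<mu>) (delta \<one>\<^bsub>lamplighter\<^esub>)"
proof (intro conjI impI ballI)
  show "AE \<omega> in bernoulli_measure. pure_point (H_op \<mu> \<omega>) \<and> spectrum (H_op \<mu> \<omega>) = spectrum (M_op \<mu>)"
    using AE_typical
    by eventually_elim (simp add: pure_point_H_op spectrum_H_op spectrum_M_op eigenvalues_M_op)
  show "spectrum (M_op \<mu>) = complex_of_real ` {- 4 - \<mu>..4 - \<mu>}" if "\<bar>\<mu>\<bar> \<le> 1"
  proof (rule antisym)
    have "(\<Union>k\<in>{1..}. jacobi_roots \<mu> k) \<subseteq> {- 4 - \<mu>..4 - \<mu>}"
      using jacobi_roots_subset[OF that] by (intro UN_least) simp
    then show "spectrum (M_op \<mu>) \<subseteq> complex_of_real ` {- 4 - \<mu>..4 - \<mu>}"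
      unfolding spectrum_M_op eigenvalues_M_op
      by (intro closure_minimal image_mono closed_of_real_Icc)
    show "complex_of_real ` {- 4 - \<mu>..4 - \<mu>} \<subseteq> spectrum (M_op \<mu>)"
      unfolding spectrum_M_op eigenvalues_M_op
      by (rule order_trans[OF band_subset_closure]) (intro closure_mono Int_lower1)
  qed
  show "countable (eigenvalues (M_op \<mu>))"
    unfolding eigenvalues_M_op by (intro countable_image countable_jacobi_roots)
  show "complex_of_real ` {- 4 - \<mu>..4 - \<mu>}
      \<subseteq> closure (eigenvalues (M_op \<mu>) \<inter> complex_of_real ` {- 4 - \<mu>..4 - \<mu>})"
    unfolding eigenvalues_M_op by (rule band_subset_closure)
  show "complex_of_real (\<mu> + 2 / \<mu>) islimpt eigenvalues (M_op \<mu>)" if \<mu>: "\<bar>\<mu>\<bar> > 1"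
    unfolding islimpt_approachable
  proof (intro allI impI)
    fix \<epsilon> :: real assume "\<epsilon> > 0"
    then obtain k r where r: "k \<ge> 1" "r \<in> jacobi_roots \<mu> k" "\<bar>\<mu> + 2 / \<mu> - r\<bar> < \<epsilon>"
      using jacobi_roots_edge(2)[OF \<mu>] by blast
    then have "r \<noteq> \<mu> + 2 / \<mu>" using jacobi_roots_edge(1)[OF \<mu>] by blast
    moreover have "dist (complex_of_real r) (complex_of_real (\<mu> + 2 / \<mu>)) = \<bar>\<mu> + 2 / \<mu> - r\<bar>"
      unfolding dist_norm of_real_diff[symmetric] norm_of_real by (rule abs_minus_commute)
    ultimately show "\<exists>w\<in>eigenvalues (M_op \<mu>). w \<noteq> complex_of_real (\<mu> + 2 / \<mu>) \<and> dist w (complex_of_real (\<mu> + 2 / \<mu>)) < \<epsilon>"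
      unfolding eigenvalues_M_op using r of_real_eq_iff by (intro bexI[of _ "complex_of_real r"] conjI) auto
  qed
qed (fact spectrum_M_op edge_notin_band discrete_density_of_states emeasure_density_of_states density_of_states_eq)+

end
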